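(* Let $n$ be an integer with $n\ge 3$ and $n\neq 4$, let $l,r$ be nonzero complex numbers, and assume that $(r^2)^k\neq 1$ for every $k\in\{1,\dots,n\}$. There exists an irreducible $(n-1)$-dimensional invariant subspace of the Lawrence-Krammer space $\mathcal V^{(n)}$ if and only if $l\in\{\frac{1}{r^{n-3}},-\frac{1}{r^{n-3}}\}$. If so, it is unique.
   Context: Let $l,r$ be nonzero complex numbers with $r^2\ne1$, $m=\frac1r-r$ and $F=\mathbb{Q}(l,r)\subset\mathbb{C}$. The BMW algebra $B(A_{n-1})$ is the unital associative $F$-algebra generated by invertible elements $g_1,\dots,g_{n-1}$, with $e_i:=\frac{l}{m}(g_i^2+m g_i-1)$, subject to: $g_ig_j=g_jg_i$ for $|i-j|\ge2$; $g_ig_{i+1}g_i=g_{i+1}g_ig_{i+1}$; $g_ie_i=l^{-1}e_i$; $e_ig_{i+1}e_i=l e_i$; $e_ig_{i-1}e_i=l e_i$ (whenever the indices make sense). The Lawrence-Krammer space $\mathcal V^{(n)}$ is the $F$-vector space with basis $\{w_{ij}:1\le i<j\le n\}$. It is a $B(A_{n-1})$-module, $g_k$ acting by the endomorphism $\nu_k$ defined, for $1\le k\le n-1$, by: - $\nu_k(w_{ij})=r\,w_{ij}$ if $\{i,j\}\cap\{k,k+1\}=\emptyset$; - $\nu_k(w_{k,k+1})=l^{-1}w_{k,k+1}$; - $\nu_k(w_{k,j})=w_{k+1,j}$ for $j\ge k+2$; - $\nu_k(w_{k+1,j})=w_{k,j}+m\,r^{j-k-2}\,w_{k,k+1}-m\,w_{k+1,j}$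 for $j\ge k+2$; - $\nu_k(w_{i,k})=w_{i,k+1}$ for $i\le k-1$; - $\nu_k(w_{i,k+1})=w_{i,k}+\frac{m}{l\,r^{k-1-i}}\,w_{k,k+1}-m\,w_{i,k+1}$ for $i\le k-1$. Invariant subspaces are $F$-subspaces stable under $B(A_{n-1})$; an invariant subspace is irreducible if it is nonzero and contains no invariant subspaces other than $0$ and itself; dimensions are over $F$. *)

theory Defs
  imports
    "HOL-Algebra.Generated_Fields"
    "Jordan_Normal_Form.VS_Connect"
begin

definition bmw_field :: "complex \<Rightarrow> complex \<Rightarrow> complex ring" where
  "bmw_field l r = class_ring\<lparr>carrier := generate_field class_ring {l, r}\<rparr>"

definition bmw_m :: "complex \<Rightarrow> complex" where
  "bmw_m r = 1 / r - r"


section \<open>The BMW algebra\<close>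

text \<open>
  The algebra is given by its presentation: noncommutative expressions over the field in the
  generators \<open>g\<^sub>1, \<dots>, g\<^sub>n\<^sub>-\<^sub>1\<close> and their inverses, modulo the least congruence containing the
  laws of a unital associative algebra and the defining relations.
\<close>

datatype bmw_expr =
    Gen nat
  | GenInv nat
  | Const complex
  | Plus bmw_expr bmw_expr
  | Times bmw_expr bmw_expr

inductive_set bmw_exprs :: "nat \<Rightarrow> complex \<Rightarrow> complex \<Rightarrow> bmw_expr set"
  for n :: nat and l r :: complex where
  Gen: "1 \<le> k \<Longrightarrow> k \<le> n - 1 \<Longrightarrow> Gen k \<in> bmw_exprs n l r"
| GenInv: "1 \<le> k \<Longrightarrow> k \<le> n - 1 \<Longrightarrow> GenInv k \<in> bmw_exprs n l r"
| Const: "c \<in> carrier (bmw_field l r) \<Longrightarrow> Const c \<in> bmw_exprs n l r"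
| Plus: "s \<in> bmw_exprs n l r \<Longrightarrow> t \<in> bmw_exprs n l r \<Longrightarrow> Plus s t \<in> bmw_exprs n l r"
| Times: "s \<in> bmw_exprs n l r \<Longrightarrow> t \<in> bmw_exprs n l r \<Longrightarrow> Times s t \<in> bmw_exprs n l r"

definition bmw_e :: "complex \<Rightarrow> complex \<Rightarrow> nat \<Rightarrow> bmw_expr" where
  "bmw_e l r i = Times (Const (l / bmw_m r))
     (Plus (Plus (Times (Gen i) (Gen i)) (Times (Const (bmw_m r)) (Gen i))) (Const (- 1)))"

inductive bmw_cong :: "nat \<Rightarrow> complex \<Rightarrow> complex \<Rightarrow> bmw_expr \<Rightarrow> bmw_expr \<Rightarrow> bool"
  for n :: nat and l r :: complex where
  refl: "s \<in> bmw_exprs n l r \<Longrightarrow> bmw_cong n l r s s"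
| sym: "bmw_cong n l r s t \<Longrightarrow> bmw_cong n l r t s"
| trans: "bmw_cong n l r s t \<Longrightarrow> bmw_cong n l r t u \<Longrightarrow> bmw_cong n l r s u"
| Plus: "bmw_cong n l r s s' \<Longrightarrow> bmw_cong n l r t t' \<Longrightarrow> bmw_cong n l r (Plus s t) (Plus s' t')"
| Times: "bmw_cong n l r s s' \<Longrightarrow> bmw_cong n l r t t' \<Longrightarrow> bmw_cong n l r (Times s t) (Times s' t')"

| add_assoc: "\<lbrakk>s \<in> bmw_exprs n l r; t \<in> bmw_exprs n l r; u \<in> bmw_exprs n l r\<rbrakk>
    \<Longrightarrow> bmw_cong n l r (Plus (Plus s t) u) (Plus s (Plus t u))"
| add_comm: "\<lbrakk>s \<in> bmw_exprs n l r; t \<in> bmw_exprs n l r\<rbrakk>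
    \<Longrightarrow> bmw_cong n l r (Plus s t) (Plus t s)"
| add_zero: "s \<in> bmw_exprs n l r \<Longrightarrow> bmw_cong n l r (Plus (Const 0) s) s"
| add_neg: "s \<in> bmw_exprs n l r
    \<Longrightarrow> bmw_cong n l r (Plus s (Times (Const (- 1)) s)) (Const 0)"
| mult_assoc: "\<lbrakk>s \<in> bmw_exprs n l r; t \<in> bmw_exprs n l r; u \<in> bmw_exprs n l r\<rbrakk>
    \<Longrightarrow> bmw_cong n l r (Times (Times s t) u) (Times s (Times t u))"
| mult_one: "s \<in> bmw_exprs n l r \<Longrightarrow> bmw_cong n l r (Times (Const 1) s) s"
| distrib_left: "\<lbrakk>s \<in> bmw_exprs n l r; t \<in> bmw_exprs n l r; u \<in> bmw_exprs n l r\<rbrakk>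
    \<Longrightarrow> bmw_cong n l r (Times s (Plus t u)) (Plus (Times s t) (Times s u))"
| distrib_right: "\<lbrakk>s \<in> bmw_exprs n l r; t \<in> bmw_exprs n l r; u \<in> bmw_exprs n l r\<rbrakk>
    \<Longrightarrow> bmw_cong n l r (Times (Plus s t) u) (Plus (Times s u) (Times t u))"
| Const_add: "\<lbrakk>a \<in> carrier (bmw_field l r); b \<in> carrier (bmw_field l r)\<rbrakk>
    \<Longrightarrow> bmw_cong n l r (Const (a + b)) (Plus (Const a) (Const b))"
| Const_mult: "\<lbrakk>a \<in> carrier (bmw_field l r); b \<in> carrier (bmw_field l r)\<rbrakk>
    \<Longrightarrow> bmw_cong n l r (Const (a * b)) (Times (Const a) (Const b))"
| Const_central: "\<lbrakk>c \<in> carrier (bmw_field l r); s \<in> bmw_exprs n l r\<rbrakk>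
    \<Longrightarrow> bmw_cong n l r (Times (Const c) s) (Times s (Const c))"

| inverse_left: "\<lbrakk>1 \<le> i; i \<le> n - 1\<rbrakk>
    \<Longrightarrow> bmw_cong n l r (Times (GenInv i) (Gen i)) (Const 1)"
| inverse_right: "\<lbrakk>1 \<le> i; i \<le> n - 1\<rbrakk>
    \<Longrightarrow> bmw_cong n l r (Times (Gen i) (GenInv i)) (Const 1)"
| far: "\<lbrakk>1 \<le> i; i + 2 \<le> j; j \<le> n - 1\<rbrakk>
    \<Longrightarrow> bmw_cong n l r (Times (Gen i) (Gen j)) (Times (Gen j) (Gen i))"
| braid: "\<lbrakk>1 \<le> i; i + 1 \<le> n - 1\<rbrakk>
    \<Longrightarrow> bmw_cong n l r (Times (Gen i) (Times (Gen (i + 1)) (Gen i)))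
          (Times (Gen (i + 1)) (Times (Gen i) (Gen (i + 1))))"
| g_e: "\<lbrakk>1 \<le> i; i \<le> n - 1\<rbrakk>
    \<Longrightarrow> bmw_cong n l r (Times (Gen i) (bmw_e l r i)) (Times (Const (inverse l)) (bmw_e l r i))"
| e_g_e_up: "\<lbrakk>1 \<le> i; i + 1 \<le> n - 1\<rbrakk>
    \<Longrightarrow> bmw_cong n l r (Times (bmw_e l r i) (Times (Gen (i + 1)) (bmw_e l r i)))
          (Times (Const l) (bmw_e l r i))"
| e_g_e_down: "\<lbrakk>2 \<le> i; i \<le> n - 1\<rbrakk>
    \<Longrightarrow> bmw_cong n l r (Times (bmw_e l r i) (Times (Gen (i - 1)) (bmw_e l r i)))
          (Times (Const l) (bmw_e l r i))"

definition bmw_rel :: "nat \<Rightarrow> complex \<Rightarrow> complex \<Rightarrow> (bmw_expr \<times> bmw_expr) set" where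
  "bmw_rel n l r = {(s, t). bmw_cong n l r s t}"

definition bmw_algebra :: "nat \<Rightarrow> complex \<Rightarrow> complex \<Rightarrow> (complex, bmw_expr set) module" where
  "bmw_algebra n l r = \<lparr>
     carrier = bmw_exprs n l r // bmw_rel n l r,
     monoid.mult = (\<lambda>X Y. \<Union>x\<in>X. \<Union>y\<in>Y. bmw_rel n l r `` {Times x y}),
     one = bmw_rel n l r `` {Const 1},
     zero = bmw_rel n l r `` {Const 0},
     add = (\<lambda>X Y. \<Union>x\<in>X. \<Union>y\<in>Y. bmw_rel n l r `` {Plus x y}),
     smult = (\<lambda>c X. \<Union>x\<in>X. bmw_rel n l r `` {Times (Const c) x})\<rparr>"


section \<open>The Lawrence-Krammer space\<close>

definition lk_index :: "nat \<Rightarrow> (nat \<times> nat) set" where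
  "lk_index n = {(i, j). 1 \<le> i \<and> i < j \<and> j \<le> n}"

text \<open>Functions from the index set to the field; the functions \<open>lk_w n (i, j)\<close> below are the basis \<open>w\<^sub>i\<^sub>j\<close>.\<close>

definition lk_space :: "nat \<Rightarrow> complex \<Rightarrow> complex \<Rightarrow> (complex, nat \<times> nat \<Rightarrow> complex) module" where
  "lk_space n l r = ring.func_space (bmw_field l r) (lk_index n)"

definition lk_w :: "nat \<Rightarrow> nat \<times> nat \<Rightarrow> (nat \<times> nat \<Rightarrow> complex)" where
  "lk_w n p = (\<lambda>q\<in>lk_index n. if q = p then 1 else 0)"

text \<open>The value of \<open>\<nu>\<^sub>k\<close> on the basis vector \<open>w\<^sub>i\<^sub>j\<close>, for \<open>i < j\<close>.\<close>

definition lk_nu_basis ::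
    "nat \<Rightarrow> complex \<Rightarrow> complex \<Rightarrow> nat \<Rightarrow> nat \<times> nat \<Rightarrow> (nat \<times> nat \<Rightarrow> complex)" where
  "lk_nu_basis n l r k = (\<lambda>(i, j).
     let V = lk_space n l r; w = lk_w n; m = bmw_m r in
     if {i, j} \<inter> {k, k + 1} = {} then r \<odot>\<^bsub>V\<^esub> w (i, j)
     else if i = k \<and> j = k + 1 then inverse l \<odot>\<^bsub>V\<^esub> w (k, k + 1)
     else if i = k then w (k + 1, j)
     else if i = k + 1 then
       w (k, j) \<oplus>\<^bsub>V\<^esub> (m * r ^ (j - k - 2)) \<odot>\<^bsub>V\<^esub> w (k, k + 1) \<oplus>\<^bsub>V\<^esub> (- m) \<odot>\<^bsub>V\<^esub> w (k + 1, j)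
     else if j = k then w (i, k + 1)
     else
       w (i, k) \<oplus>\<^bsub>V\<^esub> (m / (l * r ^ (k - 1 - i))) \<odot>\<^bsub>V\<^esub> w (k, k + 1)
         \<oplus>\<^bsub>V\<^esub> (- m) \<odot>\<^bsub>V\<^esub> w (i, k + 1))"

definition lk_nu ::
    "nat \<Rightarrow> complex \<Rightarrow> complex \<Rightarrow> nat \<Rightarrow> (nat \<times> nat \<Rightarrow> complex) \<Rightarrow> (nat \<times> nat \<Rightarrow> complex)" where
  "lk_nu n l r k v =
     (\<Oplus>\<^bsub>lk_space n l r\<^esub>p\<in>lk_index n. v p \<odot>\<^bsub>lk_space n l r\<^esub> lk_nu_basis n l r k p)"

primrec bmw_eval ::
    "nat \<Rightarrow> complex \<Rightarrow> complex \<Rightarrow> bmw_expr \<Rightarrow> (nat \<times> nat \<Rightarrow> complex) \<Rightarrow> (nat \<times> nat \<Rightarrow> complex)" where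
  "bmw_eval n l r (Gen k) = lk_nu n l r k"
| "bmw_eval n l r (GenInv k) = inv_into (carrier (lk_space n l r)) (lk_nu n l r k)"
| "bmw_eval n l r (Const c) = (\<lambda>v. c \<odot>\<^bsub>lk_space n l r\<^esub> v)"
| "bmw_eval n l r (Plus s t) = (\<lambda>v. bmw_eval n l r s v \<oplus>\<^bsub>lk_space n l r\<^esub> bmw_eval n l r t v)"
| "bmw_eval n l r (Times s t) = (\<lambda>v. bmw_eval n l r s (bmw_eval n l r t v))"

text \<open>
  The action of a congruence class is that of any of its elements; all of them act in the same way
  on the space, see \<open>bmw_act_eq\<close> below.
\<close>

definition bmw_act ::
    "nat \<Rightarrow> complex \<Rightarrow> complex \<Rightarrow> bmw_expr set \<Rightarrow> (nat \<times> nat \<Rightarrow> complex) \<Rightarrow> (nat \<times> nat \<Rightarrow> complex)" where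
  "bmw_act n l r X v = the_elem ((\<lambda>t. bmw_eval n l r t v) ` X)"

definition lk_invariant :: "nat \<Rightarrow> complex \<Rightarrow> complex \<Rightarrow> (nat \<times> nat \<Rightarrow> complex) set \<Rightarrow> bool" where
  "lk_invariant n l r W \<longleftrightarrow>
     subspace (bmw_field l r) W (lk_space n l r) \<and>
     (\<forall>X\<in>carrier (bmw_algebra n l r). \<forall>v\<in>W. bmw_act n l r X v \<in> W)"

definition lk_irreducible :: "nat \<Rightarrow> complex \<Rightarrow> complex \<Rightarrow> (nat \<times> nat \<Rightarrow> complex) set \<Rightarrow> bool" where
  "lk_irreducible n l r W \<longleftrightarrow>
     lk_invariant n l r W \<and> W \<noteq> {\<zero>\<^bsub>lk_space n l r\<^esub>} \<and>
     (\<forall>U. lk_invariant n l r U \<and> U \<subseteq> W \<longrightarrow> U = {\<zero>\<^bsub>lk_space n l r\<^esub>} \<or> U = W)"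

definition lk_dim :: "nat \<Rightarrow> complex \<Rightarrow> complex \<Rightarrow> (nat \<times> nat \<Rightarrow> complex) set \<Rightarrow> nat" where
  "lk_dim n l r W = vectorspace.dim (bmw_field l r) (lk_space n l r\<lparr>carrier := W\<rparr>)"

section \<open>Well-definedness of the action\<close>

text \<open>The operators \<open>lk_nu\<close> satisfy the defining relations, so congruent expressions act equally.\<close>

lemma class_ring_inverse: "h \<noteq> 0 \<Longrightarrow> inv\<^bsub>class_ring\<^esub> (h::complex) = inverse h"
  unfolding m_inv_def
  by (rule the1_equality, rule ex1I[of _ "inverse h"]) (auto simp: field_simps)

lemma bmw_field_sel [simp]:
  "\<one>\<^bsub>bmw_field l r\<^esub> = 1" "\<zero>\<^bsub>bmw_field l r\<^esub> = 0"
  "a \<oplus>\<^bsub>bmw_field l r\<^esub> b = a + b" "a \<otimes>\<^bsub>bmw_field l r\<^esub> b = a * b"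
  by (simp_all add: bmw_field_def)

lemma bmw_field_is_field: "field (bmw_field l r)"
proof -
  have "field (class_ring :: complex ring)" ..
  then have "subfield (generate_field class_ring {l, r}) class_ring"
    by (rule field.generate_field_is_subfield) simp
  moreover have "ring (class_ring :: complex ring)" ..
  ultimately show ?thesis
    unfolding bmw_field_def using ring.subfield_iff(2) by blast
qed

lemma bmw_field_closed [simp]:
  shows "0 \<in> carrier (bmw_field l r)"
    and "1 \<in> carrier (bmw_field l r)"
    and "l \<in> carrier (bmw_field l r)"
    and "r \<in> carrier (bmw_field l r)"
    and bmw_field_uminus: "a \<in> carrier (bmw_field l r) \<Longrightarrow> - a \<in> carrier (bmw_field l r)"
    and bmw_field_inverse: "a \<in> carrier (bmw_field l r) \<Longrightarrow> inverse a \<in> carrier (bmw_field l r)"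
    and bmw_field_add: "a \<in> carrier (bmw_field l r) \<Longrightarrow> b \<in> carrier (bmw_field l r) \<Longrightarrow> a + b \<in> carrier (bmw_field l r)"
    and bmw_field_mult: "a \<in> carrier (bmw_field l r) \<Longrightarrow> b \<in> carrier (bmw_field l r) \<Longrightarrow> a * b \<in> carrier (bmw_field l r)"
proof -
  interpret F: field "bmw_field l r" by (rule bmw_field_is_field)
  show zero: "0 \<in> carrier (bmw_field l r)" and "1 \<in> carrier (bmw_field l r)"
    using F.zero_closed F.one_closed by simp_all
  show "l \<in> carrier (bmw_field l r)" "r \<in> carrier (bmw_field l r)"
    by (simp_all add: bmw_field_def generate_field.incl)
  show "- a \<in> carrier (bmw_field l r)" if "a \<in> carrier (bmw_field l r)"
    using generate_field.a_inv[of a "class_ring :: complex ring" "{l, r}"] that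
    by (simp add: bmw_field_def class_ring_simps)
  show "inverse a \<in> carrier (bmw_field l r)" if "a \<in> carrier (bmw_field l r)"
    using generate_field.m_inv[of a "class_ring :: complex ring" "{l, r}"] that zero
    by (cases "a = 0") (auto simp add: bmw_field_def class_ring_inverse)
  show "a + b \<in> carrier (bmw_field l r)" "a * b \<in> carrier (bmw_field l r)"
    if "a \<in> carrier (bmw_field l r)" "b \<in> carrier (bmw_field l r)"
    using F.a_closed[OF that] F.m_closed[OF that] by simp_all
qed

lemma bmw_field_closed2 [simp]:
  shows bmw_field_minus: "a \<in> carrier (bmw_field l r) \<Longrightarrow> b \<in> carrier (bmw_field l r) \<Longrightarrow> a - b \<in> carrier (bmw_field l r)"
    and bmw_field_divide: "a \<in> carrier (bmw_field l r) \<Longrightarrow> b \<in> carrier (bmw_field l r) \<Longrightarrow> a / b \<in> carrier (bmw_field l r)"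
    and bmw_field_power: "a \<in> carrier (bmw_field l r) \<Longrightarrow> a ^ d \<in> carrier (bmw_field l r)"
    and bmw_field_m: "bmw_m r \<in> carrier (bmw_field l r)"
proof -
  show *: "a - b \<in> carrier (bmw_field l r)"
    if "a \<in> carrier (bmw_field l r)" "b \<in> carrier (bmw_field l r)" for a b
    using bmw_field_add[OF that(1) bmw_field_uminus[OF that(2)]] by simp
  show "a / b \<in> carrier (bmw_field l r)"
    if "a \<in> carrier (bmw_field l r)" "b \<in> carrier (bmw_field l r)" for a b
    using bmw_field_mult[OF that(1) bmw_field_inverse[OF that(2)]] by (simp add: divide_inverse)
  show "a ^ d \<in> carrier (bmw_field l r)" if "a \<in> carrier (bmw_field l r)"
    using that by (induction d) auto
  show "bmw_m r \<in> carrier (bmw_field l r)"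
    unfolding bmw_m_def inverse_eq_divide[symmetric] by (intro *) auto
qed

lemma finite_lk_index [simp]: "finite (lk_index n)"
  by (rule finite_subset[of _ "{..n} \<times> {..n}"]) (auto simp: lk_index_def)

lemma lk_space_vectorspace: "vectorspace (bmw_field l r) (lk_space n l r)"
proof -
  interpret F: field "bmw_field l r" by (rule bmw_field_is_field)
  show ?thesis
    unfolding lk_space_def vectorspace_def
    using F.func_space_is_module bmw_field_is_field by blast
qed

lemma
  shows lk_space_carrier: "carrier (lk_space n l r) = lk_index n \<rightarrow>\<^sub>E carrier (bmw_field l r)"
    and lk_space_add: "q \<in> lk_index n \<Longrightarrow> (u \<oplus>\<^bsub>lk_space n l r\<^esub> v) q = u q + v q"
    and lk_space_smult: "q \<in> lk_index n \<Longrightarrow> (c \<odot>\<^bsub>lk_space n l r\<^esub> v) q = c * v q"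
    and lk_space_zero: "q \<in> lk_index n \<Longrightarrow> \<zero>\<^bsub>lk_space n l r\<^esub> q = 0"
proof -
  interpret F: field "bmw_field l r" by (rule bmw_field_is_field)
  show "carrier (lk_space n l r) = lk_index n \<rightarrow>\<^sub>E carrier (bmw_field l r)"
    "q \<in> lk_index n \<Longrightarrow> (u \<oplus>\<^bsub>lk_space n l r\<^esub> v) q = u q + v q"
    "q \<in> lk_index n \<Longrightarrow> (c \<odot>\<^bsub>lk_space n l r\<^esub> v) q = c * v q"
    "q \<in> lk_index n \<Longrightarrow> \<zero>\<^bsub>lk_space n l r\<^esub> q = 0"
    by (simp_all add: lk_space_def F.func_space_def)
qed

lemmas lk_space_pointwise = lk_space_add lk_space_smult lk_space_zero

locale lk_params =
  fixes n :: nat and l r :: complex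
  assumes l0: "l \<noteq> 0" and r0: "r \<noteq> 0" and r2: "r\<^sup>2 \<noteq> 1"
begin

abbreviation "F \<equiv> bmw_field l r"
abbreviation "V \<equiv> lk_space n l r"
abbreviation "S \<equiv> lk_index n"
abbreviation "w \<equiv> lk_w n"
abbreviation "m \<equiv> bmw_m r"
abbreviation "\<nu> \<equiv> lk_nu n l r"

interpretation V: vectorspace F V
  by (rule lk_space_vectorspace)

lemma m0: "m \<noteq> 0"
proof
  assume "m = 0"
  then have "r * (1 / r - r) = 0" by (simp add: bmw_m_def)
  then show False using r0 r2 by (simp add: algebra_simps power2_eq_square)
qed

lemma V_ext: "u \<in> carrier V \<Longrightarrow> v \<in> carrier V \<Longrightarrow> (\<And>q. q \<in> S \<Longrightarrow> u q = v q) \<Longrightarrow> u = v"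
  unfolding lk_space_carrier by (rule PiE_ext)

lemma finsum_pointwise:
  assumes "finite A" "f \<in> A \<rightarrow> carrier V" "q \<in> S"
  shows "(\<Oplus>\<^bsub>V\<^esub>p\<in>A. f p) q = (\<Sum>p\<in>A. f p q)"
  using assms by (induction A rule: finite_induct) (simp_all add: lk_space_pointwise)

lemma w_closed [simp]: "w p \<in> carrier V"
  by (auto simp: lk_w_def lk_space_carrier)

lemma w_apply: "q \<in> S \<Longrightarrow> w p q = (if q = p then 1 else 0)"
  by (simp add: lk_w_def)

lemma coeff_closed [simp]: "v \<in> carrier V \<Longrightarrow> p \<in> S \<Longrightarrow> v p \<in> carrier F"
  by (auto simp: lk_space_carrier)

lemma nu_basis_closed [simp]: "lk_nu_basis n l r k p \<in> carrier V"
  by (cases p) (simp add: lk_nu_basis_def Let_def)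

lemma nu_closed [simp]: "v \<in> carrier V \<Longrightarrow> \<nu> k v \<in> carrier V"
  unfolding lk_nu_def by (intro V.M.finsum_closed) auto

lemma nu_apply:
  "v \<in> carrier V \<Longrightarrow> q \<in> S \<Longrightarrow> \<nu> k v q = (\<Sum>p\<in>S. v p * lk_nu_basis n l r k p q)"
  unfolding lk_nu_def by (subst finsum_pointwise) (auto simp: lk_space_pointwise)

lemma nu_w:
  assumes "p \<in> S"
  shows "\<nu> k (w p) = lk_nu_basis n l r k p"
proof (rule V_ext)
  fix q assume q: "q \<in> S"
  have "\<nu> k (w p) q = (\<Sum>p'\<in>S. (if p' = p then lk_nu_basis n l r k p' q else 0))"
    unfolding nu_apply[OF w_closed q] by (rule sum.cong) (auto simp: w_apply)
  then show "\<nu> k (w p) q = lk_nu_basis n l r k p q"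
    using assms by simp
qed simp_all

definition lin where
  "lin T \<longleftrightarrow> T \<in> carrier V \<rightarrow> carrier V \<and>
     (\<forall>u\<in>carrier V. \<forall>v\<in>carrier V. T (u \<oplus>\<^bsub>V\<^esub> v) = T u \<oplus>\<^bsub>V\<^esub> T v) \<and>
     (\<forall>c\<in>carrier F. \<forall>v\<in>carrier V. T (c \<odot>\<^bsub>V\<^esub> v) = c \<odot>\<^bsub>V\<^esub> T v)"

lemma linD:
  assumes "lin T"
  shows "v \<in> carrier V \<Longrightarrow> T v \<in> carrier V"
    and "u \<in> carrier V \<Longrightarrow> v \<in> carrier V \<Longrightarrow> T (u \<oplus>\<^bsub>V\<^esub> v) = T u \<oplus>\<^bsub>V\<^esub> T v"
    and "c \<in> carrier F \<Longrightarrow> v \<in> carrier V \<Longrightarrow> T (c \<odot>\<^bsub>V\<^esub> v) = c \<odot>\<^bsub>V\<^esub> T v"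
  using assms by (auto simp: lin_def)

lemma lin_nu: "lin (\<nu> k)"
  unfolding lin_def
proof (intro conjI ballI)
  fix u v assume uv: "u \<in> carrier V" "v \<in> carrier V"
  show "\<nu> k (u \<oplus>\<^bsub>V\<^esub> v) = \<nu> k u \<oplus>\<^bsub>V\<^esub> \<nu> k v"
    by (rule V_ext)
       (use uv in \<open>simp_all add: lk_space_pointwise nu_apply ring_distribs sum.distrib\<close>)
next
  fix c v assume cv: "c \<in> carrier F" "v \<in> carrier V"
  show "\<nu> k (c \<odot>\<^bsub>V\<^esub> v) = c \<odot>\<^bsub>V\<^esub> \<nu> k v"
    by (rule V_ext)
       (use cv in \<open>simp_all add: lk_space_pointwise nu_apply sum_distrib_left mult.assoc\<close>)
qed auto

lemmas nu_add [simp] = linD(2)[OF lin_nu]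
lemmas nu_smult [simp] = linD(3)[OF lin_nu]

lemma lin_smult: "c \<in> carrier F \<Longrightarrow> lin T \<Longrightarrow> lin (\<lambda>v. c \<odot>\<^bsub>V\<^esub> T v)"
  unfolding lin_def by (auto simp: Pi_iff lk_space_pointwise algebra_simps intro!: V_ext)

lemma lin_add: "lin T \<Longrightarrow> lin U \<Longrightarrow> lin (\<lambda>v. T v \<oplus>\<^bsub>V\<^esub> U v)"
  unfolding lin_def by (auto simp: Pi_iff lk_space_pointwise algebra_simps intro!: V_ext)

lemma lin_comp: "lin T \<Longrightarrow> lin U \<Longrightarrow> lin (\<lambda>v. T (U v))"
  unfolding lin_def by (auto simp: Pi_iff)

lemma lin_id: "lin (\<lambda>v. v)"
  unfolding lin_def by auto

lemma lin_finsum: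
  assumes "lin T" "finite A" "f \<in> A \<rightarrow> carrier V"
  shows "T (\<Oplus>\<^bsub>V\<^esub>p\<in>A. f p) = (\<Oplus>\<^bsub>V\<^esub>p\<in>A. T (f p))"
  using assms(2,3)
proof (induction A rule: finite_induct)
  case empty
  have "T \<zero>\<^bsub>V\<^esub> = T (0 \<odot>\<^bsub>V\<^esub> \<zero>\<^bsub>V\<^esub>)"
    by simp
  also have "\<dots> = 0 \<odot>\<^bsub>V\<^esub> T \<zero>\<^bsub>V\<^esub>"
    by (rule linD(3)[OF assms(1)]) auto
  also have "\<dots> = \<zero>\<^bsub>V\<^esub>"
    using V.smult_l_null[OF linD(1)[OF assms(1)], of "\<zero>\<^bsub>V\<^esub>"] by simp
  finally show ?case by simp
next
  case (insert a A)
  then show ?case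
    using linD[OF assms(1)] by (simp add: Pi_iff)
qed

lemma w_expansion:
  assumes "v \<in> carrier V"
  shows "v = (\<Oplus>\<^bsub>V\<^esub>p\<in>S. v p \<odot>\<^bsub>V\<^esub> w p)"
proof (rule V_ext)
  fix q assume q: "q \<in> S"
  have "(\<Oplus>\<^bsub>V\<^esub>p\<in>S. v p \<odot>\<^bsub>V\<^esub> w p) q = (\<Sum>p\<in>S. (v p \<odot>\<^bsub>V\<^esub> w p) q)"
    using assms q by (intro finsum_pointwise) auto
  also have "\<dots> = (\<Sum>p\<in>S. if p = q then v p else 0)"
    using q by (intro sum.cong) (auto simp: lk_space_pointwise w_apply)
  finally have "(\<Oplus>\<^bsub>V\<^esub>p\<in>S. v p \<odot>\<^bsub>V\<^esub> w p) q = (\<Sum>p\<in>S. if p = q then v p else 0)" .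
  then show "v q = (\<Oplus>\<^bsub>V\<^esub>p\<in>S. v p \<odot>\<^bsub>V\<^esub> w p) q"
    using q by simp
qed (use assms in \<open>auto intro!: V.M.finsum_closed\<close>)

lemma lin_ext:
  assumes "lin T" "lin U" "\<And>i j. (i, j) \<in> S \<Longrightarrow> T (w (i, j)) = U (w (i, j))" "v \<in> carrier V"
  shows "T v = U v"
proof -
  have exp: "L v = (\<Oplus>\<^bsub>V\<^esub>p\<in>S. v p \<odot>\<^bsub>V\<^esub> L (w p))" if "lin L" for L
  proof -
    have "L v = L (\<Oplus>\<^bsub>V\<^esub>p\<in>S. v p \<odot>\<^bsub>V\<^esub> w p)"
      using w_expansion[OF assms(4)] by simp
    also have "\<dots> = (\<Oplus>\<^bsub>V\<^esub>p\<in>S. L (v p \<odot>\<^bsub>V\<^esub> w p))"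
      using assms(4) by (intro lin_finsum that) auto
    also have "\<dots> = (\<Oplus>\<^bsub>V\<^esub>p\<in>S. v p \<odot>\<^bsub>V\<^esub> L (w p))"
      using assms(4) that by (intro V.M.finsum_cong') (auto simp: linD)
    finally show ?thesis .
  qed
  have "T (w p) = U (w p)" if "p \<in> S" for p
    using assms(3) that by (cases p) auto
  then show ?thesis
    unfolding exp[OF assms(1)] exp[OF assms(2)]
    using assms(2,4) by (intro V.M.finsum_cong') (auto simp: linD)
qed


lemma nu_1: "(i, j) \<in> S \<Longrightarrow> i \<noteq> k \<Longrightarrow> i \<noteq> Suc k \<Longrightarrow> j \<noteq> k \<Longrightarrow> j \<noteq> Suc k \<Longrightarrow> \<nu> k (w (i, j)) = r \<odot>\<^bsub>V\<^esub> w (i, j)"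
  by (simp add: nu_w lk_nu_basis_def Let_def)

lemma nu_2: "(k, Suc k) \<in> S \<Longrightarrow> \<nu> k (w (k, Suc k)) = inverse l \<odot>\<^bsub>V\<^esub> w (k, Suc k)"
  by (simp add: nu_w lk_nu_basis_def Let_def)

lemma nu_3: "(k, j) \<in> S \<Longrightarrow> j \<noteq> Suc k \<Longrightarrow> \<nu> k (w (k, j)) = w (Suc k, j)"
  by (simp add: nu_w lk_nu_basis_def Let_def)

lemma nu_4: "(Suc k, j) \<in> S \<Longrightarrow>
   \<nu> k (w (Suc k, j)) = w (k, j) \<oplus>\<^bsub>V\<^esub> (m * r ^ (j - k - 2)) \<odot>\<^bsub>V\<^esub> w (k, Suc k) \<oplus>\<^bsub>V\<^esub> (- m) \<odot>\<^bsub>V\<^esub> w (Suc k, j)"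
  by (simp add: nu_w lk_nu_basis_def Let_def)

lemma nu_5: "(i, k) \<in> S \<Longrightarrow> \<nu> k (w (i, k)) = w (i, Suc k)"
  by (auto simp add: nu_w lk_nu_basis_def Let_def lk_index_def)

lemma nu_6: "(i, Suc k) \<in> S \<Longrightarrow> i \<noteq> k \<Longrightarrow>
   \<nu> k (w (i, Suc k)) = w (i, k) \<oplus>\<^bsub>V\<^esub> (m / (l * r ^ (k - 1 - i))) \<odot>\<^bsub>V\<^esub> w (k, Suc k) \<oplus>\<^bsub>V\<^esub> (- m) \<odot>\<^bsub>V\<^esub> w (i, Suc k)"
  by (auto simp add: nu_w lk_nu_basis_def Let_def lk_index_def)

lemmas nu_rules = nu_1 nu_2 nu_3 nu_4 nu_5 nu_6

lemma S_iff: "(i, j) \<in> S \<longleftrightarrow> 1 \<le> i \<and> i < j \<and> j \<le> n"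
  by (simp add: lk_index_def)

lemma inverse_l_closed [simp]: "inverse l \<in> carrier F" 
  by simp

lemma lin_nu_nu: "lin (\<lambda>v. \<nu> k (\<nu> k' v))"
  by (rule lin_comp[OF lin_nu lin_nu])

lemma nu_far:
  assumes k: "1 \<le> k" "k + 2 \<le> k'" "k' + 1 \<le> n" and v: "v \<in> carrier V"
  shows "\<nu> k (\<nu> k' v) = \<nu> k' (\<nu> k v)"
proof (rule lin_ext[OF lin_nu_nu lin_nu_nu _ v])
  fix i j assume ij: "(i, j) \<in> S"
  then have ij': "1 \<le> i" "i < j" "j \<le> n" by (auto simp: S_iff)
  obtain d where d: "k' = k + 2 + d" using k(2) le_Suc_ex by blast

  consider (1) "i = k" | (2) "i = Suc k" | (3) "i = k'" | (4) "i = Suc k'" | (5) "i \<noteq> k" "i \<noteq> Suc k" "i \<noteq> k'" "i \<noteq> Suc k'" by blast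
  then show "\<nu> k (\<nu> k' (w (i, j))) = \<nu> k' (\<nu> k (w (i, j)))"
  proof cases
  case 1
  note I = this
  consider (1) "j = k" | (2) "j = Suc k" | (3) "j = k'" | (4) "j = Suc k'" | (5) "j \<noteq> k" "j \<noteq> Suc k" "j \<noteq> k'" "j \<noteq> Suc k'" by blast
  then show ?thesis
  proof cases
    case 1 then show ?thesis using I k ij' by simp
  next
    case 2 show ?thesis by (rule V_ext) (use I 2 k ij' r0 l0 in \<open>simp_all add: nu_rules S_iff lk_space_pointwise d field_simps\<close>)
  next
    case 3 show ?thesis by (rule V_ext) (use I 3 k ij' r0 l0 in \<open>simp_all add: nu_rules S_iff lk_space_pointwise d field_simps\<close>)
  next
    case 4 show ?thesis by (rule V_ext) (use I 4 k ij' r0 l0 in \<open>simp_all add: nu_rules S_iff lk_space_pointwise d field_simps\<close>)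
  next
    case 5 show ?thesis by (rule V_ext) (use I 5 k ij' r0 l0 in \<open>simp_all add: nu_rules S_iff lk_space_pointwise d field_simps\<close>)
  qed
  next
  case 2
  note I = this
  consider (1) "j = k" | (2) "j = Suc k" | (3) "j = k'" | (4) "j = Suc k'" | (5) "j \<noteq> k" "j \<noteq> Suc k" "j \<noteq> k'" "j \<noteq> Suc k'" by blast
  then show ?thesis
  proof cases
    case 1 then show ?thesis using I k ij' by simp
  next
    case 2 then show ?thesis using I k ij' by simp
  next
    case 3 show ?thesis by (rule V_ext) (use I 3 k ij' r0 l0 in \<open>simp_all add: nu_rules S_iff lk_space_pointwise d field_simps\<close>)
  next
    case 4 show ?thesis by (rule V_ext) (use I 4 k ij' r0 l0 in \<open>simp_all add: bmw_m_def nu_rules S_iff lk_space_pointwise d field_simps\<close>)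
  next
    case 5 show ?thesis by (rule V_ext) (use I 5 k ij' r0 l0 in \<open>simp_all add: nu_rules S_iff lk_space_pointwise d field_simps\<close>)
  qed
  next
  case 3
  note I = this
  consider (1) "j = k" | (2) "j = Suc k" | (3) "j = k'" | (4) "j = Suc k'" | (5) "j \<noteq> k" "j \<noteq> Suc k" "j \<noteq> k'" "j \<noteq> Suc k'" by blast
  then show ?thesis
  proof cases
    case 1 then show ?thesis using I k ij' by simp
  next
    case 2 then show ?thesis using I k ij' by simp
  next
    case 3 then show ?thesis using I k ij' by simp
  next
    case 4 show ?thesis by (rule V_ext) (use I 4 k ij' r0 l0 in \<open>simp_all add: nu_rules S_iff lk_space_pointwise d field_simps\<close>)
  next
    case 5 show ?thesis by (rule V_ext) (use I 5 k ij' r0 l0 in \<open>simp_all add: nu_rules S_iff lk_space_pointwise d field_simps\<close>)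
  qed
  next
  case 4
  note I = this
  consider (1) "j = k" | (2) "j = Suc k" | (3) "j = k'" | (4) "j = Suc k'" | (5) "j \<noteq> k" "j \<noteq> Suc k" "j \<noteq> k'" "j \<noteq> Suc k'" by blast
  then show ?thesis
  proof cases
    case 1 then show ?thesis using I k ij' by simp
  next
    case 2 then show ?thesis using I k ij' by simp
  next
    case 3 then show ?thesis using I k ij' by simp
  next
    case 4 then show ?thesis using I k ij' by simp
  next
    case 5 show ?thesis by (rule V_ext) (use I 5 k ij' r0 l0 in \<open>simp_all add: nu_rules S_iff lk_space_pointwise d field_simps\<close>)
  qed
  next
  case 5
  note I = this
  consider (1) "j = k" | (2) "j = Suc k" | (3) "j = k'" | (4) "j = Suc k'" | (5) "j \<noteq> k" "j \<noteq> Suc k" "j \<noteq> k'" "j \<noteq> Suc k'" by blast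
  then show ?thesis
  proof cases
    case 1 show ?thesis by (rule V_ext) (use I 1 k ij' r0 l0 in \<open>simp_all add: nu_rules S_iff lk_space_pointwise d field_simps\<close>)
  next
    case 2 show ?thesis by (rule V_ext) (use I 2 k ij' r0 l0 in \<open>simp_all add: nu_rules S_iff lk_space_pointwise d field_simps\<close>)
  next
    case 3 show ?thesis by (rule V_ext) (use I 3 k ij' r0 l0 in \<open>simp_all add: nu_rules S_iff lk_space_pointwise d field_simps\<close>)
  next
    case 4 show ?thesis by (rule V_ext) (use I 4 k ij' r0 l0 in \<open>simp_all add: nu_rules S_iff lk_space_pointwise d field_simps\<close>)
  next
    case 5 show ?thesis by (rule V_ext) (use I 5 k ij' r0 l0 in \<open>simp_all add: nu_rules S_iff lk_space_pointwise d field_simps\<close>)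
  qed
  qed
qed

lemma nu_braid:
  assumes k: "1 \<le> k" "k + 2 \<le> n" and v: "v \<in> carrier V"
  shows "\<nu> k (\<nu> (Suc k) (\<nu> k v)) = \<nu> (Suc k) (\<nu> k (\<nu> (Suc k) v))"
proof (rule lin_ext[OF lin_comp[OF lin_nu lin_nu_nu] lin_comp[OF lin_nu lin_nu_nu] _ v])
  fix i j assume ij: "(i, j) \<in> S"
  then have ij': "1 \<le> i" "i < j" "j \<le> n" by (auto simp: S_iff)

  consider (1) "i = k" | (2) "i = Suc k" | (3) "i = Suc (Suc k)" | (4) "i \<noteq> k" "i \<noteq> Suc k" "i \<noteq> Suc (Suc k)" by blast
  then show "\<nu> k (\<nu> (Suc k) (\<nu> k (w (i, j)))) = \<nu> (Suc k) (\<nu> k (\<nu> (Suc k) (w (i, j))))"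
  proof cases
  case 1
  note I = this
  consider (1) "j = k" | (2) "j = Suc k" | (3) "j = Suc (Suc k)" | (4) "j \<noteq> k" "j \<noteq> Suc k" "j \<noteq> Suc (Suc k)" by blast
  then show ?thesis
  proof cases
    case 1 then show ?thesis using I k ij' by simp
  next
    case 2 show ?thesis by (rule V_ext) (use I 2 k ij' r0 l0 in \<open>simp_all add: nu_rules S_iff lk_space_pointwise field_simps\<close>)
  next
    case 3 show ?thesis by (rule V_ext) (use I 3 k ij' r0 l0 in \<open>simp_all add: nu_rules S_iff lk_space_pointwise field_simps\<close>)
  next
    case 4 show ?thesis by (rule V_ext) (use I 4 k ij' r0 l0 in \<open>simp_all add: nu_rules S_iff lk_space_pointwise field_simps\<close>)
  qed
  next
  case 2
  note I = this
  consider (1) "j = k" | (2) "j = Suc k" | (3) "j = Suc (Suc k)" | (4) "j \<noteq> k" "j \<noteq> Suc k" "j \<noteq> Suc (Suc k)" by blast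
  then show ?thesis
  proof cases
    case 1 then show ?thesis using I k ij' by simp
  next
    case 2 then show ?thesis using I k ij' by simp
  next
    case 3 show ?thesis by (rule V_ext) (use I 3 k ij' r0 l0 in \<open>simp_all add: nu_rules S_iff lk_space_pointwise field_simps\<close>)
  next
    case 4
    then obtain e where e: "j = k + 3 + e"
      using I ij' le_Suc_ex[of "k + 3" j] by auto
    show ?thesis by (rule V_ext) (use I e k ij' r0 l0 in \<open>simp_all add: nu_rules S_iff lk_space_pointwise field_simps\<close>)
  qed
  next
  case 3
  note I = this
  consider (1) "j = k" | (2) "j = Suc k" | (3) "j = Suc (Suc k)" | (4) "j \<noteq> k" "j \<noteq> Suc k" "j \<noteq> Suc (Suc k)" by blast
  then show ?thesis
  proof cases
    case 1 then show ?thesis using I k ij' by simp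
  next
    case 2 then show ?thesis using I k ij' by simp
  next
    case 3 then show ?thesis using I k ij' by simp
  next
    case 4
    then obtain e where e: "j = k + 3 + e"
      using I ij' le_Suc_ex[of "k + 3" j] by auto
    show ?thesis by (rule V_ext) (use I e k ij' r0 l0 in \<open>simp_all add: bmw_m_def nu_rules S_iff lk_space_pointwise field_simps\<close>)
  qed
  next
  case 4
  note I = this
  consider (1) "j = k" | (2) "j = Suc k" | (3) "j = Suc (Suc k)" | (4) "j \<noteq> k" "j \<noteq> Suc k" "j \<noteq> Suc (Suc k)" by blast
  then show ?thesis
  proof cases
    case 1 show ?thesis by (rule V_ext) (use I 1 k ij' r0 l0 in \<open>simp_all add: nu_rules S_iff lk_space_pointwise field_simps\<close>)
  next
    case 2
    then obtain e where e: "k = i + 1 + e"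
      using I ij' le_Suc_ex[of "i + 1" k] by auto
    show ?thesis by (rule V_ext) (use 2 e k ij' r0 l0 in \<open>simp_all add: bmw_m_def nu_rules S_iff lk_space_pointwise field_simps\<close>)
  next
    case 3
    then obtain e where e: "k = i + 1 + e"
      using I ij' le_Suc_ex[of "i + 1" k] by auto
    show ?thesis by (rule V_ext) (use 3 e k ij' r0 l0 in \<open>simp_all add: bmw_m_def nu_rules S_iff lk_space_pointwise field_simps\<close>)
  next
    case 4 show ?thesis by (rule V_ext) (use I 4 k ij' r0 l0 in \<open>simp_all add: nu_rules S_iff lk_space_pointwise field_simps\<close>)
  qed
  qed
qed

lemma zero_smult [simp]: "v \<in> carrier V \<Longrightarrow> 0 \<odot>\<^bsub>V\<^esub> v = \<zero>\<^bsub>V\<^esub>"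
  using V.smult_l_null[of v] by simp

lemma one_smult [simp]: "v \<in> carrier V \<Longrightarrow> 1 \<odot>\<^bsub>V\<^esub> v = v"
  using V.smult_one[of v] by simp

abbreviation "e k v \<equiv> bmw_eval n l r (bmw_e l r k) v"

lemma e_eq: "e k v = (l / m) \<odot>\<^bsub>V\<^esub> (\<nu> k (\<nu> k v) \<oplus>\<^bsub>V\<^esub> m \<odot>\<^bsub>V\<^esub> \<nu> k v \<oplus>\<^bsub>V\<^esub> (- 1) \<odot>\<^bsub>V\<^esub> v)"
  by (simp add: bmw_e_def)

lemma lin_e: "lin (e k)"
  unfolding e_eq by (intro lin_smult lin_add lin_nu_nu lin_nu lin_id) auto

lemma nu_e_basis:
  assumes k: "1 \<le> k" "k + 1 \<le> n" and ij: "(i, j) \<in> S"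
  shows "\<exists>c\<in>carrier F. e k (w (i, j)) = c \<odot>\<^bsub>V\<^esub> w (k, Suc k)"
proof -
  from ij have ij': "1 \<le> i" "i < j" "j \<le> n" by (auto simp: S_iff)
  have witness: "\<exists>c\<in>carrier F. e k (w (i, j)) = c \<odot>\<^bsub>V\<^esub> w (k, Suc k)"
    if "c \<in> carrier F" "\<And>q. q \<in> S \<Longrightarrow> e k (w (i, j)) q = c * w (k, Suc k) q" for c
    using that lin_e by (intro bexI[of _ c] V_ext) (auto simp: lk_space_pointwise linD)
  note rules = e_eq nu_rules S_iff lk_space_pointwise field_simps m0
  consider (1) "i \<noteq> k" "i \<noteq> Suc k" "j \<noteq> k" "j \<noteq> Suc k" | (2) "i = k" "j = Suc k" | (3) "i = k" "j \<noteq> Suc k" 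
    | (4) "i = Suc k" | (5) "j = k" | (6) "j = Suc k" "i \<noteq> k" by blast
  then show ?thesis
  proof cases
    case 1
    show ?thesis
      by (rule witness[of 0]) (use 1 k ij' l0 r0 in \<open>simp_all add: rules bmw_m_def\<close>)
  next
    case 2
    show ?thesis
      by (rule witness[of "(l / m) * (inverse l * inverse l + m * inverse l - 1)"])
         (use 2 k ij' l0 r0 in \<open>simp_all add: rules\<close>)
  next
    case 3
    show ?thesis
      by (rule witness[of "l * r ^ (j - k - 2)"])
         (use 3 k ij' l0 r0 in \<open>simp_all add: rules\<close>)
  next
    case 4
    show ?thesis
      by (rule witness[of "r ^ (j - k - 2)"])
         (use 4 k ij' l0 r0 in \<open>simp_all add: rules\<close>)
  next
    case 5
    show ?thesis
      by (rule witness[of "1 / r ^ (k - 1 - i)"])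
         (use 5 k ij' l0 r0 in \<open>simp_all add: rules\<close>)
  next
    case 6
    show ?thesis
      by (rule witness[of "1 / (l * r ^ (k - 1 - i))"])
         (use 6 k ij' l0 r0 in \<open>simp_all add: rules\<close>)
  qed
qed

lemma e_range:
  assumes k: "1 \<le> k" "k + 1 \<le> n" and v: "v \<in> carrier V"
  shows "\<exists>c\<in>carrier F. e k v = c \<odot>\<^bsub>V\<^esub> w (k, Suc k)"
proof -
  have "\<forall>p\<in>S. \<exists>a. a \<in> carrier F \<and> e k (w p) = a \<odot>\<^bsub>V\<^esub> w (k, Suc k)"
    using nu_e_basis[OF k] by force
  from bchoice[OF this] obtain c where c: "\<And>p. p \<in> S \<Longrightarrow> c p \<in> carrier F"
    "\<And>p. p \<in> S \<Longrightarrow> e k (w p) = c p \<odot>\<^bsub>V\<^esub> w (k, Suc k)"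
    by blast
  have "e k v = e k (\<Oplus>\<^bsub>V\<^esub>p\<in>S. v p \<odot>\<^bsub>V\<^esub> w p)"
    using w_expansion[OF v] by simp
  also have "\<dots> = (\<Oplus>\<^bsub>V\<^esub>p\<in>S. e k (v p \<odot>\<^bsub>V\<^esub> w p))"
    using v by (intro lin_finsum lin_e) auto
  also have "\<dots> = (\<Oplus>\<^bsub>V\<^esub>p\<in>S. (v p * c p) \<odot>\<^bsub>V\<^esub> w (k, Suc k))"
    using v c V.smult_assoc1 by (intro V.M.finsum_cong') (auto simp: linD[OF lin_e])
  also have "\<dots> = (\<Sum>p\<in>S. v p * c p) \<odot>\<^bsub>V\<^esub> w (k, Suc k)"
  proof (rule V_ext)
    have sum_closed: "(\<Sum>p\<in>A. v p * c p) \<in> carrier F" if "A \<subseteq> S" for A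
      using finite_subset[OF that finite_lk_index] that
      by (induction A rule: finite_induct) (use v c in auto)
    show "(\<Sum>p\<in>S. v p * c p) \<odot>\<^bsub>V\<^esub> w (k, Suc k) \<in> carrier V"
      using sum_closed by auto
    show "(\<Oplus>\<^bsub>V\<^esub>p\<in>S. (v p * c p) \<odot>\<^bsub>V\<^esub> w (k, Suc k)) \<in> carrier V"
      using v c by (intro V.M.finsum_closed) auto
    show "(\<Oplus>\<^bsub>V\<^esub>p\<in>S. (v p * c p) \<odot>\<^bsub>V\<^esub> w (k, Suc k)) q
        = ((\<Sum>p\<in>S. v p * c p) \<odot>\<^bsub>V\<^esub> w (k, Suc k)) q" if "q \<in> S" for q
      using that v c by (subst finsum_pointwise) (auto simp: lk_space_pointwise sum_distrib_right)
  qed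
  finally have "e k v = (\<Sum>p\<in>S. v p * c p) \<odot>\<^bsub>V\<^esub> w (k, Suc k)" .
  moreover have "(\<Sum>p\<in>A. v p * c p) \<in> carrier F" if "A \<subseteq> S" for A
    using finite_subset[OF that finite_lk_index] that
    by (induction A rule: finite_induct) (use v c in auto)
  ultimately show ?thesis by blast
qed

lemma e_closed [simp]: "v \<in> carrier V \<Longrightarrow> e k v \<in> carrier V"
  by (rule linD(1)[OF lin_e])

lemma nu_e:
  assumes k: "1 \<le> k" "k + 1 \<le> n" and v: "v \<in> carrier V"
  shows "\<nu> k (e k v) = inverse l \<odot>\<^bsub>V\<^esub> e k v"
proof -
  obtain c where "c \<in> carrier F" "e k v = c \<odot>\<^bsub>V\<^esub> w (k, Suc k)"
    using e_range[OF assms] by blast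
  then show ?thesis
    using k by (intro V_ext) (auto simp: nu_2 S_iff lk_space_pointwise simp del: inverse_l_closed)
qed

lemma e_nu_e_up:
  assumes k: "1 \<le> k" "k + 2 \<le> n" and v: "v \<in> carrier V"
  shows "e k (\<nu> (Suc k) (e k v)) = l \<odot>\<^bsub>V\<^esub> e k v"
proof -
  have *: "e k (\<nu> (Suc k) (w (k, Suc k))) = l \<odot>\<^bsub>V\<^esub> w (k, Suc k)"
    by (rule V_ext) (use k l0 r0 in \<open>simp_all add: e_eq nu_rules S_iff lk_space_pointwise field_simps m0\<close>)
  obtain c where c: "c \<in> carrier F" "e k v = c \<odot>\<^bsub>V\<^esub> w (k, Suc k)"
    using e_range[of k v] assms by auto
  show ?thesis
    using c(1) by (intro V_ext) (auto simp: c(2) * linD(3)[OF lin_e] lk_space_pointwise)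
qed

lemma e_nu_e_down:
  assumes k: "1 \<le> k" "k + 2 \<le> n" and v: "v \<in> carrier V"
  shows "e (Suc k) (\<nu> k (e (Suc k) v)) = l \<odot>\<^bsub>V\<^esub> e (Suc k) v"
proof -
  have *: "e (Suc k) (\<nu> k (w (Suc k, Suc (Suc k)))) = l \<odot>\<^bsub>V\<^esub> w (Suc k, Suc (Suc k))"
    by (rule V_ext) (use k l0 r0 in \<open>simp_all add: e_eq nu_rules S_iff lk_space_pointwise field_simps m0\<close>)
  obtain c where c: "c \<in> carrier F" "e (Suc k) v = c \<odot>\<^bsub>V\<^esub> w (Suc k, Suc (Suc k))"
    using e_range[of "Suc k" v] assms by auto
  show ?thesis
    using c(1) by (intro V_ext) (auto simp: c(2) * linD(3)[OF lin_e] lk_space_pointwise)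
qed

definition \<mu> where
  "\<mu> k v = (- l) \<odot>\<^bsub>V\<^esub> (\<nu> k (\<nu> k v) \<oplus>\<^bsub>V\<^esub> (m - inverse l) \<odot>\<^bsub>V\<^esub> \<nu> k v \<oplus>\<^bsub>V\<^esub> (- 1 - m * inverse l) \<odot>\<^bsub>V\<^esub> v)"

lemma lin_mu: "lin (\<mu> k)"
  unfolding \<mu>_def by (intro lin_smult lin_add lin_nu_nu lin_nu lin_id) auto

lemma nu_mu:
  assumes k: "1 \<le> k" "k + 1 \<le> n" and v: "v \<in> carrier V"
  shows "\<nu> k (\<mu> k v) = v" "\<mu> k (\<nu> k v) = v"
proof -
  have cubic: "\<nu> k (\<nu> k (\<nu> k v)) q = inverse l * (\<nu> k (\<nu> k v) q + m * \<nu> k v q - v q)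
      - m * \<nu> k (\<nu> k v) q + \<nu> k v q" if "q \<in> S" for q
  proof -
    have "\<nu> k (e k v) q = inverse l * e k v q"
      using nu_e[OF assms] that by (simp add: lk_space_pointwise)
    then have "(l / m) * (\<nu> k (\<nu> k (\<nu> k v)) q + m * \<nu> k (\<nu> k v) q - \<nu> k v q)
        = (l / m) * (inverse l * (\<nu> k (\<nu> k v) q + m * \<nu> k v q - v q))"
      using v that by (simp add: e_eq lk_space_pointwise mult.left_commute)
    then have "\<nu> k (\<nu> k (\<nu> k v)) q + m * \<nu> k (\<nu> k v) q - \<nu> k v q
        = inverse l * (\<nu> k (\<nu> k v) q + m * \<nu> k v q - v q)"
      using l0 m0 by (subst (asm) mult_left_cancel) auto
    then show ?thesis
      by (simp add: algebra_simps)
  qed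
  show "\<nu> k (\<mu> k v) = v" "\<mu> k (\<nu> k v) = v"
    by (rule V_ext; use v l0 in \<open>simp add: \<mu>_def lk_space_pointwise cubic field_simps\<close>)+
qed

lemma nu_bij: "1 \<le> k \<Longrightarrow> k + 1 \<le> n \<Longrightarrow> bij_betw (\<nu> k) (carrier V) (carrier V)"
  by (rule bij_betw_byWitness[of _ "\<mu> k"]) (auto simp: nu_mu linD[OF lin_mu])

lemma nu_inv: "1 \<le> k \<Longrightarrow> k + 1 \<le> n \<Longrightarrow> v \<in> carrier V \<Longrightarrow> inv_into (carrier V) (\<nu> k) v = \<mu> k v"
  using inv_into_f_f[of "\<nu> k" "carrier V" "\<mu> k v"] nu_bij[of k]
  by (auto simp: nu_mu linD[OF lin_mu] bij_betw_def)

lemma lin_cong: "lin T \<Longrightarrow> (\<And>v. v \<in> carrier V \<Longrightarrow> U v = T v) \<Longrightarrow> lin U"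
  by (auto simp: lin_def Pi_iff)

lemma lin_eval: "t \<in> bmw_exprs n l r \<Longrightarrow> lin (bmw_eval n l r t)"
proof (induction rule: bmw_exprs.induct)
  case (GenInv k)
  then show ?case
    by (simp, intro lin_cong[OF lin_mu[of k]] nu_inv) auto
next
  case (Const c)
  then show ?case
    using lin_smult[OF _ lin_id] by simp
qed (simp_all add: lin_nu lin_add lin_comp)

lemma eval_closed: "t \<in> bmw_exprs n l r \<Longrightarrow> v \<in> carrier V \<Longrightarrow> bmw_eval n l r t v \<in> carrier V"
  using linD(1)[OF lin_eval] .

lemma bmw_e_exprs: "1 \<le> k \<Longrightarrow> k \<le> n - 1 \<Longrightarrow> bmw_e l r k \<in> bmw_exprs n l r"
  unfolding bmw_e_def by (intro bmw_exprs.intros) auto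

lemma bmw_cong_exprs: "bmw_cong n l r s t \<Longrightarrow> s \<in> bmw_exprs n l r \<and> t \<in> bmw_exprs n l r"
  by (induction rule: bmw_cong.induct) (auto intro!: bmw_exprs.intros bmw_e_exprs)

lemma bmw_cong_eval:
  "bmw_cong n l r s t \<Longrightarrow> v \<in> carrier V \<Longrightarrow> bmw_eval n l r s v = bmw_eval n l r t v"
proof (induction arbitrary: v rule: bmw_cong.induct)
  case (Times s s' t t')
  then show ?case
    using eval_closed bmw_cong_exprs by simp
next
  case (inverse_left i)
  then show ?case using nu_inv[of i "\<nu> i v"] nu_mu[of i v] by simp
next
  case (inverse_right i)
  then show ?case using nu_inv[of i v] nu_mu[of i v] by simp
next
  case (far i j)
  then show ?case using nu_far[of i j v] by simp
next
  case (braid i)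
  then show ?case using nu_braid[of i v] by simp
next
  case (g_e i)
  then show ?case using nu_e[of i v] by simp
next
  case (e_g_e_up i)
  then show ?case using e_nu_e_up[of i v] by simp
next
  case (e_g_e_down i)
  then show ?case using e_nu_e_down[of "i - 1" v] by simp
next
  case (add_assoc s t u)
  then show ?case by (simp add: eval_closed V.M.a_assoc)
next
  case (add_comm s t)
  then show ?case by (simp add: eval_closed V.M.a_comm)
next
  case (add_zero s)
  then show ?case
    by (simp add: eval_closed)
next
  case (add_neg s)
  then show ?case
    by (intro V_ext) (simp_all add: eval_closed lk_space_pointwise)
next
  case (distrib_left s t u)
  then show ?case
    by (simp add: eval_closed linD[OF lin_eval])
next
  case (Const_add a b)
  then show ?case
    by (intro V_ext) (simp_all add: lk_space_pointwise algebra_simps)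
next
  case (Const_mult a b)
  then show ?case
    by (intro V_ext) (simp_all add: lk_space_pointwise)
next
  case (Const_central c s)
  then show ?case
    by (simp add: linD[OF lin_eval])
qed (simp_all add: eval_closed)

lemma bmw_act_eq:
  assumes "t \<in> bmw_exprs n l r" "v \<in> carrier V"
  shows "bmw_act n l r (bmw_rel n l r `` {t}) v = bmw_eval n l r t v"
proof -
  have "(\<lambda>s. bmw_eval n l r s v) ` (bmw_rel n l r `` {t}) = {bmw_eval n l r t v}"
  proof (rule equalityI)
    show "(\<lambda>s. bmw_eval n l r s v) ` (bmw_rel n l r `` {t}) \<subseteq> {bmw_eval n l r t v}"
      using bmw_cong_eval[OF _ assms(2)] by (auto simp: bmw_rel_def)
    show "{bmw_eval n l r t v} \<subseteq> (\<lambda>s. bmw_eval n l r s v) ` (bmw_rel n l r `` {t})"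
      using bmw_cong.refl[OF assms(1)] by (auto simp: bmw_rel_def)
  qed
  then show ?thesis
    by (simp add: bmw_act_def)
qed

lemma bmw_act_Gen:
  "1 \<le> k \<Longrightarrow> k \<le> n - 1 \<Longrightarrow> v \<in> carrier V \<Longrightarrow> bmw_act n l r (bmw_rel n l r `` {Gen k}) v = \<nu> k v"
  by (subst bmw_act_eq) (auto intro: bmw_exprs.Gen)

end

end

theory Submission
  imports Defs
begin

text \<open>
  Let \<open>W\<close> be an invariant subspace of dimension \<open>n - 1\<close>, and consider the functionals \<open>v (1, j)\<close> on \<open>W\<close>, for
  \<open>2 \<le> j \<le> n\<close>. They form a quotient of the permutation module of the Hecke algebra generated by
  \<open>\<nu> 2, \<dots>, \<nu> (n - 1)\<close>, whose only proper nonzero submodules are a line and a hyperplane; dimension counts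
  rule out both as kernel, so the first row is a system of coordinates on \<open>W\<close>. The second row is then
  a linear function of the first one. Equivariance under \<open>\<nu> 3, \<dots>, \<nu> (n - 1)\<close> and the braid relation
  leave two unknown constants in it, and the action of \<open>\<nu> 2\<close> determines these constants and forces
  \<open>l\<^sup>2 = r ^ (- 2 * (n - 3))\<close>. The remaining rows follow from the second one, hence uniqueness.

  Conversely, for these \<open>l\<close> there are vectors \<open>v\<^sub>1, \<dots>, v\<^sub>n\<^sub>-\<^sub>1\<close> such that \<open>\<nu> t - r\<close> maps their span into the
  line of \<open>v\<^sub>t\<close>, as for the reduced Burau representation. A vector killed by all \<open>\<nu> t - r\<close> has coefficients
  that satisfy a three-term recurrence, whose only solution is zero because \<open>r ^ (2 * n) \<noteq> 1\<close>. This gives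
  linear independence and irreducibility at once.
\<close>

section \<open>Subspaces in coordinates\<close>

text \<open>On coordinates the action shifts rows: \<open>\<nu> k v (k, j)\<close> equals
  \<open>v (k + 1, j)\<close> for \<open>j > k + 1\<close>, so a relation between the first two rows
  that holds on all of \<open>W\<close> propagates downwards. The exclusion of 4 comes from column
  5. It is used twice: to find the eigenvalue of \<open>\<nu> 3\<close> on the line met in
  \<open>row_sum_nonzero\<close>, and to isolate one coefficient of the second row. For
  \<open>n = 3\<close> column 4 is absent as well; the second row then has only two coefficients,
  and their equations admit an extra solution \<open>l = m\<close>, \<open>m\<^sup>2 = -1\<close>,
  which irreducibility removes. For \<open>n \<ge> 5\<close> the unit rows 2, 3, 4 give three
  equations; two determine the unknown constants in terms of \<open>l\<close> and \<open>r\<close>,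
  and the third becomes the condition on \<open>l\<close>. In the converse this condition appears as
  the cancellation of two geometric sums in the entry \<open>(k, k + 1)\<close>.\<close>

context lk_params
begin

interpretation V: vectorspace F V
  by (rule lk_space_vectorspace)

lemma subspace_submodule: "subspace F W V \<longleftrightarrow> submodule F W V"
  using lk_space_vectorspace by (auto simp: subspace_def)

lemma subspace_closed:
  assumes "subspace F W V"
  shows "v \<in> W \<Longrightarrow> v \<in> carrier V"
    and "\<zero>\<^bsub>V\<^esub> \<in> W"
    and "u \<in> W \<Longrightarrow> v \<in> W \<Longrightarrow> u \<oplus>\<^bsub>V\<^esub> v \<in> W"
    and "c \<in> carrier F \<Longrightarrow> v \<in> W \<Longrightarrow> c \<odot>\<^bsub>V\<^esub> v \<in> W"
  using assms unfolding subspace_submodule submodule_def by auto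

lemma subspaceI:
  assumes "W \<subseteq> carrier V" "\<zero>\<^bsub>V\<^esub> \<in> W"
    and "\<And>u v. u \<in> W \<Longrightarrow> v \<in> W \<Longrightarrow> u \<oplus>\<^bsub>V\<^esub> v \<in> W"
    and "\<And>c v. c \<in> carrier F \<Longrightarrow> v \<in> W \<Longrightarrow> c \<odot>\<^bsub>V\<^esub> v \<in> W"
  shows "subspace F W V"
  using assms V.module_axioms unfolding subspace_submodule submodule_def by auto

definition comb :: "('a \<Rightarrow> complex) \<Rightarrow> ('a \<Rightarrow> nat \<times> nat \<Rightarrow> complex) \<Rightarrow> 'a set \<Rightarrow> nat \<times> nat \<Rightarrow> complex" where
  "comb c x P = (\<Oplus>\<^bsub>V\<^esub>p\<in>P. c p \<odot>\<^bsub>V\<^esub> x p)"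

lemma comb_closed:
  "c \<in> P \<rightarrow> carrier F \<Longrightarrow> x \<in> P \<rightarrow> carrier V \<Longrightarrow> comb c x P \<in> carrier V"
  unfolding comb_def by (intro V.M.finsum_closed) (auto simp: Pi_iff)

lemma comb_apply:
  assumes "finite P" "c \<in> P \<rightarrow> carrier F" "x \<in> P \<rightarrow> carrier V" "q \<in> S"
  shows "comb c x P q = (\<Sum>p\<in>P. c p * x p q)"
  unfolding comb_def using assms by (subst finsum_pointwise) (auto simp: Pi_iff lk_space_pointwise)

lemma subspace_comb:
  assumes W: "subspace F W V" and "finite P" "c \<in> P \<rightarrow> carrier F" "x \<in> P \<rightarrow> W"
  shows "comb c x P \<in> W"
  using assms(2-)
proof (induction P rule: finite_induct)
  case empty
  then show ?case using subspace_closed[OF W] by (simp add: comb_def)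
next
  case (insert a P)
  then have "comb c x (insert a P) = c a \<odot>\<^bsub>V\<^esub> x a \<oplus>\<^bsub>V\<^esub> comb c x P"
    unfolding comb_def using subspace_closed(1)[OF W]
    by (intro V.M.finsum_insert) (auto simp: Pi_iff)
  then show ?case using insert subspace_closed[OF W] by (auto simp: Pi_iff)
qed

lemma lin_comb:
  assumes "lin T" "finite P" "c \<in> P \<rightarrow> carrier F" "x \<in> P \<rightarrow> carrier V"
  shows "T (comb c x P) = comb c (\<lambda>p. T (x p)) P"
proof -
  have "T (comb c x P) = (\<Oplus>\<^bsub>V\<^esub>p\<in>P. T (c p \<odot>\<^bsub>V\<^esub> x p))"
    unfolding comb_def using assms by (intro lin_finsum) (auto simp: Pi_iff)
  also have "\<dots> = comb c (\<lambda>p. T (x p)) P"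
    unfolding comb_def using assms
    by (intro V.M.finsum_cong') (auto simp: Pi_iff linD[OF assms(1)])
  finally show ?thesis .
qed

text \<open>Bases in the library are sets, while the families below are indexed. Independence of the
  family forces the indexing to be injective, so indices can be counted instead of vectors.\<close>

lemma lk_dim_eq_card:
  assumes W: "subspace F W V" and P: "finite P" and x: "x \<in> P \<rightarrow> W"
    and spans: "\<And>v. v \<in> W \<Longrightarrow> \<exists>c\<in>P \<rightarrow> carrier F. v = comb c x P"
    and indep: "\<And>c p. c \<in> P \<rightarrow> carrier F \<Longrightarrow> comb c x P = \<zero>\<^bsub>V\<^esub> \<Longrightarrow> p \<in> P \<Longrightarrow> c p = 0"
  shows "lk_dim n l r W = card P"
proof -
  interpret W: vectorspace F "V\<lparr>carrier := W\<rparr>" by (rule V.subspace_is_vs[OF W])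
  have subm: "submodule F W V" using W subspace_submodule by blast
  have xV: "x \<in> P \<rightarrow> carrier V" using x subspace_closed(1)[OF W] by auto
  have inj: "inj_on x P"
  proof (rule inj_onI, rule ccontr)
    fix a b assume ab: "a \<in> P" "b \<in> P" "x a = x b" "a \<noteq> b"
    define c where "c = (\<lambda>p. if p = a then 1 else if p = b then - 1 else (0::complex))"
    have c: "c \<in> P \<rightarrow> carrier F" by (auto simp: c_def)
    have "comb c x P q = \<zero>\<^bsub>V\<^esub> q" if q: "q \<in> S" for q
    proof -
      have "comb c x P q = (\<Sum>p\<in>P. c p * x p q)"
        using comb_apply[OF P c xV q] .
      also have "\<dots> = (\<Sum>p\<in>P. (if p = a then x a q else 0) + (if p = b then - x b q else 0))"
        using ab by (intro sum.cong) (auto simp: c_def)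
      also have "\<dots> = 0"
        unfolding sum.distrib using ab P by simp
      finally show ?thesis using q by (simp add: lk_space_pointwise)
    qed
    then have "comb c x P = \<zero>\<^bsub>V\<^esub>"
      using comb_closed[OF c xV] by (intro V_ext) auto
    from indep[OF c this ab(1)] show False by (simp add: c_def)
  qed
  have lincomb: "V.lincomb a (x ` P) = comb (\<lambda>p. a (x p)) x P" if "a \<in> x ` P \<rightarrow> carrier F" for a
  proof -
    have "(\<lambda>v. a v \<odot>\<^bsub>V\<^esub> v) \<in> x ` P \<rightarrow> carrier V"
    proof
      fix v assume v: "v \<in> x ` P"
      then have "v \<in> carrier V" "a v \<in> carrier F" using xV that by blast+
      then show "a v \<odot>\<^bsub>V\<^esub> v \<in> carrier V" by simp
    qed
    from V.M.finsum_reindex[OF this inj] show ?thesis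
      unfolding V.lincomb_def comb_def .
  qed
  have li: "V.lin_indpt (x ` P)"
  proof (rule V.finite_lin_indpt2)
    fix a assume a: "a \<in> x ` P \<rightarrow> carrier F" "V.lincomb a (x ` P) = \<zero>\<^bsub>V\<^esub>"
    show "\<forall>v\<in>x ` P. a v = \<zero>\<^bsub>F\<^esub>"
    proof
      fix v assume "v \<in> x ` P"
      then obtain p where p: "p \<in> P" "v = x p" by blast
      have "(\<lambda>p. a (x p)) \<in> P \<rightarrow> carrier F" using a(1) by blast
      from indep[OF this _ p(1)] show "a v = \<zero>\<^bsub>F\<^esub>"
        using a lincomb[OF a(1)] p(2) by simp
    qed
  qed (use P xV in auto)
  have sub: "x ` P \<subseteq> W" using x by auto
  have span: "V.span (x ` P) = W"
  proof
    show "V.span (x ` P) \<subseteq> W" by (rule V.span_is_subset[OF sub subm])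
    show "W \<subseteq> V.span (x ` P)"
    proof
      fix v assume "v \<in> W"
      from spans[OF this] obtain c where c: "c \<in> P \<rightarrow> carrier F" "v = comb c x P" by blast
      define a where "a = (\<lambda>u. c (inv_into P x u))"
      have a: "a (x p) = c p" if "p \<in> P" for p
        using that inj by (simp add: a_def)
      have aF: "a \<in> x ` P \<rightarrow> carrier F"
      proof
        fix v assume "v \<in> x ` P"
        then obtain p where "p \<in> P" "v = x p" by blast
        then show "a v \<in> carrier F" using a c(1) by (metis PiE)
      qed
      have "comb (\<lambda>p. a (x p)) x P = comb c x P"
      proof (unfold comb_def, rule V.M.finsum_cong')
        show "(\<lambda>p. c p \<odot>\<^bsub>V\<^esub> x p) \<in> P \<rightarrow> carrier V"
        proof
          fix p assume "p \<in> P"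
          then have "c p \<in> carrier F" "x p \<in> carrier V" using c(1) xV by blast+
          then show "c p \<odot>\<^bsub>V\<^esub> x p \<in> carrier V" by simp
        qed
      qed (simp_all add: a)
      then have "v = V.lincomb a (x ` P)" using lincomb[OF aF] c by simp
      then show "v \<in> V.span (x ` P)"
        unfolding V.span_def using aF P by blast
    qed
  qed
  have "W.basis (x ` P)"
    unfolding W.basis_def using V.span_li_not_depend[OF sub subm] li span sub by simp
  then have "W.dim = card (x ` P)" using W.dim_basis P by blast
  then show ?thesis using inj by (simp add: lk_dim_def card_image)
qed

text \<open>
  The coordinate functionals in \<open>P\<close> are linearly independent on \<open>W\<close> (\<open>coord_dual\<close>), respectively span
  the dual of \<open>W\<close> (\<open>coord_inj\<close>).
\<close>

definition coord_dual :: "(nat \<times> nat \<Rightarrow> complex) set \<Rightarrow> (nat \<times> nat) set \<Rightarrow> bool" where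
  "coord_dual W P \<longleftrightarrow> (\<exists>x\<in>P \<rightarrow> W. \<forall>p\<in>P. \<forall>q\<in>P. x p q = (if q = p then 1 else 0))"

definition coord_inj :: "(nat \<times> nat \<Rightarrow> complex) set \<Rightarrow> (nat \<times> nat) set \<Rightarrow> bool" where
  "coord_inj W P \<longleftrightarrow> (\<forall>v\<in>W. (\<forall>p\<in>P. v p = 0) \<longrightarrow> v = \<zero>\<^bsub>V\<^esub>)"

lemma coord_injD: "coord_inj W P \<Longrightarrow> v \<in> W \<Longrightarrow> (\<And>p. p \<in> P \<Longrightarrow> v p = 0) \<Longrightarrow> v = \<zero>\<^bsub>V\<^esub>"
  by (simp add: coord_inj_def)

lemma lk_dim_coords:
  assumes W: "subspace F W V" and "P \<subseteq> S" "coord_dual W P" "coord_inj W P"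
  shows "lk_dim n l r W = card P"
proof -
  from assms(3) obtain x where x: "x \<in> P \<rightarrow> W"
    "\<And>p q. p \<in> P \<Longrightarrow> q \<in> P \<Longrightarrow> x p q = (if q = p then 1 else 0)"
    unfolding coord_dual_def by blast
  have P: "finite P" using assms(2) finite_lk_index finite_subset by blast
  have xV: "x \<in> P \<rightarrow> carrier V" using x(1) subspace_closed(1)[OF W] by blast
  have coord: "comb c x P q = c q" if "c \<in> P \<rightarrow> carrier F" "q \<in> P" for c q
  proof -
    have "comb c x P q = (\<Sum>p\<in>P. c p * x p q)"
      using comb_apply[OF P that(1) xV] that assms(2) by blast
    also have "\<dots> = (\<Sum>p\<in>P. if p = q then c q else 0)"
      using x that by (intro sum.cong) auto
    finally show ?thesis using P that by simp
  qed
  show ?thesis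
  proof (rule lk_dim_eq_card[OF W P x(1)])
    fix c p assume "c \<in> P \<rightarrow> carrier F" "comb c x P = \<zero>\<^bsub>V\<^esub>" "p \<in> P"
    with coord[of c p] assms(2) show "c p = 0" by (auto simp: lk_space_pointwise)
  next
    fix v assume v: "v \<in> W"
    then have vV: "v \<in> carrier V" using subspace_closed(1)[OF W] by blast
    then have vF: "v \<in> P \<rightarrow> carrier F" using assms(2) by auto
    define u where "u = v \<oplus>\<^bsub>V\<^esub> (- 1) \<odot>\<^bsub>V\<^esub> comb v x P"
    have uW: "u \<in> W"
      unfolding u_def using v subspace_comb[OF W P vF x(1)] by (intro subspace_closed[OF W]) auto
    have "u = \<zero>\<^bsub>V\<^esub>"
      using coord[OF vF] assms(2) by (intro coord_injD[OF assms(4) uW]) (auto simp: u_def lk_space_pointwise)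
    then have "u q = 0" if "q \<in> S" for q using that by (simp add: lk_space_pointwise)
    then have "v = comb v x P"
      using vV comb_closed[OF vF xV] by (intro V_ext) (auto simp: u_def lk_space_pointwise)
    with vF show "\<exists>c\<in>P \<rightarrow> carrier F. v = comb c x P" by blast
  qed
qed

text \<open>Steinitz exchange for coordinate functionals: a maximal independent set between
  \<open>A\<close> and \<open>B\<close> already separates the vectors of \<open>W\<close>, since
  otherwise some \<open>b\<close> in \<open>B\<close> could be added.\<close>

lemma coord_exchange:
  assumes W: "subspace F W V" and AB: "A \<subseteq> B" "B \<subseteq> S" and "coord_dual W A" "coord_inj W B"
  shows "\<exists>P. A \<subseteq> P \<and> P \<subseteq> B \<and> coord_dual W P \<and> coord_inj W P"
proof -
  have finB: "finite B" using AB finite_lk_index finite_subset by blast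
  define Z where "Z = {P. A \<subseteq> P \<and> P \<subseteq> B \<and> coord_dual W P}"
  have "finite Z" "Z \<noteq> {}"
    using finB assms(4) AB by (auto simp: Z_def intro: finite_subset[of _ "Pow B"])
  then obtain P where P: "P \<in> Z" "\<And>Q. Q \<in> Z \<Longrightarrow> P \<subseteq> Q \<Longrightarrow> Q = P"
    using finite_has_maximal[of Z] by metis
  then have PB: "A \<subseteq> P" "P \<subseteq> B" "coord_dual W P" by (auto simp: Z_def)
  then obtain x where x: "x \<in> P \<rightarrow> W"
    "\<And>p q. p \<in> P \<Longrightarrow> q \<in> P \<Longrightarrow> x p q = (if q = p then 1 else 0)"
    unfolding coord_dual_def by blast
  have "coord_inj W P"
    unfolding coord_inj_def
  proof (intro ballI impI, rule ccontr)
    fix v assume v: "v \<in> W" "\<forall>p\<in>P. v p = 0" "v \<noteq> \<zero>\<^bsub>V\<^esub>"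
    then obtain b where b: "b \<in> B" "v b \<noteq> 0" using coord_injD[OF assms(5)] by blast
    have bP: "b \<notin> P" using b v by auto
    have bS: "b \<in> S" using b AB by blast
    have vb: "v b \<in> carrier F" using bS v subspace_closed(1)[OF W] by auto
    have xV: "x p \<in> carrier V" if "p \<in> P" for p using that x(1) subspace_closed(1)[OF W] by blast
    \<comment> \<open>Gaussian elimination with pivot \<open>v b\<close>: as \<open>v\<close>
      vanishes on \<open>P\<close>, subtracting multiples of it clears coordinate \<open>b\<close>
      without disturbing the duality on \<open>P\<close>.\<close>
    define y where "y = (\<lambda>p. if p = b then inverse (v b) \<odot>\<^bsub>V\<^esub> v
      else x p \<oplus>\<^bsub>V\<^esub> (- x p b / v b) \<odot>\<^bsub>V\<^esub> v)"
    have "y p \<in> W" if "p \<in> insert b P" for p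
    proof (cases "p = b")
      case True
      then show ?thesis
        unfolding y_def using v vb by (simp add: subspace_closed(4)[OF W])
    next
      case False
      then have p: "p \<in> P" using that by blast
      then have "p \<in> P" "x p \<in> W" using x(1) by auto
      then have "- x p b / v b \<in> carrier F"
        using bS vb xV subspace_closed(1)[OF W v(1)] by (intro bmw_field_divide bmw_field_uminus coeff_closed) auto
      then have "x p \<oplus>\<^bsub>V\<^esub> (- x p b / v b) \<odot>\<^bsub>V\<^esub> v \<in> W"
        using \<open>x p \<in> W\<close> v(1) subspace_closed(3,4)[OF W] by blast
      then show ?thesis unfolding y_def using False by simp
    qed
    then have "y \<in> insert b P \<rightarrow> W" by blast
    moreover have "y p q = (if q = p then 1 else 0)" if "p \<in> insert b P" "q \<in> insert b P" for p q
    proof -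
      have "q \<in> S" using that bS PB AB by blast
      then show ?thesis
        using that b bP v(2) x(2)[of p q]
        by (cases "p = b"; cases "q = b") (auto simp: y_def lk_space_pointwise)
    qed
    ultimately have "coord_dual W (insert b P)" unfolding coord_dual_def by blast
    then have "insert b P \<in> Z" using PB b by (auto simp: Z_def)
    then show False using P(2)[of "insert b P"] bP by auto
  qed
  with PB show ?thesis by blast
qed

lemma coord_inj_S: "subspace F W V \<Longrightarrow> coord_inj W S"
  unfolding coord_inj_def using subspace_closed(1)[of W]
  by (auto intro!: V_ext simp: lk_space_pointwise)

lemma coord_dual_empty: "coord_dual W {}"
  by (auto simp: coord_dual_def)

lemma dual_card_eq_dim_imp_inj:
  assumes W: "subspace F W V" and "A \<subseteq> S" "coord_dual W A" "card A = lk_dim n l r W"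
  shows "coord_inj W A"
proof -
  obtain P where P: "A \<subseteq> P" "P \<subseteq> S" "coord_dual W P" "coord_inj W P"
    using coord_exchange[OF W assms(2) subset_refl assms(3) coord_inj_S[OF W]] by blast
  have "card P = card A" using lk_dim_coords[OF W P(2-4)] assms(4) by simp
  then have "A = P" using P finite_subset[OF P(2) finite_lk_index] by (intro card_subset_eq) auto
  then show ?thesis using P by simp
qed

lemma inj_imp_dim_le_card:
  assumes W: "subspace F W V" and "A \<subseteq> S" "coord_inj W A"
  shows "lk_dim n l r W \<le> card A"
    and "card A = lk_dim n l r W \<Longrightarrow> coord_dual W A"
proof -
  obtain P where P: "P \<subseteq> A" "coord_dual W P" "coord_inj W P"
    using coord_exchange[OF W _ assms(2) coord_dual_empty assms(3)] by blast
  have dim: "lk_dim n l r W = card P" using lk_dim_coords[OF W _ P(2,3)] P(1) assms(2) by blast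
  have fin: "finite A" using assms(2) finite_lk_index finite_subset by blast
  show "lk_dim n l r W \<le> card A" using dim P fin card_mono by metis
  assume "card A = lk_dim n l r W"
  then have "P = A" using dim P fin card_subset_eq by metis
  then show "coord_dual W A" using P by simp
qed

text \<open>\<open>A\<close> extends to a full coordinate system by a single index \<open>b\<close>;
  the generator of the line is the vector dual to \<open>b\<close>.\<close>

lemma dual_card_Suc_eq_dim:
  assumes W: "subspace F W V" and A: "A \<subseteq> S" "coord_dual W A" "Suc (card A) = lk_dim n l r W"
  obtains u where "u \<in> W" "u \<noteq> \<zero>\<^bsub>V\<^esub>" "\<And>p. p \<in> A \<Longrightarrow> u p = 0"
    "\<And>v. v \<in> W \<Longrightarrow> (\<And>p. p \<in> A \<Longrightarrow> v p = 0) \<Longrightarrow> \<exists>c\<in>carrier F. v = c \<odot>\<^bsub>V\<^esub> u"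
proof -
  obtain P where P: "A \<subseteq> P" "P \<subseteq> S" "coord_dual W P" "coord_inj W P"
    using coord_exchange[OF W A(1) subset_refl A(2) coord_inj_S[OF W]] by blast
  have finP: "finite P" using P finite_lk_index finite_subset by blast
  then have finA: "finite A" using P finite_subset by blast
  have "card P = Suc (card A)" using lk_dim_coords[OF W P(2-4)] A(3) by simp
  then have "card (P - A) = 1" using card_Diff_subset[OF finA P(1)] by simp
  then obtain b where b: "P - A = {b}" using card_1_singletonE by blast
  then have bP: "b \<in> P" "b \<notin> A" "P = insert b A" using P(1) by auto
  obtain x where x: "x \<in> P \<rightarrow> W"
    "\<And>p q. p \<in> P \<Longrightarrow> q \<in> P \<Longrightarrow> x p q = (if q = p then 1 else 0)"
    using P(3) unfolding coord_dual_def by blast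
  have xb: "x b \<in> W" using x bP by auto
  have bS: "b \<in> S" using bP P by blast
  show thesis
  proof
    show "x b \<in> W" by fact
    show "x b \<noteq> \<zero>\<^bsub>V\<^esub>" using x(2)[OF bP(1) bP(1)] bS by (auto simp: lk_space_pointwise)
    show "x b p = 0" if "p \<in> A" for p using x(2)[of b p] that bP P by auto
    show "\<exists>c\<in>carrier F. v = c \<odot>\<^bsub>V\<^esub> x b" if v: "v \<in> W" "\<And>p. p \<in> A \<Longrightarrow> v p = 0" for v
    proof -
      have V: "v \<in> carrier V" "x b \<in> carrier V" using v xb subspace_closed(1)[OF W] by auto
      have vb: "v b \<in> carrier F" using V bS by auto
      define u where "u = v \<oplus>\<^bsub>V\<^esub> (- v b) \<odot>\<^bsub>V\<^esub> x b"
      have uW: "u \<in> W" unfolding u_def using v xb vb by (intro subspace_closed[OF W]) auto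
      have "u = \<zero>\<^bsub>V\<^esub>"
      proof (rule coord_injD[OF P(4) uW])
        fix p assume p: "p \<in> P"
        then have "p \<in> S" using P by blast
        then show "u p = 0" using p bP v x(2)[OF bP(1) p] by (cases "p = b") (simp_all add: u_def lk_space_pointwise)
      qed
      then have "u q = 0" if "q \<in> S" for q using that by (simp add: lk_space_pointwise)
      then have "v = v b \<odot>\<^bsub>V\<^esub> x b"
        using V vb by (intro V_ext) (auto simp: u_def lk_space_pointwise)
      then show ?thesis using vb by blast
    qed
  qed
qed

end

section \<open>The action in coordinates\<close>

context lk_params
begin

interpretation V: vectorspace F V
  by (rule lk_space_vectorspace)

lemma lk_invariant_subspace: "lk_invariant n l r W \<Longrightarrow> subspace F W V"
  by (simp add: lk_invariant_def)

lemma lk_invariant_nu: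
  assumes "lk_invariant n l r W" "1 \<le> k" "k < n" "v \<in> W"
  shows "\<nu> k v \<in> W"
proof -
  have "bmw_rel n l r `` {Gen k} \<in> carrier (bmw_algebra n l r)"
    using assms by (auto simp: bmw_algebra_def intro!: quotientI bmw_exprs.Gen)
  then have "bmw_act n l r (bmw_rel n l r `` {Gen k}) v \<in> W"
    using assms by (simp add: lk_invariant_def)
  then show ?thesis
    using assms subspace_closed(1)[OF lk_invariant_subspace[OF assms(1)]] by (simp add: bmw_act_Gen)
qed

text \<open>Inverse generators need no separate hypothesis: \<open>\<mu> k\<close>, which inverts
  \<open>\<nu> k\<close>, is a quadratic polynomial in \<open>\<nu> k\<close>.\<close>

lemma lk_invariantI:
  assumes W: "subspace F W V" and nu: "\<And>k v. 1 \<le> k \<Longrightarrow> k < n \<Longrightarrow> v \<in> W \<Longrightarrow> \<nu> k v \<in> W"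
  shows "lk_invariant n l r W"
  unfolding lk_invariant_def
proof (intro conjI ballI)
  fix X v assume X: "X \<in> carrier (bmw_algebra n l r)" and v: "v \<in> W"
  then obtain t where t: "t \<in> bmw_exprs n l r" "X = bmw_rel n l r `` {t}"
    by (auto simp: bmw_algebra_def elim!: quotientE)
  have "bmw_eval n l r t v \<in> W"
    using t(1) v
  proof (induction arbitrary: v rule: bmw_exprs.induct)
    case (GenInv k)
    have k: "1 \<le> k" "k < n" using GenInv by auto
    have "\<mu> k v \<in> W"
      unfolding \<mu>_def using GenInv nu[OF k] nu[OF k nu[OF k]] W
      by (intro subspace_closed(3,4)[OF W] bmw_field_minus bmw_field_mult bmw_field_uminus) auto
    moreover have "inv_into (carrier V) (\<nu> k) v = \<mu> k v"
      using k GenInv(3) subspace_closed(1)[OF W] by (intro nu_inv) auto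
    ultimately show ?case by simp
  qed (use nu subspace_closed[OF W] in auto)
  then show "bmw_act n l r X v \<in> W"
    using t bmw_act_eq[OF t(1), of v] subspace_closed(1)[OF W v] by simp
qed (rule W)

context
  fixes k v
  assumes k: "1 \<le> k" "k < n" and v: "v \<in> carrier V"
begin

lemma nu_coord_disjoint:
  assumes "(i, j) \<in> S" "i \<noteq> k" "i \<noteq> Suc k" "j \<noteq> k" "j \<noteq> Suc k"
  shows "\<nu> k v (i, j) = r * v (i, j)"
proof -
  have "v p * lk_nu_basis n l r k p (i, j) = (if p = (i, j) then r * v p else 0)" if "p \<in> S" for p
    using assms that k
    by (cases p) (auto simp: lk_nu_basis_def Let_def lk_space_pointwise w_apply S_iff)
  then show ?thesis
    using nu_apply[OF v assms(1), of k] assms(1) by simp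
qed

text \<open>The transpose of the action on basis vectors. The first equation is the source of every
  passage from one row to the next.\<close>

lemma nu_coord_left:
  assumes "Suc k < j" "j \<le> n"
  shows "\<nu> k v (k, j) = v (Suc k, j)"
    and "\<nu> k v (Suc k, j) = v (k, j) - m * v (Suc k, j)"
proof -
  have S: "(k, j) \<in> S" "(Suc k, j) \<in> S" using assms k by (auto simp: S_iff)
  have 1: "lk_nu_basis n l r k p (k, j) = (if p = (Suc k, j) then 1 else 0)" if "p \<in> S" for p
    using assms that k S
    by (cases p) (auto simp: lk_nu_basis_def Let_def lk_space_pointwise w_apply S_iff)
  have 2: "v p * lk_nu_basis n l r k p (Suc k, j)
      = (if p = (k, j) then v p else 0) + (if p = (Suc k, j) then - m * v p else 0)" if "p \<in> S" for p
    using assms that k S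
    by (cases p) (auto simp: lk_nu_basis_def Let_def lk_space_pointwise w_apply S_iff)
  show "\<nu> k v (k, j) = v (Suc k, j)"
    using nu_apply[OF v S(1), of k] 1 S by (simp add: if_distrib cong: if_cong)
  show "\<nu> k v (Suc k, j) = v (k, j) - m * v (Suc k, j)"
    using nu_apply[OF v S(2), of k] S by (simp add: 2 sum.distrib)
qed

lemma nu_coord_right:
  assumes "1 \<le> i" "i < k"
  shows "\<nu> k v (i, k) = v (i, Suc k)"
    and "\<nu> k v (i, Suc k) = v (i, k) - m * v (i, Suc k)"
proof -
  have S: "(i, k) \<in> S" "(i, Suc k) \<in> S" using assms k by (auto simp: S_iff)
  have 1: "lk_nu_basis n l r k p (i, k) = (if p = (i, Suc k) then 1 else 0)" if "p \<in> S" for p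
    using assms that k S
    by (cases p) (auto simp: lk_nu_basis_def Let_def lk_space_pointwise w_apply S_iff)
  have 2: "v p * lk_nu_basis n l r k p (i, Suc k)
      = (if p = (i, k) then v p else 0) + (if p = (i, Suc k) then - m * v p else 0)" if "p \<in> S" for p
    using assms that k S
    by (cases p) (auto simp: lk_nu_basis_def Let_def lk_space_pointwise w_apply S_iff)
  show "\<nu> k v (i, k) = v (i, Suc k)"
    using nu_apply[OF v S(1), of k] 1 S by (simp add: if_distrib cong: if_cong)
  show "\<nu> k v (i, Suc k) = v (i, k) - m * v (i, Suc k)"
    using nu_apply[OF v S(2), of k] S by (simp add: 2 sum.distrib)
qed

lemma nu_coord_diag:
  "\<nu> k v (k, Suc k) = v (k, Suc k) / l + m * (\<Sum>j=k+2..n. r ^ (j - k - 2) * v (Suc k, j))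
     + m / l * (\<Sum>i=1..<k. v (i, Suc k) / r ^ (k - 1 - i))"
proof -
  have S: "(k, Suc k) \<in> S" using k by (auto simp: S_iff)
  define A where "A = Pair (Suc k) ` {k+2..n}"
  define B where "B = (\<lambda>i. (i, Suc k)) ` {1..<k}"
  have AB: "A \<subseteq> S" "B \<subseteq> S" using k by (auto simp: A_def B_def S_iff)
  have 1: "v p * lk_nu_basis n l r k p (k, Suc k) = (if p = (k, Suc k) then v p / l else 0)
      + (if p \<in> A then v p * (m * r ^ (snd p - k - 2)) else 0)
      + (if p \<in> B then v p * (m / (l * r ^ (k - 1 - fst p))) else 0)" if "p \<in> S" for p
    using that k S
    by (cases p) (auto simp: lk_nu_basis_def Let_def lk_space_pointwise w_apply S_iff A_def B_def field_simps)
  have "\<nu> k v (k, Suc k) = v (k, Suc k) / l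
      + (\<Sum>p\<in>A. v p * (m * r ^ (snd p - k - 2)))
      + (\<Sum>p\<in>B. v p * (m / (l * r ^ (k - 1 - fst p))))"
    using nu_apply[OF v S, of k] S AB
    by (simp add: 1 sum.distrib sum.If_cases Int_absorb1)
  moreover have "(\<Sum>p\<in>A. v p * (m * r ^ (snd p - k - 2)))
      = m * (\<Sum>j=k+2..n. r ^ (j - k - 2) * v (Suc k, j))"
    unfolding A_def by (subst sum.reindex) (auto simp: inj_on_def sum_distrib_left intro!: sum.cong)
  moreover have "(\<Sum>p\<in>B. v p * (m / (l * r ^ (k - 1 - fst p))))
      = m / l * (\<Sum>i=1..<k. v (i, Suc k) / r ^ (k - 1 - i))"
    unfolding B_def by (subst sum.reindex) (auto simp: inj_on_def sum_distrib_left intro!: sum.cong)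
  ultimately show ?thesis by simp
qed

end

end

section \<open>The first row of an invariant subspace\<close>

locale lk_semisimple = lk_params +
  assumes n3: "3 \<le> n" and r_pow: "1 \<le> k \<Longrightarrow> k \<le> n \<Longrightarrow> r ^ (2 * k) \<noteq> 1"
begin

interpretation V: vectorspace F V
  by (rule lk_space_vectorspace)

lemma r_m: "r * m = 1 - r ^ 2" "r + m = 1 / r"
  using r0 by (simp_all add: bmw_m_def field_simps power2_eq_square)

lemma geometric_sum_nonzero: "(\<Sum>j=3..n. r ^ (2 * j)) \<noteq> 0"
proof
  assume "(\<Sum>j=3..n. r ^ (2 * j)) = 0"
  then have "(1 - r\<^sup>2) * (\<Sum>j=3..n. (r\<^sup>2) ^ j) = 0" by (simp add: power_mult)
  then have "(r\<^sup>2) ^ 3 = (r\<^sup>2) ^ Suc n"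
    using n3 by (subst (asm) sum_gp_multiplied) auto
  moreover have "(r\<^sup>2) ^ Suc n = (r\<^sup>2) ^ 3 * r ^ (2 * (n - 2))"
  proof -
    have "2 * Suc n = 2 * 3 + 2 * (n - 2)" using n3 by simp
    then show ?thesis by (simp only: power_mult[symmetric] power_add[symmetric])
  qed
  ultimately have "r ^ (2 * (n - 2)) = 1" using r0 by simp
  then show False using r_pow[of "n - 2"] n3 by simp
qed

lemma geometric_sum4: "m * (\<Sum>j=4..n. r ^ (j - 4) * r ^ (j - 3)) = 1 - r ^ (2 * (n - 3))"
proof (cases "n = 3")
  case False
  then have n4: "4 \<le> n" using n3 by simp
  have e: "a + a - 7 = Suc (2 * (a - 4))" if "4 \<le> a" for a :: nat
    using that by simp
  have "(\<Sum>j=4..n. r ^ (j - 4) * r ^ (j - 3)) = (\<Sum>j=0..n-4. r * (r\<^sup>2) ^ j)"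
    using n4
    by (intro sum.reindex_bij_witness[of _ "\<lambda>j. j + 4" "\<lambda>j. j - 4"])
       (auto simp: e power_mult[symmetric] simp flip: power_add)
  then have "m * (\<Sum>j=4..n. r ^ (j - 4) * r ^ (j - 3)) = (1 - r\<^sup>2) * (\<Sum>j=0..n-4. (r\<^sup>2) ^ j)"
    by (simp flip: sum_distrib_left r_m(1))
  also have "\<dots> = 1 - (r\<^sup>2) ^ Suc (n - 4)"
    by (subst sum_gp_multiplied) auto
  also have "Suc (n - 4) = n - 3" using n4 by simp
  finally show ?thesis by (simp add: power_mult)
qed simp

text \<open>The eigenvector, for the eigenvalue \<open>- 1 / r\<close>, of the two by two block by
  which \<open>\<nu> k\<close> acts on the entries \<open>(1, k)\<close> and
  \<open>(1, k + 1)\<close>.\<close>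

definition row_d :: "nat \<Rightarrow> nat \<Rightarrow> complex" where
  "row_d k j = (if j = k then 1 else if j = Suc k then - 1 / r else 0)"

text \<open>Up to a factor the only functional of the first row that kills every
  \<open>row_d k\<close>. It spans the line in the module of functionals; the hyperplane there is
  spanned by the \<open>v (1, Suc j) - r * v (1, j)\<close>.\<close>

definition row_sum :: "(nat \<times> nat \<Rightarrow> complex) \<Rightarrow> complex" where
  "row_sum v = (\<Sum>j=2..n. r ^ j * v (1, j))"

definition row_tail :: "(nat \<times> nat \<Rightarrow> complex) \<Rightarrow> complex" where
  "row_tail v = (\<Sum>j=3..n. r ^ j * v (1, j))"

lemma row_S: "2 \<le> j \<Longrightarrow> j \<le> n \<Longrightarrow> (1, j) \<in> S" "2 \<le> j \<Longrightarrow> j \<le> n \<Longrightarrow> (Suc 0, j) \<in> S"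
  by (simp_all add: S_iff)

lemma nu_row:
  assumes "2 \<le> k" "k < n" "v \<in> carrier V" "2 \<le> j" "j \<le> n"
  shows "\<nu> k v (1, j) = r * v (1, j) + (v (1, Suc k) - r * v (1, k)) * row_d k j"
proof -
  consider "j = k" | "j = Suc k" | "j \<noteq> k" "j \<noteq> Suc k" by blast
  then show ?thesis
  proof cases
    case 1
    then show ?thesis using nu_coord_right(1)[of k v 1] assms by (simp add: row_d_def)
  next
    case 2
    then show ?thesis using nu_coord_right(2)[of k v 1] assms r_m r0
      by (simp add: row_d_def bmw_m_def field_simps)
  next
    case 3
    then show ?thesis using nu_coord_disjoint[of k v 1 j] assms row_S by (simp add: row_d_def)
  qed
qed

lemmas nu_row_Suc = nu_row[unfolded One_nat_def]

lemma row_sum_d: "2 \<le> k \<Longrightarrow> k < n \<Longrightarrow> (\<Sum>j=2..n. r ^ j * row_d k j) = 0"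
proof -
  assume k: "2 \<le> k" "k < n"
  have "(\<Sum>j=2..n. r ^ j * row_d k j) = (\<Sum>j=2..n. (if j = k then r ^ k else 0) + (if j = Suc k then - (r ^ k) else 0))"
    using r0 by (intro sum.cong) (auto simp: row_d_def)
  also have "\<dots> = 0" using k by (simp add: sum.distrib)
  finally show ?thesis .
qed

lemma row_sum_eq: "row_sum v = r\<^sup>2 * v (1, 2) + row_tail v"
  unfolding row_sum_def row_tail_def using n3
  by (subst sum.atLeast_Suc_atMost) (auto simp: numeral_eq_Suc)

lemma row_sum_nu:
  assumes "2 \<le> k" "k < n" "v \<in> carrier V"
  shows "row_sum (\<nu> k v) = r * row_sum v"
proof -
  have "row_sum (\<nu> k v) = (\<Sum>j=2..n. r * (r ^ j * v (1, j)) + (v (1, Suc k) - r * v (1, k)) * (r ^ j * row_d k j))"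
    unfolding row_sum_def using assms by (intro sum.cong) (auto simp: nu_row_Suc algebra_simps)
  also have "\<dots> = r * row_sum v"
    unfolding sum.distrib row_sum_def sum_distrib_left[symmetric] using row_sum_d assms by simp
  finally show ?thesis .
qed

end

locale lk_subrep = lk_semisimple +
  fixes W
  assumes inv: "lk_invariant n l r W" and dim: "lk_dim n l r W = n - 1"
begin

interpretation V: vectorspace F V
  by (rule lk_space_vectorspace)

lemma subsp: "subspace F W V"
  by (rule lk_invariant_subspace[OF inv])

lemmas W_closed [simp] = subspace_closed[OF subsp]

lemma W_nu [simp]: "1 \<le> k \<Longrightarrow> k < n \<Longrightarrow> v \<in> W \<Longrightarrow> \<nu> k v \<in> W"
  by (rule lk_invariant_nu[OF inv])

lemma next_row:
  "1 \<le> i \<Longrightarrow> Suc i < j \<Longrightarrow> j \<le> n \<Longrightarrow> v \<in> W \<Longrightarrow> v (Suc i, j) = \<nu> i v (i, j)"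
  using nu_coord_left(1)[of i v j] by simp

lemma next_column:
  "1 \<le> i \<Longrightarrow> i < j \<Longrightarrow> j < n \<Longrightarrow> v \<in> W \<Longrightarrow> v (i, Suc j) = \<nu> j v (i, j)"
  using nu_coord_right(1)[of j v i] by simp

text \<open>This excludes the hyperplane as kernel. Otherwise shifting rows would make every row
  geometric with ratio \<open>r\<close>, and the \<open>n - 1\<close> entries
  \<open>(i, i + 1)\<close> would be independent coordinates on \<open>W\<close>. A vector with
  entry 1 at \<open>(1, 2)\<close> and 0 at \<open>(2, 3)\<close> is then sent by
  \<open>\<nu> 1\<close> to one whose first row begins \<open>1 / l\<close>, 0, which is not
  geometric.\<close>

lemma row_not_constant:
  "\<exists>v\<in>W. \<exists>j. 2 \<le> j \<and> j < n \<and> v (1, Suc j) \<noteq> r * v (1, j)"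
proof (rule ccontr)
  assume "\<not> ?thesis"
  then have geo: "v (1, Suc j) = r * v (1, j)" if "v \<in> W" "2 \<le> j" "j < n" for v j
    using that by blast
  have rows: "v (i, Suc (i + d)) = r ^ d * v (i, Suc i)" if "1 \<le> i" "v \<in> W" "Suc (i + d) \<le> n" for i v d
    using that
  proof (induction i arbitrary: v d rule: dec_induct)
    case base
    show ?case using base(2)
    proof (induction d)
      case (Suc d)
      then show ?case using geo[OF base(1), of "Suc (Suc d)"] by simp
    qed simp
  next
    case (step i)
    have "v (Suc i, Suc (Suc i + d)) = \<nu> i v (i, Suc (Suc i + d))"
      using step by (intro next_row) auto
    also have "\<dots> = r ^ Suc d * \<nu> i v (i, Suc i)"
      using step.IH[of "\<nu> i v" "Suc d"] step by simp
    finally have 1: "v (Suc i, Suc (Suc i + d)) = r ^ Suc d * \<nu> i v (i, Suc i)" .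
    have "v (Suc i, Suc (Suc i)) = \<nu> i v (i, Suc (Suc i))"
      using step by (intro next_row) auto
    also have "\<dots> = r * \<nu> i v (i, Suc i)"
      using step.IH[of "\<nu> i v" 1] step by simp
    finally show ?case using 1 by simp
  qed
  define A where "A = (\<lambda>i. (i, Suc i)) ` {1..<n}"
  have AS: "A \<subseteq> S" by (auto simp: A_def S_iff)
  have card: "card A = n - 1" unfolding A_def by (subst card_image) (auto simp: inj_on_def)
  have "coord_inj W A"
    unfolding coord_inj_def
  proof (intro ballI impI)
    fix v assume v: "v \<in> W" "\<forall>p\<in>A. v p = 0"
    show "v = \<zero>\<^bsub>V\<^esub>"
    proof (rule V_ext)
      fix q assume q: "q \<in> S"
      obtain i j where ij: "q = (i, j)" by (cases q)
      then obtain d where d: "j = Suc (i + d)" "1 \<le> i" using q less_iff_Suc_add[of i j] by (auto simp: S_iff)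
      have "v (i, Suc i) = 0" using v q d ij by (auto simp: A_def S_iff)
      then show "v q = \<zero>\<^bsub>V\<^esub> q" using rows[of i v d] v d ij q by (auto simp: lk_space_pointwise S_iff)
    qed (use v in auto)
  qed
  then have "coord_dual W A" using inj_imp_dim_le_card(2)[OF subsp AS] card dim by simp
  then obtain x where x: "x \<in> A \<rightarrow> W" "\<forall>p\<in>A. \<forall>q\<in>A. x p q = (if q = p then 1 else 0)"
    unfolding coord_dual_def by blast
  have A: "(1, 2) \<in> A" "(2, 3) \<in> A" using n3 by (auto simp: A_def image_iff)
  define v where "v = x (1, 2)"
  have v: "v \<in> W" "v (1, 2) = 1" "v (2, 3) = 0"
    using x A by (auto simp: v_def)
  have "v (2, j) = 0" if "3 \<le> j" "j \<le> n" for j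
  proof -
    have "Suc (2 + (j - 3)) = j" using that by simp
    then show ?thesis using rows[of 2 v "j - 3"] v that by simp
  qed
  then have "\<nu> 1 v (1, 2) = 1 / l"
    using nu_coord_diag[of 1 v] n3 v by (simp add: numeral_eq_Suc)
  moreover have "\<nu> 1 v (1, 3) = 0"
    using next_row[of 1 3 v] n3 v by (simp add: numeral_eq_Suc)
  moreover have "\<nu> 1 v (1, 3) = r * \<nu> 1 v (1, 2)"
    using geo[of "\<nu> 1 v" 2] n3 v by (simp add: numeral_eq_Suc)
  ultimately show False using l0 r0 by simp
qed

text \<open>On the first row, \<open>\<nu> k - r\<close> has rank one, with image spanned by \<open>row_d k\<close>.\<close>

lemma row_d_step:
  assumes "v \<in> W" "2 \<le> k" "k < n" "v (1, Suc k) \<noteq> r * v (1, k)"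
  shows "\<exists>u\<in>W. \<forall>j. 2 \<le> j \<longrightarrow> j \<le> n \<longrightarrow> u (1, j) = row_d k j"
proof -
  define a where "a = v (1, Suc k) - r * v (1, k)"
  have a: "a \<noteq> 0" "a \<in> carrier F"
    using assms row_S by (auto simp: a_def)
  define u where "u = inverse a \<odot>\<^bsub>V\<^esub> (\<nu> k v \<oplus>\<^bsub>V\<^esub> (- r) \<odot>\<^bsub>V\<^esub> v)"
  have "u \<in> W" unfolding u_def using assms a by (intro W_closed) auto
  moreover have "u (1, j) = row_d k j" if "2 \<le> j" "j \<le> n" for j
    using that assms a nu_row[of k v j] row_S[of j] by (simp add: u_def lk_space_pointwise a_def)
  ultimately show ?thesis by blast
qed

text \<open>\<open>row_d k\<close> has entries \<open>- 1 / r\<close>, 0 in columns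
  \<open>k + 1\<close>, \<open>k + 2\<close> and 0, 1 in columns \<open>k - 1\<close>,
  \<open>k\<close>. Neither pair has ratio \<open>r\<close>, so \<open>row_d_step\<close> propagates
  from one index to both neighbours.\<close>

lemma row_d_exists:
  assumes "2 \<le> k" "k < n"
  shows "\<exists>u\<in>W. \<forall>j. 2 \<le> j \<longrightarrow> j \<le> n \<longrightarrow> u (1, j) = row_d k j"
proof -
  obtain v k0 where k0: "v \<in> W" "2 \<le> k0" "k0 < n" "v (1, Suc k0) \<noteq> r * v (1, k0)"
    using row_not_constant by blast
  have base: "\<exists>u\<in>W. \<forall>j. 2 \<le> j \<longrightarrow> j \<le> n \<longrightarrow> u (1, j) = row_d k0 j"
    using row_d_step k0 by blast
  show ?thesis
  proof (cases "k0 \<le> k")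
    case True
    then show ?thesis using assms(2)
    proof (induction k rule: dec_induct)
      case base
      show ?case by fact
    next
      case (step k)
      then obtain u where "u \<in> W" "\<forall>j. 2 \<le> j \<longrightarrow> j \<le> n \<longrightarrow> u (1, j) = row_d k j" by auto
      then show ?case using row_d_step[of u "Suc k"] step k0 r0 by (simp add: row_d_def)
    qed
  next
    case False
    then have "k \<le> k0" by simp
    then show ?thesis using assms(1)
    proof (induction k rule: inc_induct)
      case base
      show ?case by fact
    next
      case (step k)
      then obtain u where "u \<in> W" "\<forall>j. 2 \<le> j \<longrightarrow> j \<le> n \<longrightarrow> u (1, j) = row_d (Suc k) j" by auto
      then show ?case using row_d_step[of u k] step k0 r0 by (simp add: row_d_def)
    qed
  qed
qed

text \<open>A telescoping sum of the \<open>row_d k\<close>, scaled by powers of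
  \<open>1 / r\<close>. Together these rows span the kernel of \<open>row_sum\<close> among first
  rows.\<close>

lemma row_difference_exists:
  assumes "2 \<le> t" "t \<le> n"
  shows "\<exists>z\<in>W. \<forall>j. 2 \<le> j \<longrightarrow> j \<le> n \<longrightarrow>
    z (1, j) = (if j = 2 then 1 else 0) - (if j = t then 1 / r ^ (t - 2) else 0)"
  using assms
proof (induction t rule: dec_induct)
  case base
  show ?case
    by (rule bexI[of _ "\<zero>\<^bsub>V\<^esub>"]) (auto simp: lk_space_pointwise row_S)
next
  case (step t)
  obtain z where z: "z \<in> W" "\<forall>j. 2 \<le> j \<longrightarrow> j \<le> n \<longrightarrow>
    z (1, j) = (if j = 2 then 1 else 0) - (if j = t then 1 / r ^ (t - 2) else 0)"
    using step by auto
  obtain u where u: "u \<in> W" "\<forall>j. 2 \<le> j \<longrightarrow> j \<le> n \<longrightarrow> u (1, j) = row_d t j"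
    using row_d_exists[of t] step by auto
  have t: "Suc t - 2 = Suc (t - 2)" using step by simp
  show ?case
  proof (intro bexI[of _ "z \<oplus>\<^bsub>V\<^esub> (1 / r ^ (t - 2)) \<odot>\<^bsub>V\<^esub> u"] allI impI)
    show "z \<oplus>\<^bsub>V\<^esub> (1 / r ^ (t - 2)) \<odot>\<^bsub>V\<^esub> u \<in> W"
      using z u by (intro W_closed) auto
    fix j assume j: "2 \<le> j" "j \<le> n"
    then have "(1, j) \<in> S" by (rule row_S)
    then have "(z \<oplus>\<^bsub>V\<^esub> (1 / r ^ (t - 2)) \<odot>\<^bsub>V\<^esub> u) (1, j) = z (1, j) + 1 / r ^ (t - 2) * u (1, j)"
      by (simp only: lk_space_pointwise)
    also have "\<dots> = (if j = 2 then 1 else 0) - (if j = t then 1 / r ^ (t - 2) else 0)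
        + 1 / r ^ (t - 2) * row_d t j"
      using z(2) u(2) j by simp
    also have "\<dots> = (if j = 2 then 1 else 0) - (if j = Suc t then 1 / r ^ (Suc t - 2) else 0)"
      using t by (auto simp: row_d_def)
    finally show "(z \<oplus>\<^bsub>V\<^esub> (1 / r ^ (t - 2)) \<odot>\<^bsub>V\<^esub> u) (1, j) =
        (if j = 2 then 1 else 0) - (if j = Suc t then 1 / r ^ (Suc t - 2) else 0)" .
  qed
qed

text \<open>
  If \<open>row_sum\<close> vanished on \<open>W\<close>, the kernel of the first row in \<open>W\<close> would be a line stable under
  \<open>\<nu> 2, \<dots>, \<nu> (n - 1)\<close>; these act on it by \<open>r\<close>, which fixes its generator \<open>v0\<close> up to a factor, and then
  \<open>row_sum (\<nu> 1 v0) \<noteq> 0\<close>.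
\<close>

lemma row_sum_nonzero:
  assumes "n \<noteq> 4"
  shows "\<exists>v\<in>W. row_sum v \<noteq> 0"
proof (rule ccontr)
  assume "\<not> ?thesis"
  then have zero: "row_sum v = 0" if "v \<in> W" for v using that by blast
  have row1: "v (1, 2) = 0" if v: "v \<in> W" "\<And>j. 3 \<le> j \<Longrightarrow> j \<le> n \<Longrightarrow> v (1, j) = 0" for v
    using zero[OF v(1)] v(2) r0 by (simp add: row_sum_eq row_tail_def)
  \<comment> \<open>In \<open>row_sum (\<nu> 1 v) = 0\<close> the shifted second row and the entry
    \<open>(1, 2)\<close> combine to a multiple of \<open>(r + m)\<close> times this sum, and
    \<open>r + m = 1 / r\<close>.\<close>
  have tail: "(\<Sum>j=3..n. r ^ j * v (2, j)) = 0" if v: "v \<in> W" "v (1, 2) = 0" for v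
  proof -
    let ?s = "\<Sum>j=3..n. r ^ j * v (2, j)"
    have "row_tail (\<nu> 1 v) = ?s"
      unfolding row_tail_def using next_row[of 1 _ v] v n3
      by (intro sum.cong) (auto simp: numeral_eq_Suc)
    moreover have "r ^ 3 * \<nu> 1 v (1, 2) = m * ?s"
    proof -
      have "\<nu> 1 v (1, 2) = m * (\<Sum>j=3..n. r ^ (j - 3) * v (2, j))"
        using nu_coord_diag[of 1 v] n3 v by (simp add: numeral_eq_Suc)
      moreover have "r ^ 3 * (\<Sum>j=3..n. r ^ (j - 3) * v (2, j)) = ?s"
        unfolding sum_distrib_left by (intro sum.cong) (auto simp flip: power_add mult.assoc)
      ultimately show ?thesis by (simp only: mult.left_commute[of "r ^ 3" m])
    qed
    moreover have "r * row_sum (\<nu> 1 v) = r ^ 3 * \<nu> 1 v (1, 2) + r * row_tail (\<nu> 1 v)"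
      by (simp only: row_sum_eq power2_eq_square power3_eq_cube ring_distribs mult.assoc)
    moreover have "row_sum (\<nu> 1 v) = 0"
      using zero[of "\<nu> 1 v"] v n3 by simp
    ultimately have "(r + m) * ?s = 0"
      by (simp only: ring_distribs mult_zero_right add.commute)
    then show ?thesis using r_m(2) r0 by simp
  qed
  show False
  proof (cases "n = 3")
    case True
    \<comment> \<open>For \<open>n = 3\<close> the two sum relations reduce every vector of
      \<open>W\<close> to its entry \<open>(1, 2)\<close>, so \<open>W\<close> would have dimension
      at most 1 instead of 2.\<close>
    have "coord_inj W {(1, 2)}"
      unfolding coord_inj_def
    proof (intro ballI impI)
      fix v assume v: "v \<in> W" "\<forall>p\<in>{(1, 2)}. v p = 0"
      have "v (1, 3) = 0" using zero[OF v(1), unfolded row_sum_eq row_tail_def] v r0 True by simp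
      moreover have "v (2, 3) = 0" using tail[OF v(1)] v r0 True by simp
      moreover have "q = (1, 2) \<or> q = (1, 3) \<or> q = (2, 3)" if "q \<in> S" for q
        using that True by (cases q) (auto simp: lk_index_def)
      ultimately show "v = \<zero>\<^bsub>V\<^esub>"
        using v by (intro V_ext) (auto simp: lk_space_pointwise)
    qed
    then have "lk_dim n l r W \<le> card {(1::nat, 2::nat)}"
      using n3 by (intro inj_imp_dim_le_card(1)[OF subsp]) (auto simp: S_iff)
    then show False using dim True by simp
  next
    case False
    then have n5: "5 \<le> n" using n3 assms by simp
    define A where "A = Pair (1::nat) ` {3..n}"
    have AS: "A \<subseteq> S" by (auto simp: A_def S_iff)
    have cardA: "Suc (card A) = lk_dim n l r W"
      unfolding A_def dim using n3 by (subst card_image) (auto simp: inj_on_def)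
    have "\<exists>u\<in>W. \<forall>j. 3 \<le> j \<longrightarrow> j \<le> n \<longrightarrow> u (1, j) = (if j = t then 1 else 0)" if t: "3 \<le> t" "t \<le> n" for t
    proof -
      obtain z where z: "z \<in> W" "\<forall>j. 2 \<le> j \<longrightarrow> j \<le> n \<longrightarrow>
        z (1, j) = (if j = 2 then 1 else 0) - (if j = t then 1 / r ^ (t - 2) else 0)"
        using row_difference_exists[of t] t by auto
      show ?thesis
      proof (intro bexI[of _ "(- (r ^ (t - 2))) \<odot>\<^bsub>V\<^esub> z"] allI impI)
        fix j assume j: "3 \<le> j" "j \<le> n"
        then have "(1, j) \<in> S" by (simp add: S_iff)
        then have "((- (r ^ (t - 2))) \<odot>\<^bsub>V\<^esub> z) (1, j) = - (r ^ (t - 2)) * z (1, j)"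
          by (simp only: lk_space_pointwise)
        then show "((- (r ^ (t - 2))) \<odot>\<^bsub>V\<^esub> z) (1, j) = (if j = t then 1 else 0)"
          using z(2) j r0 by auto
      qed (use z in \<open>auto intro!: W_closed\<close>)
    qed
    then obtain b where b: "\<And>t. 3 \<le> t \<Longrightarrow> t \<le> n \<Longrightarrow> b t \<in> W"
      "\<And>t j. 3 \<le> t \<Longrightarrow> t \<le> n \<Longrightarrow> 3 \<le> j \<Longrightarrow> j \<le> n \<Longrightarrow> b t (1, j) = (if j = t then 1 else 0)"
      by metis
    have "coord_dual W A"
      unfolding coord_dual_def by (rule bexI[of _ "\<lambda>p. b (snd p)"]) (auto simp: A_def b b(2)[unfolded One_nat_def])
    then obtain v0 where v0: "v0 \<in> W" "v0 \<noteq> \<zero>\<^bsub>V\<^esub>" "\<And>p. p \<in> A \<Longrightarrow> v0 p = 0"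
      "\<And>v. v \<in> W \<Longrightarrow> (\<And>p. p \<in> A \<Longrightarrow> v p = 0) \<Longrightarrow> \<exists>c\<in>carrier F. v = c \<odot>\<^bsub>V\<^esub> v0"
      using dual_card_Suc_eq_dim[OF subsp AS _ cardA] by metis
    have row0: "v0 (1, j) = 0" if "3 \<le> j" "j \<le> n" for j
      using v0(3)[of "(1, j)"] that by (simp add: A_def)
    have row0': "v0 (1, j) = 0" if "2 \<le> j" "j \<le> n" for j
      using row1[OF v0(1) row0] row0[of j] that by (cases "j = 2") auto
    have "\<exists>c. \<forall>q\<in>S. \<nu> k v0 q = c * v0 q" if k: "2 \<le> k" "k < n" for k
    proof -
      have "\<nu> k v0 p = 0" if "p \<in> A" for p
        using that k v0(1) row0' by (auto simp: A_def nu_row simp flip: One_nat_def)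
      then obtain c where "\<nu> k v0 = c \<odot>\<^bsub>V\<^esub> v0" using v0(4)[of "\<nu> k v0"] k v0(1) by auto
      then show ?thesis by (auto simp: lk_space_pointwise)
    qed
    then obtain c where c: "\<And>k q. 2 \<le> k \<Longrightarrow> k < n \<Longrightarrow> q \<in> S \<Longrightarrow> \<nu> k v0 q = c k * v0 q"
      by metis
    have down: "v0 (Suc i, j) = c i * v0 (i, j)" if "2 \<le> i" "Suc i < j" "j \<le> n" for i j
      using next_row[of i j v0] c[of i "(i, j)"] that v0(1) by (simp add: S_iff)
    have right: "v0 (2, Suc j) = c j * v0 (2, j)" if "3 \<le> j" "j < n" for j
      using next_column[of 2 j v0] c[of j "(2, j)"] that v0(1) by (simp add: S_iff)
    have v23: "v0 (2, 3) \<noteq> 0"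
    proof
      assume 23: "v0 (2, 3) = 0"
      have 2: "v0 (2, j) = 0" if "3 \<le> j" "j \<le> n" for j
        using that by (induction j rule: dec_induct) (auto simp: 23 right)
      have rest: "v0 (i, j) = 0" if "2 \<le> i" "i < j" "j \<le> n" for i j
        using that by (induction i rule: dec_induct) (auto simp: 2 down)
      have "v0 q = 0" if "q \<in> S" for q
      proof -
        obtain i j where ij: "q = (i, j)" by (cases q)
        then have "i < j" "j \<le> n" "i = 1 \<or> 2 \<le> i" using that by (auto simp: S_iff)
        then show ?thesis using row0'[of j] rest[of i j] ij by auto
      qed
      then have "v0 = \<zero>\<^bsub>V\<^esub>"
        using v0(1) by (intro V_ext) (auto simp: lk_space_pointwise)
      with v0(2) show False ..
    qed
    have c_r: "c j = r" if "4 \<le> j" "j < n" for j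
      using nu_coord_disjoint[of j v0 2 3] c[of j "(2, 3)"] that v0(1) v23 by (simp add: S_iff)
    \<comment> \<open>\<open>\<nu> 3\<close> moves the entry \<open>(2, 3)\<close>, so its
      eigenvalue is read off at \<open>(2, 5)\<close>, which exists because \<open>n \<ge> 5\<close>
      and is nonzero because \<open>v0 (2, 4)\<close> is.\<close>
    have c3: "c 3 = r"
    proof -
      have "v0 (2, 3) - m * v0 (2, 4) = c 3 * v0 (2, 4)"
        using nu_coord_right(2)[of 3 v0 2] c[of 3 "(2, 4)"] n5 v0(1) by (simp add: S_iff)
      then have "v0 (2, 4) \<noteq> 0" using v23 by auto
      moreover have "v0 (2, 5) = r * v0 (2, 4)" using right[of 4] c_r[of 4] n5 by simp
      moreover have "c 3 * v0 (2, 5) = r * v0 (2, 5)"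
        using nu_coord_disjoint[of 3 v0 2 5] c[of 3 "(2, 5)"] n5 v0(1) by (simp add: S_iff)
      ultimately show ?thesis using r0 by auto
    qed
    have v2: "v0 (2, 3 + d) = r ^ d * v0 (2, 3)" if "3 + d \<le> n" for d
      using that
    proof (induction d)
      case (Suc d)
      then show ?case using right[of "3 + d"] c_r[of "3 + d"] c3 by (cases "d = 0") auto
    qed simp
    have "r ^ 3 * (r ^ j * v0 (2, j)) = r ^ (2 * j) * v0 (2, 3)" if "3 \<le> j" "j \<le> n" for j
    proof -
      obtain d where d: "j = 3 + d" using \<open>3 \<le> j\<close> le_Suc_ex by blast
      have "r ^ 3 * (r ^ (3 + d) * (r ^ d * v0 (2, 3))) = r ^ (3 + (3 + d) + d) * v0 (2, 3)"
        by (simp only: power_add mult.assoc)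
      also have "3 + (3 + d) + d = 2 * (3 + d)" by simp
      finally show ?thesis using v2[of d] that d by simp
    qed
    then have "r ^ 3 * (\<Sum>j=3..n. r ^ j * v0 (2, j)) = (\<Sum>j=3..n. r ^ (2 * j)) * v0 (2, 3)"
      unfolding sum_distrib_left sum_distrib_right by (intro sum.cong) auto
    then show False using tail[OF v0(1) row1[OF v0(1) row0]] geometric_sum_nonzero v23 by simp
  qed
qed

end

section \<open>The first row as a coordinate system on \<open>W\<close>\<close>

locale lk_subrep_ne4 = lk_subrep +
  assumes n4: "n \<noteq> 4"
begin

interpretation V: vectorspace F V
  by (rule lk_space_vectorspace)

lemma first_unit_row_exists:
  "\<exists>u\<in>W. \<forall>j. 2 \<le> j \<longrightarrow> j \<le> n \<longrightarrow> u (1, j) = (if j = 2 then 1 else 0)"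
proof -
  obtain x where x: "x \<in> W" "row_sum x \<noteq> 0" using row_sum_nonzero[OF n4] by blast
  have "\<exists>z\<in>W. \<forall>j. 2 \<le> j \<longrightarrow> j \<le> n \<longrightarrow>
    z (1, j) = (if j = 2 then 1 else 0) - (if j = t then 1 / r ^ (t - 2) else 0)" if "t \<in> {3..n}" for t
    using row_difference_exists[of t] that by simp
  then obtain z where z: "\<And>t. t \<in> {3..n} \<Longrightarrow> z t \<in> W"
    "\<And>t j. t \<in> {3..n} \<Longrightarrow> 2 \<le> j \<Longrightarrow> j \<le> n \<Longrightarrow>
      z t (1, j) = (if j = 2 then 1 else 0) - (if j = t then 1 / r ^ (t - 2) else 0)"
    by metis
  \<comment> \<open>Adding \<open>c t\<close> times \<open>z t\<close> cancels the entry of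
    \<open>x\<close> in column \<open>t\<close> and moves its weight to column 2, where
    \<open>row_sum x / r\<^sup>2\<close> accumulates.\<close>
  define c where "c = (\<lambda>t. x (1, t) * r ^ (t - 2))"
  have c: "c \<in> {3..n} \<rightarrow> carrier F"
    using x row_S by (auto simp: c_def)
  have zV: "z \<in> {3..n} \<rightarrow> carrier V" using z by auto
  define y where "y = x \<oplus>\<^bsub>V\<^esub> comb c z {3..n}"
  have yW: "y \<in> W"
    unfolding y_def using x z by (intro W_closed subspace_comb[OF subsp] c) auto
  have y: "y (1, j) = x (1, j) + (\<Sum>t=3..n. c t * ((if j = 2 then 1 else 0) - (if j = t then 1 / r ^ (t - 2) else 0)))"
    if "2 \<le> j" "j \<le> n" for j
  proof -
    have "y (1, j) = x (1, j) + comb c z {3..n} (1, j)"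
      unfolding y_def by (rule lk_space_add[OF row_S(1)[OF that]])
    also have "comb c z {3..n} (1, j) = (\<Sum>t=3..n. c t * z t (1, j))"
      by (rule comb_apply[OF _ c zV row_S(1)[OF that]]) simp
    finally show ?thesis using z(2) that by simp
  qed
  have y3: "y (1, j) = 0" if "3 \<le> j" "j \<le> n" for j
  proof -
    have "y (1, j) = x (1, j) + (\<Sum>t=3..n. c t * ((if j = 2 then 1 else 0) - (if j = t then 1 / r ^ (t - 2) else 0)))"
      using that by (intro y) auto
    also have "(\<Sum>t=3..n. c t * ((if j = 2 then 1 else 0) - (if j = t then 1 / r ^ (t - 2) else 0)))
        = (\<Sum>t=3..n. if t = j then - x (1, j) else 0)"
      using that r0 by (intro sum.cong) (auto simp: c_def)
    finally show ?thesis using that by simp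
  qed
  have y2: "r\<^sup>2 * y (1, 2) = row_sum x"
  proof -
    have "y (1, 2) = x (1, 2) + (\<Sum>t=3..n. x (1, t) * r ^ (t - 2))"
      using y[of 2] n3 by (simp add: c_def)
    moreover have "r\<^sup>2 * (\<Sum>t=3..n. x (1, t) * r ^ (t - 2)) = row_tail x"
      unfolding row_tail_def sum_distrib_left
    proof (rule sum.cong[OF HOL.refl])
      fix t assume "t \<in> {3..n}"
      then have "2 + (t - 2) = t" by auto
      then have p: "r ^ t = r\<^sup>2 * r ^ (t - 2)" by (simp only: power_add[symmetric])
      show "r\<^sup>2 * (x (1, t) * r ^ (t - 2)) = r ^ t * x (1, t)"
        unfolding p by (simp only: mult_ac)
    qed
    ultimately show ?thesis by (simp add: row_sum_eq algebra_simps)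
  qed
  have y2F: "y (1, 2) \<in> carrier F" "y (1, 2) \<noteq> 0"
    using yW row_S(1)[of 2] n3 y2 x(2) by auto
  show ?thesis
  proof (intro bexI[of _ "inverse (y (1, 2)) \<odot>\<^bsub>V\<^esub> y"] allI impI)
    show "inverse (y (1, 2)) \<odot>\<^bsub>V\<^esub> y \<in> W" using yW y2F(1) by (intro W_closed) auto
    fix j assume j: "2 \<le> j" "j \<le> n"
    have "(inverse (y (1, 2)) \<odot>\<^bsub>V\<^esub> y) (1, j) = inverse (y (1, 2)) * y (1, j)"
      by (rule lk_space_smult[OF row_S(1)[OF j]])
    then show "(inverse (y (1, 2)) \<odot>\<^bsub>V\<^esub> y) (1, j) = (if j = 2 then 1 else 0)"
      using y3[of j] y2F(2) j by (cases "j = 2") auto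
  qed
qed

lemma unit_row_exists:
  assumes "2 \<le> t" "t \<le> n"
  shows "\<exists>u\<in>W. \<forall>j. 2 \<le> j \<longrightarrow> j \<le> n \<longrightarrow> u (1, j) = (if j = t then 1 else 0)"
proof (cases "t = 2")
  case False
  obtain e where e: "e \<in> W" "\<And>j. 2 \<le> j \<Longrightarrow> j \<le> n \<Longrightarrow> e (1, j) = (if j = 2 then 1 else 0)"
    using first_unit_row_exists by blast
  obtain z where z: "z \<in> W" "\<And>j. 2 \<le> j \<Longrightarrow> j \<le> n \<Longrightarrow>
    z (1, j) = (if j = 2 then 1 else 0) - (if j = t then 1 / r ^ (t - 2) else 0)"
    using row_difference_exists[OF assms] by blast
  show ?thesis
  proof (intro bexI[of _ "r ^ (t - 2) \<odot>\<^bsub>V\<^esub> (e \<oplus>\<^bsub>V\<^esub> (- 1) \<odot>\<^bsub>V\<^esub> z)"] allI impI)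
    show "r ^ (t - 2) \<odot>\<^bsub>V\<^esub> (e \<oplus>\<^bsub>V\<^esub> (- 1) \<odot>\<^bsub>V\<^esub> z) \<in> W" using e z by (intro W_closed) auto
    fix j assume j: "2 \<le> j" "j \<le> n"
    have "(r ^ (t - 2) \<odot>\<^bsub>V\<^esub> (e \<oplus>\<^bsub>V\<^esub> (- 1) \<odot>\<^bsub>V\<^esub> z)) (1, j) = r ^ (t - 2) * (e (1, j) + - 1 * z (1, j))"
      by (simp only: lk_space_pointwise row_S(1)[OF j])
    then show "(r ^ (t - 2) \<odot>\<^bsub>V\<^esub> (e \<oplus>\<^bsub>V\<^esub> (- 1) \<odot>\<^bsub>V\<^esub> z)) (1, j) = (if j = t then 1 else 0)"
      using e(2)[OF j] z(2)[OF j] False r0 by auto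
  qed
qed (use first_unit_row_exists in auto)

definition unit_row :: "nat \<Rightarrow> nat \<times> nat \<Rightarrow> complex" where
  "unit_row t = (SOME u. u \<in> W \<and> (\<forall>j. 2 \<le> j \<longrightarrow> j \<le> n \<longrightarrow> u (1, j) = (if j = t then 1 else 0)))"

lemma unit_row:
  assumes "2 \<le> t" "t \<le> n"
  shows unit_row_W [simp]: "unit_row t \<in> W"
    and unit_row_apply: "2 \<le> j \<Longrightarrow> j \<le> n \<Longrightarrow> unit_row t (1, j) = (if j = t then 1 else 0)"
proof -
  have "\<exists>u. u \<in> W \<and> (\<forall>j. 2 \<le> j \<longrightarrow> j \<le> n \<longrightarrow> u (1, j) = (if j = t then 1 else 0))"
    using unit_row_exists[OF assms] by blast
  from someI_ex[OF this]
  have "unit_row t \<in> W \<and> (\<forall>j. 2 \<le> j \<longrightarrow> j \<le> n \<longrightarrow> unit_row t (1, j) = (if j = t then 1 else 0))"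
    unfolding unit_row_def .
  then show "unit_row t \<in> W"
    "2 \<le> j \<Longrightarrow> j \<le> n \<Longrightarrow> unit_row t (1, j) = (if j = t then 1 else 0)" by blast+
qed

text \<open>The unit rows show that the \<open>n - 1\<close> coordinates of the first row are
  independent on \<open>W\<close>; since this is the dimension of \<open>W\<close>, they also
  separate its vectors.\<close>

lemma row_eqI:
  assumes "u \<in> W" "v \<in> W" "\<And>j. 2 \<le> j \<Longrightarrow> j \<le> n \<Longrightarrow> u (1, j) = v (1, j)"
  shows "u = v"
proof -
  define A where "A = Pair (1::nat) ` {2..n}"
  have AS: "A \<subseteq> S" by (auto simp: A_def S_iff)
  have card: "card A = lk_dim n l r W"
    unfolding A_def dim by (subst card_image) (auto simp: inj_on_def)
  have "coord_dual W A"
    unfolding coord_dual_def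
    by (rule bexI[of _ "\<lambda>p. unit_row (snd p)"]) (auto simp: A_def unit_row_apply[unfolded One_nat_def])
  then have inj: "coord_inj W A" using dual_card_eq_dim_imp_inj[OF subsp AS _ card] by blast
  define d where "d = u \<oplus>\<^bsub>V\<^esub> (- 1) \<odot>\<^bsub>V\<^esub> v"
  have "d \<in> W" unfolding d_def using assms by (intro W_closed) auto
  then have "d = \<zero>\<^bsub>V\<^esub>"
  proof (rule coord_injD[OF inj])
    fix p assume "p \<in> A"
    then show "d p = 0" using assms(3) AS by (auto simp: d_def A_def lk_space_pointwise)
  qed
  then have "d q = 0" if "q \<in> S" for q using that by (simp add: lk_space_pointwise)
  then show ?thesis using assms by (intro V_ext) (auto simp: d_def lk_space_pointwise)
qed

lemma row_realize:
  assumes "\<And>j. 2 \<le> j \<Longrightarrow> j \<le> n \<Longrightarrow> c j \<in> carrier F"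
  shows "comb c unit_row {2..n} \<in> W"
    and "2 \<le> j \<Longrightarrow> j \<le> n \<Longrightarrow> comb c unit_row {2..n} (1, j) = c j"
    and "q \<in> S \<Longrightarrow> comb c unit_row {2..n} q = (\<Sum>t=2..n. c t * unit_row t q)"
proof -
  have c: "c \<in> {2..n} \<rightarrow> carrier F" using assms by simp
  have b: "unit_row \<in> {2..n} \<rightarrow> W" "unit_row \<in> {2..n} \<rightarrow> carrier V" by auto
  show "comb c unit_row {2..n} \<in> W" by (rule subspace_comb[OF subsp _ c b(1)]) simp
  show eq: "comb c unit_row {2..n} q = (\<Sum>t=2..n. c t * unit_row t q)" if "q \<in> S" for q
    using that by (intro comb_apply[OF _ c b(2)]) auto
  show "comb c unit_row {2..n} (1, j) = c j" if "2 \<le> j" "j \<le> n"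
  proof -
    have "comb c unit_row {2..n} (1, j) = (\<Sum>t=2..n. if t = j then c j else 0)"
      unfolding eq[OF row_S(1)[OF that]] using that by (intro sum.cong) (auto simp: unit_row_apply[unfolded One_nat_def])
    then show ?thesis using that by simp
  qed
qed

lemma row_expansion:
  assumes "v \<in> W" "q \<in> S"
  shows "v q = (\<Sum>t=2..n. v (1, t) * unit_row t q)"
proof -
  have c: "v (1, j) \<in> carrier F" if "2 \<le> j" "j \<le> n" for j using assms that row_S by auto
  have "v = comb (\<lambda>j. v (1, j)) unit_row {2..n}"
    by (rule row_eqI[OF assms(1) row_realize(1)[OF c] row_realize(2)[OF c, symmetric]])
  then have "v q = comb (\<lambda>j. v (1, j)) unit_row {2..n} q" by (rule fun_cong)
  also have "\<dots> = (\<Sum>t=2..n. v (1, t) * unit_row t q)"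
    by (rule row_realize(3)[OF c assms(2)])
  finally show ?thesis .
qed

lemma nu_unit_row:
  assumes "2 \<le> k" "k < n"
  shows "\<nu> k (unit_row k) = unit_row (Suc k)"
  using assms r0 by (intro row_eqI) (auto simp: nu_row_Suc unit_row_apply[unfolded One_nat_def] row_d_def)

end

section \<open>The second row and uniqueness\<close>

lemma three_strand_coefficients:
  fixes l m \<alpha> \<beta> :: complex
  assumes l0: "l \<noteq> 0"
    and 1: "\<beta> = \<alpha> / l" and 2: "\<beta> / l + m / l = \<alpha> - m * \<beta>"
    and 3: "- (m * \<alpha>) = \<alpha> * (1 / l + m * \<alpha>) + \<beta> * \<alpha>"
    and 4: "1 - m * \<beta> = \<alpha> * (m * \<beta>) + \<beta> * \<beta>"
  shows "(l\<^sup>2 = 1 \<and> \<alpha> = -1 \<and> \<beta> = - l) \<or> (l\<^sup>2 \<noteq> 1 \<and> l = m \<and> m\<^sup>2 = -1 \<and> \<alpha> = 1 \<and> \<beta> = - l)"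
proof -
  have \<alpha>l: "\<alpha> = l * \<beta>" using 1 l0 by simp
  have \<alpha>0: "\<alpha> \<noteq> 0" using 4 \<alpha>l l0 by auto
  have "\<alpha> * (1 / l + m * \<alpha> + \<beta>) = \<alpha> * (- m)" using 3 by (simp add: algebra_simps)
  then have "1 / l + m * \<alpha> + \<beta> = - m" using \<alpha>0 mult_left_cancel by blast
  then have "1 / l + m * \<alpha> + \<beta> + m = 0" by simp
  then have "m * \<alpha> + \<beta> + m + 1 / l = 0" by (simp only: ac_simps)
  then have 5: "m * \<alpha> + \<beta> + m = - (1 / l)" by (simp only: eq_neg_iff_add_eq_0)
  have "\<beta> * (m * \<alpha> + \<beta> + m) = 1" using 4 by (simp add: algebra_simps)
  then have h: "- (\<beta> / l) = 1" unfolding 5 by simp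
  have "- \<beta> = l * - (\<beta> / l)" using l0 by simp
  also have "\<dots> = l" by (simp only: h mult_1_right)
  finally have \<beta>: "\<beta> = - l" by auto
  then have \<alpha>: "\<alpha> = - (l * l)" using \<alpha>l by simp
  have "(l * l - 1) * (m * l + 1) = - (l * (m * \<alpha> + \<beta> + m)) - 1"
    unfolding \<alpha> \<beta> by (simp add: algebra_simps)
  also have "l * (m * \<alpha> + \<beta> + m) = - 1" unfolding 5 using l0 by simp
  finally have A: "(l * l - 1) * (m * l + 1) = 0" by simp
  have "m - l = l * (\<beta> / l + m / l)" unfolding \<beta> using l0 by (simp add: ring_distribs)
  also have "\<dots> = l * (\<alpha> - m * \<beta>)" unfolding 2 ..
  also have "\<dots> = m - l - (l * l - 1) * (l - m)" unfolding \<alpha> \<beta> by (simp add: algebra_simps)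
  finally have B: "(l * l - 1) * (l - m) = 0" by simp
  show ?thesis
  proof (cases "l * l = 1")
    case False
    then have "m * l + 1 = 0" and "l = m" using A B by simp_all
    then have "l = m" "m * m = - 1" by (simp_all add: eq_neg_iff_add_eq_0)
    then show ?thesis using False \<alpha> \<beta> by (simp add: power2_eq_square)
  qed (use \<alpha> \<beta> in \<open>simp add: power2_eq_square\<close>)
qed

context lk_subrep_ne4
begin

interpretation V: vectorspace F V
  by (rule lk_space_vectorspace)

lemma row_tail_nu:
  assumes "3 \<le> k" "k < n" "v \<in> W"
  shows "row_tail (\<nu> k v) = r * row_tail v"
proof -
  have "\<nu> k v (1, 2) = r * v (1, 2)"
    using nu_row[of k v 2] assms by (simp add: row_d_def)
  moreover have "row_sum (\<nu> k v) = r * row_sum v" using assms by (intro row_sum_nu) auto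
  ultimately show ?thesis by (simp add: row_sum_eq ring_distribs)
qed

lemma nu2_row:
  assumes "v \<in> W"
  shows "\<nu> 2 v (1, 2) = v (1, 3)" "\<nu> 2 v (1, 3) = v (1, 2) - m * v (1, 3)"
    and "4 \<le> j \<Longrightarrow> j \<le> n \<Longrightarrow> \<nu> 2 v (1, j) = r * v (1, j)"
    and "row_tail (\<nu> 2 v) = r * row_tail v + r ^ 3 * v (1, 2) - r ^ 2 * v (1, 3)"
proof -
  show 2: "\<nu> 2 v (1, 2) = v (1, 3)"
    using nu_coord_right(1)[of 2 v 1] assms n3 by (simp add: numeral_eq_Suc)
  show "\<nu> 2 v (1, 3) = v (1, 2) - m * v (1, 3)"
    using nu_coord_right(2)[of 2 v 1] assms n3 by (simp add: numeral_eq_Suc)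
  show "\<nu> 2 v (1, j) = r * v (1, j)" if "4 \<le> j" "j \<le> n"
    using nu_coord_disjoint[of 2 v 1 j] assms n3 that by (simp add: S_iff)
  have "row_sum (\<nu> 2 v) = r * row_sum v" using assms n3 by (intro row_sum_nu) auto
  then have "r\<^sup>2 * v (1, 3) + row_tail (\<nu> 2 v) = r * (r\<^sup>2 * v (1, 2) + row_tail v)"
    by (simp only: row_sum_eq 2)
  then show "row_tail (\<nu> 2 v) = r * row_tail v + r ^ 3 * v (1, 2) - r ^ 2 * v (1, 3)"
    by (simp only: power2_eq_square power3_eq_cube ring_distribs mult.assoc eq_diff_eq ac_simps)
qed

text \<open>The sum in \<open>nu_coord_diag\<close> runs over row 3; rewriting it as row 2 of
  \<open>\<nu> 2 v\<close> leaves only the two rows for which there are formulas.\<close>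

lemma nu2_diag:
  assumes "v \<in> W"
  shows "\<nu> 2 v (2, 3) = v (2, 3) / l + m * (\<Sum>j=4..n. r ^ (j - 4) * \<nu> 2 v (2, j)) + m / l * v (1, 3)"
proof -
  have "\<nu> 2 v (2, 3) = v (2, 3) / l + m * (\<Sum>j=4..n. r ^ (j - 4) * v (3, j)) + m / l * v (1, 3)"
    using nu_coord_diag[of 2 v] assms n3 by (simp add: numeral_eq_Suc)
  moreover have "v (3, j) = \<nu> 2 v (2, j)" if "4 \<le> j" "j \<le> n" for j
    using next_row[of 2 j v] that assms by simp
  ultimately show ?thesis by simp
qed

lemma row_tail_unit_row:
  assumes "2 \<le> t" "t \<le> n"
  shows "row_tail (unit_row t) = (if t = 2 then 0 else r ^ t)"
proof -
  have "row_tail (unit_row t) = (\<Sum>j=3..n. if j = t then r ^ t else 0)"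
    unfolding row_tail_def using assms
    by (intro sum.cong) (auto simp: unit_row_apply[unfolded One_nat_def])
  then show ?thesis using assms by auto
qed

text \<open>For \<open>k \<ge> 4\<close>, \<open>\<nu> k\<close> multiplies the coordinate
  \<open>(2, 3)\<close> by \<open>r\<close> and sends \<open>unit_row k\<close> to
  \<open>unit_row (Suc k)\<close>, so the coefficients of \<open>v (2, 3)\<close> are geometric from
  column 4 on. Applying \<open>\<nu> (3 + d)\<close> moves to the next column;
  \<open>v (1, 2)\<close> and \<open>row_tail\<close> are eigenfunctionals of it for
  \<open>r\<close>, whence the factors \<open>r ^ d\<close>.\<close>

lemma second_row_ansatz:
  assumes n5: "5 \<le> n"
  obtains \<alpha> \<beta> \<gamma> where "\<And>v d. v \<in> W \<Longrightarrow> 3 + d \<le> n \<Longrightarrow>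
    v (2, 3 + d) = \<alpha> * r ^ d * v (1, 2) + \<beta> * v (1, 3 + d) + \<gamma> * r ^ d * row_tail v"
proof -
  define c where "c t = unit_row t (2, 3)" for t
  have c_Suc: "c (Suc k) = r * c k" if "4 \<le> k" "k < n" for k
    using nu_coord_disjoint[of k "unit_row k" 2 3] nu_unit_row[of k] that
    by (simp add: c_def S_iff)
  define \<gamma> where "\<gamma> = c 4 / r ^ 4"
  \<comment> \<open>The geometric tail is extended back to column 3 so that it becomes a multiple of
    \<open>row_tail\<close>; \<open>\<beta>\<close> is the discrepancy in that column.\<close>
  define \<beta> where "\<beta> = c 3 - \<gamma> * r ^ 3"
  have c4: "c t = \<gamma> * r ^ t" if "4 \<le> t" "t \<le> n" for t
    using that by (induction t rule: dec_induct) (simp_all add: c_Suc \<gamma>_def r0)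
  have c3: "c t = \<gamma> * r ^ t + (if t = 3 then \<beta> else 0)" if "3 \<le> t" "t \<le> n" for t
    using c4[of t] that by (cases "t = 3") (auto simp: \<beta>_def)
  have base: "v (2, 3) = c 2 * v (1, 2) + \<beta> * v (1, 3) + \<gamma> * row_tail v" if v: "v \<in> W" for v
  proof -
    have "v (2, 3) = (\<Sum>t=2..n. v (1, t) * c t)"
      unfolding c_def using n3 by (intro row_expansion[OF v]) (simp add: S_iff)
    also have "\<dots> = v (1, 2) * c 2 + (\<Sum>t=3..n. v (1, t) * c t)"
      using n3 by (subst sum.atLeast_Suc_atMost) (auto simp: numeral_eq_Suc)
    also have "(\<Sum>t=3..n. v (1, t) * c t) = (\<Sum>t=3..n. \<gamma> * (r ^ t * v (1, t)) + (if t = 3 then \<beta> * v (1, 3) else 0))"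
      by (intro sum.cong) (auto simp: c3 ring_distribs)
    also have "\<dots> = \<gamma> * row_tail v + \<beta> * v (1, 3)"
      using n3 by (simp add: sum.distrib row_tail_def sum_distrib_left)
    finally show ?thesis by simp
  qed
  have "v (2, 3 + d) = c 2 * r ^ d * v (1, 2) + \<beta> * v (1, 3 + d) + \<gamma> * r ^ d * row_tail v"
    if "v \<in> W" "3 + d \<le> n" for v d
    using that
  proof (induction d arbitrary: v)
    case 0
    then show ?case using base by simp
  next
    case (Suc d)
    define u where "u = \<nu> (3 + d) v"
    have u: "u \<in> W" "u (1, 2) = r * v (1, 2)" "u (1, 3 + d) = v (1, Suc (3 + d))"
      "row_tail u = r * row_tail v" "v (2, Suc (3 + d)) = u (2, 3 + d)"
      using Suc.prems nu_row[of "3 + d" v 2] nu_row[of "3 + d" v "3 + d"] row_tail_nu[of "3 + d" v] next_column[of 2 "3 + d" v]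
      by (auto simp: u_def row_d_def)
    have "v (2, Suc (3 + d)) = c 2 * r ^ d * u (1, 2) + \<beta> * u (1, 3 + d) + \<gamma> * r ^ d * row_tail u"
      unfolding u(5) using Suc.IH[OF u(1)] Suc.prems by simp
    then show ?case unfolding u(2-4) by (simp add: mult_ac)
  qed
  then show thesis using that by blast
qed

text \<open>
  The functional \<open>v (1, 5) - r * v (1, 4)\<close> is an eigenfunctional of \<open>\<nu> 1\<close> and \<open>\<nu> 2\<close> with eigenvalues
  \<open>\<beta>\<close> and \<open>r\<close>, and the braid relation identifies the two. It needs the columns 4 and 5, so it is not
  available for \<open>n = 4\<close>.
\<close>

lemma second_row_coeff:
  assumes n5: "5 \<le> n" and row2: "\<And>v d. v \<in> W \<Longrightarrow> 3 + d \<le> n \<Longrightarrow>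
    v (2, 3 + d) = \<alpha> * r ^ d * v (1, 2) + \<beta> * v (1, 3 + d) + \<gamma> * r ^ d * row_tail v"
  shows "\<beta> = r"
proof -
  define y where "y v = v (1, 5) - r * v (1, 4)" for v :: "nat \<times> nat \<Rightarrow> complex"
  define z where "z v = v (2, 5) - r * v (2, 4)" for v :: "nat \<times> nat \<Rightarrow> complex"
  have z: "z v = \<beta> * y v" if "v \<in> W" for v
    using row2[OF that, of 2] row2[OF that, of 1] n5
    by (simp add: z_def y_def power2_eq_square algebra_simps)
  have y1: "y (\<nu> 1 v) = \<beta> * y v" if "v \<in> W" for v
    using z[OF that] next_row[of 1 _ v] n5 that by (simp add: z_def y_def numeral_eq_Suc)
  have y2: "y (\<nu> 2 v) = r * y v" if "v \<in> W" for v
    using nu2_row(3)[OF that, of 4] nu2_row(3)[OF that, of 5] n5 by (simp add: y_def algebra_simps)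
  define v where "v = unit_row 5"
  have v: "v \<in> W" "y v = 1"
    using n5 by (auto simp: v_def y_def unit_row_apply[unfolded One_nat_def])
  have "\<nu> 1 v (2, j) = v (1, j) - m * v (2, j)" if "3 \<le> j" "j \<le> n" for j
    using nu_coord_left(2)[of 1 v j] that n5 v(1) by (simp add: numeral_eq_Suc)
  then have "\<nu> 1 v (2, 4) = v (1, 4) - m * v (2, 4)" "\<nu> 1 v (2, 5) = v (1, 5) - m * v (2, 5)"
    using n5 by simp_all
  then have "z (\<nu> 1 v) = y v - m * z v"
    by (simp add: z_def y_def ring_distribs mult.left_commute)
  \<comment> \<open>This quadratic relation rules out \<open>\<beta> = 0\<close>, so that
    \<open>\<beta>\<close> can be cancelled in the braid identity.\<close>
  then have \<beta>: "\<beta> * \<beta> = 1 - m * \<beta>"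
    using z[of "\<nu> 1 v"] z[of v] y1[of v] v n5 by simp
  have e: "y (\<nu> 1 (\<nu> 2 (\<nu> 1 v))) = \<beta> * (r * \<beta>)" "y (\<nu> 2 (\<nu> 1 (\<nu> 2 v))) = r * (\<beta> * r)"
    using v n5 by (simp_all add: y1[unfolded One_nat_def] y2)
  have "\<nu> 1 (\<nu> 2 (\<nu> 1 v)) = \<nu> 2 (\<nu> 1 (\<nu> 2 v))"
    using nu_braid[of 1 v] n5 v by (simp add: numeral_eq_Suc)
  with e have "\<beta> * (r * \<beta>) = r * (\<beta> * r)" by metis
  moreover have "\<beta> \<noteq> 0" using \<beta> by auto
  ultimately show ?thesis using r0 by auto
qed

text \<open>
  The equations \<open>E1\<close>, \<open>E2\<close>, \<open>E3\<close> compare two expressions for \<open>\<nu> 2 v (2, 3)\<close>: the action in coordinates,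
  and the formula for the second row applied to \<open>\<nu> 2 v\<close>.
\<close>

lemma second_row:
  assumes n5: "5 \<le> n"
  defines "R \<equiv> r ^ (2 * (n - 3))"
  defines "\<gamma> \<equiv> m * r\<^sup>2 / (R * r ^ 5 - r ^ 4 / l)"
  shows "R * l\<^sup>2 = 1"
    and "\<And>v j. v \<in> W \<Longrightarrow> 3 \<le> j \<Longrightarrow> j \<le> n \<Longrightarrow>
      v (2, j) = (l + \<gamma> * r ^ 3) / r * r ^ (j - 3) * v (1, 2) + r * v (1, j) + \<gamma> * r ^ (j - 3) * row_tail v"
proof -
  obtain \<alpha> \<beta> g where row2: "\<And>v d. v \<in> W \<Longrightarrow> 3 + d \<le> n \<Longrightarrow>
    v (2, 3 + d) = \<alpha> * r ^ d * v (1, 2) + \<beta> * v (1, 3 + d) + g * r ^ d * row_tail v"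
    by (rule second_row_ansatz[OF n5]) blast
  have "\<beta> = r" by (rule second_row_coeff[OF n5 row2])
  then have row: "v (2, j) = \<alpha> * r ^ (j - 3) * v (1, 2) + r * v (1, j) + g * r ^ (j - 3) * row_tail v"
    if "v \<in> W" "3 \<le> j" "j \<le> n" for v j
    using row2[of v "j - 3"] that by simp
  \<comment> \<open>The test vectors have no first-row entries beyond column 4. The sum in
    \<open>nu2_diag\<close> is then a geometric series, evaluated by \<open>geometric_sum4\<close>,
    plus one term from column 4.\<close>
  have Q: "m * (\<Sum>j=4..n. r ^ (j - 4) * u (2, j)) = (\<alpha> * u (1, 2) + g * row_tail u) * (1 - R) + m * r * c"
    if u: "u \<in> W" "\<And>j. 4 \<le> j \<Longrightarrow> j \<le> n \<Longrightarrow> u (1, j) = (if j = 4 then c else 0)" for u c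
  proof -
    have "(\<Sum>j=4..n. r ^ (j - 4) * u (2, j)) =
        (\<Sum>j=4..n. (\<alpha> * u (1, 2) + g * row_tail u) * (r ^ (j - 4) * r ^ (j - 3)) + (if j = 4 then r * c else 0))"
    proof (rule sum.cong[OF HOL.refl])
      fix j assume j: "j \<in> {4..n}"
      then have "u (2, j) = \<alpha> * r ^ (j - 3) * u (1, 2) + r * u (1, j) + g * r ^ (j - 3) * row_tail u"
        using row[OF u(1), of j] by simp
      then show "r ^ (j - 4) * u (2, j) = (\<alpha> * u (1, 2) + g * row_tail u) * (r ^ (j - 4) * r ^ (j - 3)) + (if j = 4 then r * c else 0)"
        using u(2)[of j] j by (cases "j = 4") (auto simp: algebra_simps)
    qed
    also have "\<dots> = (\<alpha> * u (1, 2) + g * row_tail u) * (\<Sum>j=4..n. r ^ (j - 4) * r ^ (j - 3)) + r * c"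
      using n5 by (simp add: sum.distrib sum_distrib_left)
    finally have "m * (\<Sum>j=4..n. r ^ (j - 4) * u (2, j)) =
        (\<alpha> * u (1, 2) + g * row_tail u) * (m * (\<Sum>j=4..n. r ^ (j - 4) * r ^ (j - 3))) + m * r * c"
      by (simp only: ring_distribs mult_ac)
    then show ?thesis by (simp only: geometric_sum4 R_def)
  qed
  have eq: "\<alpha> * u (1, 2) + r * u (1, 3) + g * row_tail u =
      (\<alpha> * v (1, 2) + r * v (1, 3) + g * row_tail v) / l
      + ((\<alpha> * u (1, 2) + g * row_tail u) * (1 - R) + m * r * c) + m / l * v (1, 3)"
    if v: "v \<in> W" "u = \<nu> 2 v" "\<And>j. 4 \<le> j \<Longrightarrow> j \<le> n \<Longrightarrow> v (1, j) = (if j = 4 then c / r else 0)" for u v c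
  proof -
    have u: "u \<in> W" using v n3 by simp
    have "u (1, j) = (if j = 4 then c else 0)" if "4 \<le> j" "j \<le> n" for j
      using nu2_row(3)[OF v(1) that] v(2,3) that r0 by simp
    note Q = Q[OF u this]
    show ?thesis
      using nu2_diag[OF v(1)] Q row[OF u, of 3] row[OF v(1), of 3] n3 v(2) by simp
  qed
  \<comment> \<open>The test vectors are the unit rows 2, 3 and 4. The last argument of
    \<open>eq\<close> is the column 4 entry of the image under \<open>\<nu> 2\<close>: 0, 0 and
    \<open>r\<close>.\<close>
  have E1: "r + g * r ^ 3 = \<alpha> / l + g * r ^ 3 * (1 - R)"
    using eq[of "unit_row 2" "unit_row 3" 0] nu_unit_row[of 2] n5
    by (simp add: unit_row_apply[unfolded One_nat_def] row_tail_unit_row)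
  have E2: "\<alpha> - r * m + g * (r ^ 4 - r\<^sup>2) = (r + g * r ^ 3) / l + (\<alpha> + g * (r ^ 4 - r\<^sup>2)) * (1 - R) + m / l"
    using eq[of "unit_row 3" "\<nu> 2 (unit_row 3)" 0] nu2_row[of "unit_row 3"] n5
    by (simp add: unit_row_apply[unfolded One_nat_def] row_tail_unit_row power_eq_if mult.assoc)
  have E3: "g * r ^ 5 = g * r ^ 4 / l + g * r ^ 5 * (1 - R) + m * r\<^sup>2"
    using eq[of "unit_row 4" "\<nu> 2 (unit_row 4)" r] nu2_row[of "unit_row 4"] n5 r0
    by (simp add: unit_row_apply[unfolded One_nat_def] row_tail_unit_row power_eq_if mult.assoc)
  define L where "L = 1 / l"
  have L: "l * L = 1" using l0 by (simp add: L_def)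
  have rm: "r * m = 1 - r\<^sup>2" using r_m(1) .
  have E1: "r + g * r ^ 3 * R = \<alpha> * L" using E1 by (simp add: L_def algebra_simps)
  have E2: "R * (\<alpha> + g * (r ^ 4 - r\<^sup>2)) = r * m + (r + g * r ^ 3) * L + m * L"
    using E2 by (simp add: L_def algebra_simps add_divide_distrib)
  have E3: "g * r ^ 5 * R = g * r ^ 4 * L + m * r\<^sup>2" using E3 by (simp add: L_def algebra_simps)
  \<comment> \<open>\<open>E3\<close> divided by \<open>r\<^sup>2\<close> and inserted into
    \<open>E1\<close> yields \<open>r * \<alpha> = l + g * r ^ 3\<close>; with this,
    \<open>E2\<close> reduces modulo \<open>E3\<close> to \<open>R * l = 1 / l\<close>.\<close>
  have "r\<^sup>2 * (g * r ^ 3 * R) = r\<^sup>2 * (g * r\<^sup>2 * L + m)"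
    using E3 by (simp add: algebra_simps power_eq_if)
  then have E3': "g * r ^ 3 * R = g * r\<^sup>2 * L + m" using r0 by simp
  have "r * (\<alpha> * L) = r\<^sup>2 + r * m + g * r ^ 3 * L"
    unfolding E1[symmetric] E3' by (simp add: algebra_simps power_eq_if)
  then have "r * (\<alpha> * L) = 1 + g * r ^ 3 * L" using rm by simp
  then have "l * (r * (\<alpha> * L)) = l * (1 + g * r ^ 3 * L)" by (rule arg_cong)
  then have "l * L * (r * \<alpha>) = l * (1 + g * r ^ 3 * L)" by (simp only: mult_ac)
  also have "\<dots> = l + l * L * (g * r ^ 3)" by (simp add: algebra_simps)
  finally have \<alpha>: "r * \<alpha> = l + g * r ^ 3" using L by simp
  have "R * (r * \<alpha> + g * (r ^ 5 - r ^ 3)) = r * (R * (\<alpha> + g * (r ^ 4 - r\<^sup>2)))"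
    by (simp add: algebra_simps power_eq_if)
  also have "\<dots> = m * r\<^sup>2 + (r\<^sup>2 + r * m) * L + g * r ^ 4 * L"
    unfolding E2 by (simp add: algebra_simps power_eq_if)
  finally have "R * l + g * r ^ 5 * R = m * r\<^sup>2 + L + g * r ^ 4 * L"
    unfolding \<alpha> using rm by (simp add: algebra_simps)
  then have "R * l = L" using E3 by simp
  then have "R * l * l = l * L" by (simp only: mult_ac)
  then show "R * l\<^sup>2 = 1" using L by (simp only: power2_eq_square mult.assoc)
  have D: "g * (R * r ^ 5 - r ^ 4 / l) = m * r\<^sup>2"
    using E3 by (simp add: L_def algebra_simps)
  \<comment> \<open>As \<open>m * r\<^sup>2\<close> is nonzero, \<open>D\<close> both determines
    \<open>g\<close> and shows that the denominator of \<open>\<gamma>\<close> does not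
    vanish.\<close>
  then have "R * r ^ 5 - r ^ 4 / l \<noteq> 0" using m0 r0 by auto
  then have g: "g = \<gamma>" unfolding \<gamma>_def using D by (simp add: field_simps)
  have "\<alpha> = (l + \<gamma> * r ^ 3) / r" using \<alpha> r0 g by (simp add: field_simps)
  then show "v (2, j) = (l + \<gamma> * r ^ 3) / r * r ^ (j - 3) * v (1, 2) + r * v (1, j) + \<gamma> * r ^ (j - 3) * row_tail v"
    if "v \<in> W" "3 \<le> j" "j \<le> n" for v j
    using row[OF that] g by simp
qed

section \<open>The second row for three strands\<close>

context
  assumes n_eq3: "n = 3"
begin

lemma nu1_three:
  assumes "v \<in> W"
  shows "\<nu> 1 v (1, 2) = v (1, 2) / l + m * v (2, 3)" "\<nu> 1 v (1, 3) = v (2, 3)"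
    and "\<nu> 1 v (2, 3) = v (1, 3) - m * v (2, 3)"
proof -
  have v: "v \<in> carrier V" using assms by simp
  show "\<nu> 1 v (1, 2) = v (1, 2) / l + m * v (2, 3)" "\<nu> 1 v (1, 3) = v (2, 3)"
    "\<nu> 1 v (2, 3) = v (1, 3) - m * v (2, 3)"
    using nu_coord_diag[of 1 v, OF _ _ v] nu_coord_left[of 1 v 3, OF _ _ v] n_eq3
    by (simp_all add: numeral_eq_Suc)
qed

lemma nu2_three:
  assumes "v \<in> W"
  shows "\<nu> 2 v (2, 3) = v (2, 3) / l + m / l * v (1, 3)"
  using nu2_diag[OF assms] n_eq3 by simp

text \<open>The four equations express that the linear relation for \<open>v (2, 3)\<close> persists
  on the images of the two unit rows under the two generators.\<close>

lemma second_row_three: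
  obtains \<alpha> \<beta> where "\<And>v. v \<in> W \<Longrightarrow> v (2, 3) = \<alpha> * v (1, 2) + \<beta> * v (1, 3)"
    and "(l\<^sup>2 = 1 \<and> \<alpha> = -1 \<and> \<beta> = - l) \<or> (l\<^sup>2 \<noteq> 1 \<and> l = m \<and> m\<^sup>2 = -1 \<and> \<alpha> = 1 \<and> \<beta> = - l)"
proof -
  define \<alpha> where "\<alpha> = unit_row 2 (2, 3)"
  define \<beta> where "\<beta> = unit_row 3 (2, 3)"
  have row: "v (2, 3) = \<alpha> * v (1, 2) + \<beta> * v (1, 3)" if "v \<in> W" for v
  proof -
    have "v (2, 3) = (\<Sum>t=2..n. v (1, t) * unit_row t (2, 3))"
      by (rule row_expansion[OF that]) (simp add: lk_index_def n_eq3)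
    also have "{2..n} = {2, 3}" using n_eq3 by auto
    finally show ?thesis by (simp add: \<alpha>_def \<beta>_def)
  qed
  define u where "u = unit_row 2"
  define v where "v = unit_row 3"
  have uv: "u \<in> W" "u (1, 2) = 1" "u (1, 3) = 0" "u (2, 3) = \<alpha>"
    "v \<in> W" "v (1, 2) = 0" "v (1, 3) = 1" "v (2, 3) = \<beta>"
    using n3 by (simp_all add: u_def v_def \<alpha>_def \<beta>_def unit_row_apply[unfolded One_nat_def])
  have W: "\<nu> 1 u \<in> W" "\<nu> 1 v \<in> W" "\<nu> 2 u \<in> W" "\<nu> 2 v \<in> W" using uv n3 by auto
  have 1: "\<beta> = \<alpha> / l"
    using row[OF W(3)] unfolding nu2_three[OF uv(1)] nu2_row(1,2)[OF uv(1)] uv by simp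
  have 2: "\<beta> / l + m / l = \<alpha> - m * \<beta>"
    using row[OF W(4)] unfolding nu2_three[OF uv(5)] nu2_row(1,2)[OF uv(5)] uv by (simp add: algebra_simps)
  have 3: "- (m * \<alpha>) = \<alpha> * (1 / l + m * \<alpha>) + \<beta> * \<alpha>"
    using row[OF W(1)] unfolding nu1_three[OF uv(1)] uv by simp
  have 4: "1 - m * \<beta> = \<alpha> * (m * \<beta>) + \<beta> * \<beta>"
    using row[OF W(2)] unfolding nu1_three[OF uv(5)] uv by simp
  show thesis
    by (rule that[OF row three_strand_coefficients[OF l0 1 2 3 4]])
qed

text \<open>
  The exceptional solution \<open>l = m\<close>, \<open>m\<^sup>2 = -1\<close> is a genuine invariant plane, but it contains the line
  spanned by \<open>w\<^sub>1\<^sub>2 - w\<^sub>1\<^sub>3 / r + w\<^sub>2\<^sub>3 / r\<^sup>2\<close>, on which both generators act by \<open>-1 / r\<close>.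
\<close>

lemma not_irreducible_three:
  assumes "l\<^sup>2 \<noteq> 1"
  shows "\<not> lk_irreducible n l r W"
proof
  assume irr: "lk_irreducible n l r W"
  obtain \<alpha> \<beta> where row: "\<And>v. v \<in> W \<Longrightarrow> v (2, 3) = \<alpha> * v (1, 2) + \<beta> * v (1, 3)"
    and "(l\<^sup>2 = 1 \<and> \<alpha> = -1 \<and> \<beta> = - l) \<or> (l\<^sup>2 \<noteq> 1 \<and> l = m \<and> m\<^sup>2 = -1 \<and> \<alpha> = 1 \<and> \<beta> = - l)"
    by (rule second_row_three) blast
  then have lm: "l = m" "m * m = - 1" "\<alpha> = 1" "\<beta> = - l" using assms by (auto simp: power2_eq_square)
  have 1: "1 / l = - m" using lm l0 by (simp add: field_simps)
  define s where "s = unit_row 2 \<oplus>\<^bsub>V\<^esub> (- 1 / r) \<odot>\<^bsub>V\<^esub> unit_row 3"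
  have sW: "s \<in> W" unfolding s_def using n3 by (intro W_closed) auto
  have S: "(1, 2) \<in> S" "(1, 3) \<in> S" "(2, 3) \<in> S" by (simp_all add: lk_index_def n_eq3)
  have s: "s (1, 2) = 1" "s (1, 3) = - 1 / r"
    unfolding s_def lk_space_pointwise[OF S(1)] lk_space_pointwise[OF S(2)]
    using n3 by (simp_all add: unit_row_apply[unfolded One_nat_def])
  have rm: "m / r = 1 / r\<^sup>2 - 1" using r0 by (simp add: bmw_m_def field_simps power2_eq_square)
  have s23: "s (2, 3) = 1 / r\<^sup>2"
    using row[OF sW] s lm rm by simp
  have sV: "s \<in> carrier V" using sW by simp
  have nu1: "\<nu> 1 s = (- 1 / r) \<odot>\<^bsub>V\<^esub> s"
  proof (rule row_eqI)
    fix j assume "2 \<le> j" "j \<le> n"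
    then consider "j = 2" | "j = 3" using n_eq3 by linarith
    then show "\<nu> 1 s (1, j) = ((- 1 / r) \<odot>\<^bsub>V\<^esub> s) (1, j)"
    proof cases
      case 1
      have "\<nu> 1 s (1, 2) = m * (1 / r\<^sup>2 - 1)"
        using nu1_three(1)[OF sW] s s23 \<open>1 / l = - m\<close> by (simp add: algebra_simps)
      also have "\<dots> = m * m / r" using rm by (metis times_divide_eq_right)
      finally show ?thesis using 1 lk_space_smult[OF S(1)] s lm by simp
    next
      case 2
      then show ?thesis using nu1_three(2)[OF sW] lk_space_smult[OF S(2)] s s23
        by (simp add: power2_eq_square)
    qed
  qed (use sW n3 in \<open>auto intro!: W_closed\<close>)
  have nu2: "\<nu> 2 s = (- 1 / r) \<odot>\<^bsub>V\<^esub> s"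
  proof (rule row_eqI)
    fix j assume "2 \<le> j" "j \<le> n"
    then consider "j = 2" | "j = 3" using n_eq3 by linarith
    then show "\<nu> 2 s (1, j) = ((- 1 / r) \<odot>\<^bsub>V\<^esub> s) (1, j)"
    proof cases
      case 1
      then show ?thesis using nu2_row(1)[OF sW] lk_space_smult[OF S(1)] s by simp
    next
      case 2
      have "\<nu> 2 s (1, 3) = 1 + m / r" using nu2_row(2)[OF sW] s by simp
      then show ?thesis using 2 lk_space_smult[OF S(2)] s rm by (simp add: power2_eq_square)
    qed
  qed (use sW n3 in \<open>auto intro!: W_closed\<close>)
  define U where "U = {c \<odot>\<^bsub>V\<^esub> s |c. c \<in> carrier F}"
  have U: "c \<odot>\<^bsub>V\<^esub> s \<in> U" if "c \<in> carrier F" for c using that by (auto simp: U_def)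
  have "subspace F U V"
  proof (rule subspaceI)
    show "U \<subseteq> carrier V" using sV by (auto simp: U_def)
    show "\<zero>\<^bsub>V\<^esub> \<in> U" using U[of 0] sV by simp
    show "x \<oplus>\<^bsub>V\<^esub> y \<in> U" if xy: "x \<in> U" "y \<in> U" for x y
    proof -
      obtain a b where ab: "a \<in> carrier F" "b \<in> carrier F" "x = a \<odot>\<^bsub>V\<^esub> s" "y = b \<odot>\<^bsub>V\<^esub> s"
        using xy by (auto simp: U_def)
      have "x \<oplus>\<^bsub>V\<^esub> y = (a + b) \<odot>\<^bsub>V\<^esub> s"
        using ab sV by (intro V_ext) (auto simp: lk_space_pointwise algebra_simps)
      then show ?thesis using U[of "a + b"] ab by simp
    qed
    show "c \<odot>\<^bsub>V\<^esub> x \<in> U" if c: "c \<in> carrier F" "x \<in> U" for c x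
    proof -
      obtain a where a: "a \<in> carrier F" "x = a \<odot>\<^bsub>V\<^esub> s" using c by (auto simp: U_def)
      have "c \<odot>\<^bsub>V\<^esub> x = (c * a) \<odot>\<^bsub>V\<^esub> s"
        using a c sV by (intro V_ext) (auto simp: lk_space_pointwise)
      then show ?thesis using U[of "c * a"] a c by simp
    qed
  qed
  then have "lk_invariant n l r U"
  proof (rule lk_invariantI)
    fix k v assume k: "1 \<le> k" "k < n" and v: "v \<in> U"
    obtain a where a: "a \<in> carrier F" "v = a \<odot>\<^bsub>V\<^esub> s" using v by (auto simp: U_def)
    have "k = 1 \<or> k = 2" using k n_eq3 by linarith
    then have "\<nu> k s = (- 1 / r) \<odot>\<^bsub>V\<^esub> s" using nu1 nu2 by auto
    then have "\<nu> k v = (a * (- 1 / r)) \<odot>\<^bsub>V\<^esub> s"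
      using a sV by (intro V_ext) (auto simp: lk_space_pointwise)
    then show "\<nu> k v \<in> U" using U[of "a * (- 1 / r)"] a by simp
  qed
  moreover have "U \<subseteq> W" using sW by (auto simp: U_def)
  ultimately have "U = {\<zero>\<^bsub>V\<^esub>} \<or> U = W" using irr by (simp add: lk_irreducible_def)
  moreover have "U \<noteq> {\<zero>\<^bsub>V\<^esub>}"
  proof
    assume "U = {\<zero>\<^bsub>V\<^esub>}"
    then have "s = \<zero>\<^bsub>V\<^esub>" using U[of 1] sV by simp
    then show False using s(1) lk_space_zero[OF S(1), of l r] by simp
  qed
  moreover have "U \<noteq> W"
  proof
    assume "U = W"
    then have "unit_row 3 \<in> U" using n3 by simp
    then obtain a where a: "unit_row 3 = a \<odot>\<^bsub>V\<^esub> s" by (auto simp: U_def)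
    have "unit_row 3 (1, 2) = a * s (1, 2)" "unit_row 3 (1, 3) = a * s (1, 3)"
      unfolding a using S lk_space_smult by auto
    then show False using s n3 by (simp add: unit_row_apply[unfolded One_nat_def])
  qed
  ultimately show False by blast
qed

end

end

section \<open>Uniqueness and the necessary condition on \<open>l\<close>\<close>

context lk_semisimple
begin

text \<open>For \<open>i \<ge> 2\<close> the first row of \<open>\<nu> i v\<close> depends only on
  that of \<open>v\<close>, so vectors of \<open>W\<close> and \<open>W'\<close> with equal first
  rows keep this property. Agreement then passes from row 2 to all later rows by
  \<open>next_row\<close>.\<close>

lemma subrep_subset:
  assumes "lk_subrep_ne4 n l r W" "lk_subrep_ne4 n l r W'"
    and row2: "\<And>v v' j. v \<in> W \<Longrightarrow> v' \<in> W' \<Longrightarrow> (\<And>i. 2 \<le> i \<Longrightarrow> i \<le> n \<Longrightarrow> v (1, i) = v' (1, i)) \<Longrightarrow>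
      3 \<le> j \<Longrightarrow> j \<le> n \<Longrightarrow> v (2, j) = v' (2, j)"
  shows "W \<subseteq> W'"
proof
  interpret W: lk_subrep_ne4 n l r W by fact
  interpret W': lk_subrep_ne4 n l r W' by fact
  fix v assume v: "v \<in> W"
  have c: "v (1, j) \<in> carrier F" if "2 \<le> j" "j \<le> n" for j using v that row_S by auto
  define v' where "v' = comb (\<lambda>j. v (1, j)) W'.unit_row {2..n}"
  have v': "v' \<in> W'" "\<And>j. 2 \<le> j \<Longrightarrow> j \<le> n \<Longrightarrow> v' (1, j) = v (1, j)"
    unfolding v'_def using W'.row_realize(1,2)[OF c] by auto
  \<comment> \<open>Stated for all pairs with equal first rows, because the induction step applies
    it to \<open>\<nu> i x\<close> and \<open>\<nu> i x'\<close>.\<close>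
  have later: "x (i, j) = x' (i, j)"
    if "2 \<le> i" "x \<in> W" "x' \<in> W'" "\<And>t. 2 \<le> t \<Longrightarrow> t \<le> n \<Longrightarrow> x (1, t) = x' (1, t)" "i < j" "j \<le> n" for i j x x'
    using that
  proof (induction i arbitrary: x x' j rule: dec_induct)
    case base
    then show ?case using row2[of x x' j] by simp
  next
    case (step i)
    have "\<nu> i x (1, t) = \<nu> i x' (1, t)" if "2 \<le> t" "t \<le> n" for t
      using nu_row[of i x t] nu_row[of i x' t] that step by simp
    then have "\<nu> i x (i, j) = \<nu> i x' (i, j)"
      using step.IH[of "\<nu> i x" "\<nu> i x'" j] step.prems step.hyps by simp
    then show ?case
      using W.next_row[of i j x] W'.next_row[of i j x'] step.prems step.hyps by simp
  qed
  have "v = v'"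
  proof (rule V_ext)
    fix q assume q: "q \<in> S"
    obtain i j where ij: "q = (i, j)" by (cases q)
    then have "i < j" "j \<le> n" "i = 1 \<or> 2 \<le> i" using q by (auto simp: S_iff)
    then show "v q = v' q" using v'(2)[of j] later[of i v v' j] v v' ij by auto
  qed (use v v' in auto)
  then show "v \<in> W'" using v'(1) by simp
qed

text \<open>The constants in the second row depend only on \<open>n\<close>, \<open>l\<close> and
  \<open>r\<close>, so both subspaces share them. Exchanging \<open>W\<close> and \<open>W'\<close>
  gives equality.\<close>

lemma subrep_subset_of:
  assumes "n \<noteq> 4" and W: "lk_irreducible n l r W" "lk_dim n l r W = n - 1"
    and W': "lk_irreducible n l r W'" "lk_dim n l r W' = n - 1"
  shows "W \<subseteq> W'"
proof -
  interpret W: lk_subrep_ne4 n l r W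
    using assms by unfold_locales (auto simp: lk_irreducible_def)
  interpret W': lk_subrep_ne4 n l r W'
    using assms by unfold_locales (auto simp: lk_irreducible_def)
  show ?thesis
  proof (rule subrep_subset[OF W.lk_subrep_ne4_axioms W'.lk_subrep_ne4_axioms])
    fix v v' j
    assume v: "v \<in> W" "v' \<in> W'" "\<And>i. 2 \<le> i \<Longrightarrow> i \<le> n \<Longrightarrow> v (1, i) = v' (1, i)" and j: "3 \<le> j" "j \<le> n"
    show "v (2, j) = v' (2, j)"
    proof (cases "n = 3")
      case True
      have l2: "l\<^sup>2 = 1" using W.not_irreducible_three[OF True] W(1) by blast
      obtain \<alpha> \<beta> where a: "v (2, 3) = \<alpha> * v (1, 2) + \<beta> * v (1, 3)" "\<alpha> = -1" "\<beta> = - l"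
        using W.second_row_three[OF True] v(1) l2 by metis
      obtain \<alpha>' \<beta>' where b: "v' (2, 3) = \<alpha>' * v' (1, 2) + \<beta>' * v' (1, 3)" "\<alpha>' = -1" "\<beta>' = - l"
        using W'.second_row_three[OF True] v(2) l2 by metis
      show ?thesis using a b v(3)[of 2] v(3)[of 3] True j by simp
    next
      case False
      then have n5: "5 \<le> n" using n3 assms(1) by simp
      have "row_tail v = row_tail v'" unfolding row_tail_def using v(3) by (intro sum.cong) auto
      then show ?thesis
        using W.second_row(2)[OF n5 v(1) j] W'.second_row(2)[OF n5 v(2) j] v(3)[of 2] v(3)[of j] j n3 by simp
    qed
  qed
qed

lemma irreducible_imp_l:
  assumes "n \<noteq> 4" and W: "lk_irreducible n l r W" "lk_dim n l r W = n - 1"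
  shows "l \<in> {1 / r ^ (n - 3), - (1 / r ^ (n - 3))}"
proof -
  interpret W: lk_subrep_ne4 n l r W
    using assms by unfold_locales (auto simp: lk_irreducible_def)
  have "r ^ (2 * (n - 3)) * l\<^sup>2 = 1"
  proof (cases "n = 3")
    case True
    then show ?thesis using W.not_irreducible_three[OF True] W(1) by auto
  next
    case False
    then have n5: "5 \<le> n" using n3 assms(1) by simp
    show ?thesis by (rule W.second_row(1)[OF n5])
  qed
  then have "(r ^ (n - 3) * l)\<^sup>2 = 1" by (simp add: power_mult_distrib power_even_eq)
  then have "r ^ (n - 3) * l = 1 \<or> r ^ (n - 3) * l = - 1" by (simp add: power2_eq_1_iff)
  then show ?thesis using r0 by (auto simp: field_simps)
qed

end

section \<open>The reflection basis\<close>

context lk_params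
begin

text \<open>Where an entry next to row or column \<open>t\<close> involves an index gap, the gap is
  given as \<open>d\<close>, so that powers of \<open>r\<close> reduce without truncated
  subtraction.\<close>

lemma nu_eqI:
  assumes t: "1 \<le> t" "t < n" and v: "v \<in> carrier V" and u: "u \<in> carrier V"
    and "\<And>i j. (i, j) \<in> S \<Longrightarrow> i \<noteq> t \<Longrightarrow> i \<noteq> Suc t \<Longrightarrow> j \<noteq> t \<Longrightarrow> j \<noteq> Suc t \<Longrightarrow> r * v (i, j) = u (i, j)"
    and "\<And>d. t + 2 + d \<le> n \<Longrightarrow> v (Suc t, t + 2 + d) = u (t, t + 2 + d)"
    and "\<And>d. t + 2 + d \<le> n \<Longrightarrow> v (t, t + 2 + d) - m * v (Suc t, t + 2 + d) = u (Suc t, t + 2 + d)"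
    and "\<And>i d. 1 \<le> i \<Longrightarrow> t = Suc (i + d) \<Longrightarrow> v (i, Suc t) = u (i, t)"
    and "\<And>i d. 1 \<le> i \<Longrightarrow> t = Suc (i + d) \<Longrightarrow> v (i, t) - m * v (i, Suc t) = u (i, Suc t)"
    and "v (t, Suc t) / l + m * (\<Sum>j=t+2..n. r ^ (j - t - 2) * v (Suc t, j))
       + m / l * (\<Sum>i=1..<t. v (i, Suc t) / r ^ (t - 1 - i)) = u (t, Suc t)"
  shows "\<nu> t v = u"
proof (rule V_ext)
  fix q assume q: "q \<in> S"
  obtain i j where ij: "q = (i, j)" by (cases q)
  have S: "1 \<le> i" "i < j" "j \<le> n" "(i, j) \<in> S" using q ij by (simp_all add: S_iff)
  consider (1) "i \<noteq> t" "i \<noteq> Suc t" "j \<noteq> t" "j \<noteq> Suc t" | (2) "i = t" "j = Suc t"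
    | (3) "i = t" "t + 2 \<le> j" | (4) "i = Suc t" "t + 2 \<le> j"
    | (5) "j = t" "i < t" | (6) "j = Suc t" "i < t"
    using S(2) by linarith
  then show "\<nu> t v q = u q"
  proof cases
    case 1
    then show ?thesis using assms(5)[OF S(4)] nu_coord_disjoint[OF t v S(4)] ij by simp
  next
    case 2
    then show ?thesis using assms(10) nu_coord_diag[OF t v] ij by simp
  next
    case 3
    then obtain d where "j = t + 2 + d" using le_Suc_ex by blast
    with 3 show ?thesis using assms(6)[of d] nu_coord_left(1)[OF t v, of j] S ij by simp
  next
    case 4
    then obtain d where "j = t + 2 + d" using le_Suc_ex by blast
    with 4 show ?thesis using assms(7)[of d] nu_coord_left(2)[OF t v, of j] S ij by simp
  next
    case 5
    then obtain d where "t = Suc (i + d)" using less_iff_Suc_add by blast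
    with 5 show ?thesis using assms(8)[of i d] nu_coord_right(1)[OF t v, of i] S ij by simp
  next
    case 6
    then obtain d where "t = Suc (i + d)" using less_iff_Suc_add by blast
    with 6 show ?thesis using assms(9)[of i d] nu_coord_right(2)[OF t v, of i] S ij by simp
  qed
qed (use u v in auto)

text \<open>
  The eigenvector of \<open>\<nu> k\<close> for the eigenvalue \<open>-1 / r\<close> on which every \<open>\<nu> t\<close> with \<open>\<bar>t - k\<bar> \<ge> 2\<close> acts by \<open>r\<close>;
  the entry at \<open>(k, k + 1)\<close> is forced by the action of \<open>\<nu> (k + 1)\<close>.
\<close>

definition refl_vec :: "nat \<Rightarrow> nat \<times> nat \<Rightarrow> complex" where
  "refl_vec k = (\<lambda>(i, j)\<in>S.
     if i = k then if j = Suc k then 1 / r - 1 / l else r ^ (j - k - 2)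
     else if i = Suc k then - (r ^ (j - k - 2) / r)
     else if j = k then 1 / (l * r ^ (k - 1 - i))
     else if j = Suc k then - (1 / (l * r ^ (k - 1 - i) * r))
     else 0)"

lemma refl_vec_closed [simp]: "refl_vec k \<in> carrier V"
  unfolding lk_space_carrier refl_vec_def by (intro PiE_I) auto

lemma refl_vec_apply:
  "1 \<le> i \<Longrightarrow> i < j \<Longrightarrow> j \<le> n \<Longrightarrow> refl_vec k (i, j) =
    (if i = k then if j = Suc k then 1 / r - 1 / l else r ^ (j - k - 2)
     else if i = Suc k then - (r ^ (j - k - 2) / r)
     else if j = k then 1 / (l * r ^ (k - 1 - i))
     else if j = Suc k then - (1 / (l * r ^ (k - 1 - i) * r))
     else 0)"
  by (simp add: refl_vec_def S_iff)

lemma geometric_sum_up: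
  assumes "k < n"
  shows "m * (\<Sum>j=k+2..n. r ^ (j - k - 2) * r ^ (j - k - 2)) = (1 - r ^ (2 * (n - k - 1))) / r"
proof -
  have "(\<Sum>j=k+2..n. r ^ (j - k - 2) * r ^ (j - k - 2)) = (\<Sum>d<n - k - 1. (r\<^sup>2) ^ d)"
    by (intro sum.reindex_bij_witness[of _ "\<lambda>d. d + k + 2" "\<lambda>j. j - k - 2"])
       (auto simp: power_mult[symmetric] mult_2 power_add[symmetric])
  moreover have "(1 - r\<^sup>2) * (\<Sum>d<n - k - 1. (r\<^sup>2) ^ d) = 1 - (r\<^sup>2) ^ (n - k - 1)"
    by (simp add: one_diff_power_eq)
  moreover have "m = (1 - r\<^sup>2) / r" using r0 by (simp add: bmw_m_def field_simps power2_eq_square)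
  ultimately show ?thesis by (simp add: power_mult)
qed

lemma geometric_sum_down:
  assumes "1 \<le> k"
  shows "m * (\<Sum>i=1..<k. 1 / (r ^ (k - 1 - i) * r ^ (k - 1 - i))) = r * (1 / r ^ (2 * (k - 1)) - 1)"
proof -
  have "(\<Sum>i=1..<k. 1 / (r ^ (k - 1 - i) * r ^ (k - 1 - i))) = (\<Sum>d<k - 1. (1 / r\<^sup>2) ^ d)"
    by (intro sum.reindex_bij_witness[of _ "\<lambda>d. k - 1 - d" "\<lambda>i. k - 1 - i"])
       (auto simp: power_mult[symmetric] mult_2 power_add[symmetric] power_one_over)
  moreover have "m = - r * (1 - 1 / r\<^sup>2)" using r0 by (simp add: bmw_m_def field_simps power2_eq_square)
  ultimately have "m * (\<Sum>i=1..<k. 1 / (r ^ (k - 1 - i) * r ^ (k - 1 - i)))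
      = - r * ((1 - 1 / r\<^sup>2) * (\<Sum>d<k - 1. (1 / r\<^sup>2) ^ d))"
    by (simp only: mult.assoc)
  also have "(1 - 1 / r\<^sup>2) * (\<Sum>d<k - 1. (1 / r\<^sup>2) ^ d) = 1 - (1 / r\<^sup>2) ^ (k - 1)"
    by (rule one_diff_power_eq[symmetric])
  also have "(1 / r\<^sup>2) ^ (k - 1) = 1 / r ^ (2 * (k - 1))"
    by (simp only: power_one_over power_mult)
  finally show ?thesis by (simp add: algebra_simps)
qed

end

section \<open>The invariant subspace spanned by the reflection vectors\<close>

context lk_semisimple
begin

interpretation V: vectorspace F V
  by (rule lk_space_vectorspace)

context
  assumes l_r: "l\<^sup>2 * r ^ (2 * (n - 3)) = 1"
begin

text \<open>The form in which the condition on \<open>l\<close> enters: the row sum in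
  \<open>nu_coord_diag\<close> produces \<open>r ^ (2 * (n - k - 1))\<close>, the column sum
  produces \<open>1 / l\<^sup>2 / r ^ (2 * (k - 1))\<close>, and the two have to cancel.\<close>

lemma l_powers:
  assumes "1 \<le> k" "k < n"
  shows "1 / l\<^sup>2 / r ^ (2 * (k - 1)) = r ^ (2 * (n - k - 1)) / r\<^sup>2"
proof -
  have e: "2 * (n - k - 1) + 2 * (k - 1) = 2 * (n - 3) + 2" using assms n3 by simp
  have "r ^ (2 * (n - k - 1)) * r ^ (2 * (k - 1)) = r ^ (2 * (n - 3)) * r\<^sup>2"
    by (simp only: power_add[symmetric] e)
  then have "l\<^sup>2 * (r ^ (2 * (n - k - 1)) * r ^ (2 * (k - 1))) = r\<^sup>2"
    using l_r by (simp add: mult.assoc[symmetric])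
  then show ?thesis using r0 l0 by (simp add: field_simps)
qed

lemma nu_refl_vec_same:
  assumes k: "1 \<le> k" "k < n"
  shows "\<nu> k (refl_vec k) = (- 1 / r) \<odot>\<^bsub>V\<^esub> refl_vec k"
proof (rule nu_eqI[OF k])
  have "(\<Sum>j=k+2..n. r ^ (j - k - 2) * refl_vec k (Suc k, j))
      = (\<Sum>j=k+2..n. (- 1 / r) * (r ^ (j - k - 2) * r ^ (j - k - 2)))"
    using k by (intro sum.cong) (auto simp: refl_vec_apply)
  then have "m * (\<Sum>j=k+2..n. r ^ (j - k - 2) * refl_vec k (Suc k, j))
      = (- 1 / r) * (m * (\<Sum>j=k+2..n. r ^ (j - k - 2) * r ^ (j - k - 2)))"
    by (simp only: sum_distrib_left[symmetric] mult.left_commute)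
  then have up: "m * (\<Sum>j=k+2..n. r ^ (j - k - 2) * refl_vec k (Suc k, j))
      = (r ^ (2 * (n - k - 1)) - 1) / r\<^sup>2"
    unfolding geometric_sum_up[OF k(2)] using r0 by (simp add: field_simps power2_eq_square)
  have "(\<Sum>i=1..<k. refl_vec k (i, Suc k) / r ^ (k - 1 - i))
      = (- 1 / (l * r)) * (\<Sum>i=1..<k. 1 / (r ^ (k - 1 - i) * r ^ (k - 1 - i)))"
    unfolding sum_distrib_left using k by (intro sum.cong) (auto simp: refl_vec_apply)
  then have "m / l * (\<Sum>i=1..<k. refl_vec k (i, Suc k) / r ^ (k - 1 - i))
      = (- 1 / (l\<^sup>2 * r)) * (m * (\<Sum>i=1..<k. 1 / (r ^ (k - 1 - i) * r ^ (k - 1 - i))))"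
    by (simp add: power2_eq_square)
  also have "\<dots> = 1 / l\<^sup>2 - 1 / l\<^sup>2 / r ^ (2 * (k - 1))"
    unfolding geometric_sum_down[OF k(1)] using r0 l0 by (simp add: field_simps)
  finally have down: "m / l * (\<Sum>i=1..<k. refl_vec k (i, Suc k) / r ^ (k - 1 - i))
      = 1 / l\<^sup>2 - r ^ (2 * (n - k - 1)) / r\<^sup>2"
    unfolding l_powers[OF k] .
  have C: "refl_vec k (k, Suc k) = 1 / r - 1 / l"
    using k by (simp add: refl_vec_apply)
  have S: "(k, Suc k) \<in> S" using k by (simp add: S_iff)
  show "refl_vec k (k, Suc k) / l + m * (\<Sum>j=k+2..n. r ^ (j - k - 2) * refl_vec k (Suc k, j))
       + m / l * (\<Sum>i=1..<k. refl_vec k (i, Suc k) / r ^ (k - 1 - i)) = ((- 1 / r) \<odot>\<^bsub>V\<^esub> refl_vec k) (k, Suc k)"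
    unfolding up down lk_space_smult[OF S] C by (simp add: diff_divide_distrib algebra_simps power2_eq_square)
qed (use k r0 l0 in \<open>auto simp: refl_vec_apply lk_space_pointwise S_iff bmw_m_def field_simps\<close>)

lemma power_Suc_minus: "0 < d \<Longrightarrow> r * r ^ (d - Suc 0) = r ^ d"
  by (cases d) auto

lemma nu_refl_vec_Suc:
  assumes k: "1 \<le> k" "Suc k < n"
  shows "\<nu> (Suc k) (refl_vec k) = r \<odot>\<^bsub>V\<^esub> refl_vec k \<oplus>\<^bsub>V\<^esub> r \<odot>\<^bsub>V\<^esub> refl_vec (Suc k)"
proof (rule nu_eqI)
  have up: "(\<Sum>j=Suc k+2..n. r ^ (j - Suc k - 2) * refl_vec k (Suc (Suc k), j)) = 0"
    using k by (intro sum.neutral) (auto simp: refl_vec_apply)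
  have "(\<Sum>i=1..<Suc k. refl_vec k (i, Suc (Suc k)) / r ^ (Suc k - 1 - i)) = (\<Sum>i=1..<Suc k. if i = k then 1 else 0)"
    using k by (intro sum.cong) (auto simp: refl_vec_apply)
  then have down: "(\<Sum>i=1..<Suc k. refl_vec k (i, Suc (Suc k)) / r ^ (Suc k - 1 - i)) = 1"
    using k by simp
  show "refl_vec k (Suc k, Suc (Suc k)) / l + m * (\<Sum>j=Suc k+2..n. r ^ (j - Suc k - 2) * refl_vec k (Suc (Suc k), j))
       + m / l * (\<Sum>i=1..<Suc k. refl_vec k (i, Suc (Suc k)) / r ^ (Suc k - 1 - i))
       = (r \<odot>\<^bsub>V\<^esub> refl_vec k \<oplus>\<^bsub>V\<^esub> r \<odot>\<^bsub>V\<^esub> refl_vec (Suc k)) (Suc k, Suc (Suc k))"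
    unfolding up down using k r0 l0
    by (simp add: refl_vec_apply lk_space_pointwise S_iff bmw_m_def field_simps)
qed (use k r0 l0 in \<open>auto simp: power_Suc_minus refl_vec_apply lk_space_pointwise S_iff bmw_m_def field_simps\<close>)

lemma nu_refl_vec_pred:
  assumes k: "1 \<le> k" "Suc k < n"
  shows "\<nu> k (refl_vec (Suc k)) = r \<odot>\<^bsub>V\<^esub> refl_vec (Suc k) \<oplus>\<^bsub>V\<^esub> (1 / r) \<odot>\<^bsub>V\<^esub> refl_vec k"
proof (rule nu_eqI)
  have S: "(k, Suc k) \<in> S" using k by (simp add: S_iff)
  \<comment> \<open>The first term is the exceptional entry at \<open>(k + 1, k + 2)\<close> and is
    split off; the others form a geometric series.\<close>
  have "(\<Sum>j=k+2..n. r ^ (j - k - 2) * refl_vec (Suc k) (Suc k, j))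
      = (\<Sum>j=Suc k+2..n. r ^ (j - k - 2) * refl_vec (Suc k) (Suc k, j)) + refl_vec (Suc k) (Suc k, Suc (Suc k))"
    using k by (subst sum.atLeast_Suc_atMost) auto
  also have "(\<Sum>j=Suc k+2..n. r ^ (j - k - 2) * refl_vec (Suc k) (Suc k, j))
      = r * (\<Sum>j=Suc k+2..n. r ^ (j - Suc k - 2) * r ^ (j - Suc k - 2))"
    unfolding sum_distrib_left
  proof (rule sum.cong[OF HOL.refl])
    fix j assume j: "j \<in> {Suc k + 2..n}"
    then have "j - k - 2 = Suc (j - Suc k - 2)" by auto
    then show "r ^ (j - k - 2) * refl_vec (Suc k) (Suc k, j) = r * (r ^ (j - Suc k - 2) * r ^ (j - Suc k - 2))"
      using k j by (simp add: refl_vec_apply)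
  qed
  also have "refl_vec (Suc k) (Suc k, Suc (Suc k)) = 1 / r - 1 / l"
    using k by (simp add: refl_vec_apply)
  finally have "m * (\<Sum>j=k+2..n. r ^ (j - k - 2) * refl_vec (Suc k) (Suc k, j))
      = m * (r * (\<Sum>j=Suc k+2..n. r ^ (j - Suc k - 2) * r ^ (j - Suc k - 2)) + (1 / r - 1 / l))"
    by (rule arg_cong)
  then have "m * (\<Sum>j=k+2..n. r ^ (j - k - 2) * refl_vec (Suc k) (Suc k, j))
      = r * (m * (\<Sum>j=Suc k+2..n. r ^ (j - Suc k - 2) * r ^ (j - Suc k - 2))) + m * (1 / r - 1 / l)"
    by (simp only: ring_distribs mult.left_commute)
  then have up: "m * (\<Sum>j=k+2..n. r ^ (j - k - 2) * refl_vec (Suc k) (Suc k, j))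
      = 1 - r ^ (2 * (n - Suc k - 1)) + m * (1 / r - 1 / l)"
    unfolding geometric_sum_up[OF k(2)] using r0 by simp
  have "(\<Sum>i=1..<k. refl_vec (Suc k) (i, Suc k) / r ^ (k - 1 - i))
      = (1 / (l * r)) * (\<Sum>i=1..<k. 1 / (r ^ (k - 1 - i) * r ^ (k - 1 - i)))"
    unfolding sum_distrib_left
  proof (rule sum.cong[OF HOL.refl])
    fix i assume i: "i \<in> {1..<k}"
    then have "k - i = Suc (k - 1 - i)" by auto
    then show "refl_vec (Suc k) (i, Suc k) / r ^ (k - 1 - i) = (1 / (l * r)) * (1 / (r ^ (k - 1 - i) * r ^ (k - 1 - i)))"
      using k i by (simp add: refl_vec_apply)
  qed
  then have "m / l * (\<Sum>i=1..<k. refl_vec (Suc k) (i, Suc k) / r ^ (k - 1 - i))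
      = (1 / (l\<^sup>2 * r)) * (m * (\<Sum>i=1..<k. 1 / (r ^ (k - 1 - i) * r ^ (k - 1 - i))))"
    by (simp add: power2_eq_square)
  also have "\<dots> = 1 / l\<^sup>2 / r ^ (2 * (k - 1)) - 1 / l\<^sup>2"
    unfolding geometric_sum_down[OF k(1)] using r0 l0 by (simp add: field_simps)
  also have "1 / l\<^sup>2 / r ^ (2 * (k - 1)) = r ^ (2 * (n - Suc k - 1))"
  proof -
    have "2 * (n - k - 1) = 2 * (n - Suc k - 1) + 2" using k by simp
    then have "r ^ (2 * (n - k - 1)) = r ^ (2 * (n - Suc k - 1)) * r\<^sup>2" by (simp only: power_add)
    then show ?thesis using l_powers[of k] k r0 by simp
  qed
  finally have down: "m / l * (\<Sum>i=1..<k. refl_vec (Suc k) (i, Suc k) / r ^ (k - 1 - i))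
      = r ^ (2 * (n - Suc k - 1)) - 1 / l\<^sup>2" .
  have C: "refl_vec (Suc k) (k, Suc k) = 1 / l" "refl_vec k (k, Suc k) = 1 / r - 1 / l"
    using k by (simp_all add: refl_vec_apply)
  show "refl_vec (Suc k) (k, Suc k) / l + m * (\<Sum>j=k+2..n. r ^ (j - k - 2) * refl_vec (Suc k) (Suc k, j))
       + m / l * (\<Sum>i=1..<k. refl_vec (Suc k) (i, Suc k) / r ^ (k - 1 - i))
       = (r \<odot>\<^bsub>V\<^esub> refl_vec (Suc k) \<oplus>\<^bsub>V\<^esub> (1 / r) \<odot>\<^bsub>V\<^esub> refl_vec k) (k, Suc k)"
    unfolding up down lk_space_pointwise[OF S] C using r0 l0
    by (simp add: bmw_m_def field_simps power2_eq_square)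
qed (use k r0 l0 in \<open>auto simp: power_Suc_minus refl_vec_apply lk_space_pointwise S_iff bmw_m_def field_simps\<close>)

lemma nu_refl_vec_far:
  assumes k: "1 \<le> k" "k < n" "1 \<le> t" "t < n" "k + 2 \<le> t \<or> t + 2 \<le> k"
  shows "\<nu> t (refl_vec k) = r \<odot>\<^bsub>V\<^esub> refl_vec k"
  using k(5)
proof
  assume "k + 2 \<le> t"
  then obtain e where e: "t = k + 2 + e" using le_Suc_ex by blast
  show ?thesis
  proof (rule nu_eqI)
    have up: "(\<Sum>j=t+2..n. r ^ (j - t - 2) * refl_vec k (Suc t, j)) = 0"
      using k e by (intro sum.neutral) (auto simp: refl_vec_apply)
    \<comment> \<open>Column \<open>t + 1\<close> of \<open>refl_vec k\<close> is supported on rows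
      \<open>k\<close> and \<open>k + 1\<close>; after rescaling the two entries are 1 and
      -1.\<close>
    have "(\<Sum>i=1..<t. refl_vec k (i, Suc t) / r ^ (t - 1 - i))
        = (\<Sum>i=1..<t. (if i = k then 1 else 0) + (if i = Suc k then - 1 else 0))"
      using k e r0 by (intro sum.cong) (auto simp: refl_vec_apply)
    also have "\<dots> = 0" unfolding sum.distrib using k e by simp
    finally show "refl_vec k (t, Suc t) / l + m * (\<Sum>j=t+2..n. r ^ (j - t - 2) * refl_vec k (Suc t, j))
       + m / l * (\<Sum>i=1..<t. refl_vec k (i, Suc t) / r ^ (t - 1 - i)) = (r \<odot>\<^bsub>V\<^esub> refl_vec k) (t, Suc t)"
      unfolding up using k e by (simp add: refl_vec_apply lk_space_pointwise S_iff)
  qed (use k e r0 l0 in \<open>auto simp: refl_vec_apply lk_space_pointwise S_iff bmw_m_def field_simps\<close>)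
next
  assume "t + 2 \<le> k"
  then obtain e where e: "k = t + 2 + e" using le_Suc_ex by blast
  show ?thesis
  proof (rule nu_eqI)
    have down: "(\<Sum>i=1..<t. refl_vec k (i, Suc t) / r ^ (t - 1 - i)) = 0"
      using k e by (intro sum.neutral) (auto simp: refl_vec_apply)
    have "(\<Sum>j=t+2..n. r ^ (j - t - 2) * refl_vec k (Suc t, j))
        = (\<Sum>j=t+2..n. (if j = k then 1 / l else 0) + (if j = Suc k then - 1 / l else 0))"
      using k e r0 by (intro sum.cong) (auto simp: refl_vec_apply)
    also have "\<dots> = 0" unfolding sum.distrib using k e by simp
    finally show "refl_vec k (t, Suc t) / l + m * (\<Sum>j=t+2..n. r ^ (j - t - 2) * refl_vec k (Suc t, j))
       + m / l * (\<Sum>i=1..<t. refl_vec k (i, Suc t) / r ^ (t - 1 - i)) = (r \<odot>\<^bsub>V\<^esub> refl_vec k) (t, Suc t)"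
      unfolding down using k e by (simp add: refl_vec_apply lk_space_pointwise S_iff)
  qed (use k e r0 l0 in \<open>auto simp: refl_vec_apply lk_space_pointwise S_iff bmw_m_def field_simps\<close>)
qed

text \<open>
  \<open>\<nu> t - r\<close> maps the combination of the \<open>refl_vec k\<close> with coefficients \<open>c\<close> to \<open>refl_coeff t c\<close> times \<open>refl_vec t\<close>,
  under the convention \<open>c 0 = c n = 0\<close>.
\<close>

definition refl_coeff :: "nat \<Rightarrow> (nat \<Rightarrow> complex) \<Rightarrow> complex" where
  "refl_coeff t c = r * c (t - 1) - (r + 1 / r) * c t + c (Suc t) / r"

definition refl_space :: "(nat \<times> nat \<Rightarrow> complex) set" where
  "refl_space = {comb c refl_vec {1..<n} |c. c \<in> {1..<n} \<rightarrow> carrier F}"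

text \<open>All relative positions of \<open>k\<close> and \<open>t\<close> in one rank-one formula;
  the case \<open>k = t\<close> fits because \<open>- 1 / r = r - (r + 1 / r)\<close>.\<close>

lemma nu_refl_vec:
  assumes "1 \<le> k" "k < n" "1 \<le> t" "t < n" "q \<in> S"
  shows "\<nu> t (refl_vec k) q = r * refl_vec k q +
    ((if Suc k = t then r else 0) - (if k = t then r + 1 / r else 0) + (if k = Suc t then 1 / r else 0)) * refl_vec t q"
proof -
  consider "k = t" | "Suc k = t" | "k = Suc t" | "k + 2 \<le> t \<or> t + 2 \<le> k" by linarith
  then show ?thesis
  proof cases
    case 1
    then show ?thesis using nu_refl_vec_same[of k] assms by (simp add: lk_space_pointwise algebra_simps)
  next
    case 2
    then show ?thesis using nu_refl_vec_Suc[of k] assms by (auto simp: lk_space_pointwise)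
  next
    case 3
    then show ?thesis using nu_refl_vec_pred[of t] assms by (simp add: lk_space_pointwise)
  next
    case 4
    then show ?thesis using nu_refl_vec_far[of k t] assms by (auto simp: lk_space_pointwise)
  qed
qed

lemma comb_refl_closed [simp]:
  "c \<in> {1..<n} \<rightarrow> carrier F \<Longrightarrow> comb c refl_vec {1..<n} \<in> carrier V"
  by (rule comb_closed) auto

lemma comb_refl_apply:
  assumes "c \<in> {1..<n} \<rightarrow> carrier F" "q \<in> S"
  shows "comb c refl_vec {1..<n} q = (\<Sum>k=1..<n. c k * refl_vec k q)"
  using assms by (intro comb_apply) auto

lemma nu_comb_refl:
  assumes c: "c \<in> {1..<n} \<rightarrow> carrier F" "c 0 = 0" "c n = 0" and t: "1 \<le> t" "t < n" and q: "q \<in> S"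
  shows "\<nu> t (comb c refl_vec {1..<n}) q = r * comb c refl_vec {1..<n} q + refl_coeff t c * refl_vec t q"
proof -
  have V: "refl_vec \<in> {1..<n} \<rightarrow> carrier V" by auto
  have "\<nu> t (comb c refl_vec {1..<n}) q = comb c (\<lambda>k. \<nu> t (refl_vec k)) {1..<n} q"
    by (subst lin_comb[OF lin_nu _ c(1) V]) auto
  also have "\<dots> = (\<Sum>k=1..<n. c k * \<nu> t (refl_vec k) q)"
    by (rule comb_apply[OF _ c(1) _ q]) auto
  also have "\<dots> = (\<Sum>k=1..<n. r * (c k * refl_vec k q)
      + ((if k = t - 1 then r * c (t - 1) else 0) - (if k = t then (r + 1 / r) * c t else 0)
        + (if k = Suc t then c (Suc t) / r else 0)) * refl_vec t q)"
  proof (rule sum.cong[OF HOL.refl])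
    fix k assume k: "k \<in> {1..<n}"
    then have *: "1 \<le> k" "k < n" by auto
    have e: "k = t - 1 \<longleftrightarrow> Suc k = t" using * t by auto
    show "c k * \<nu> t (refl_vec k) q = r * (c k * refl_vec k q)
      + ((if k = t - 1 then r * c (t - 1) else 0) - (if k = t then (r + 1 / r) * c t else 0)
        + (if k = Suc t then c (Suc t) / r else 0)) * refl_vec t q"
      unfolding nu_refl_vec[OF * t q] e
    proof -
      consider "Suc k = t" | "k = t" | "k = Suc t" | "Suc k \<noteq> t" "k \<noteq> t" "k \<noteq> Suc t" by blast
      then show "c k * (r * refl_vec k q + ((if Suc k = t then r else 0) - (if k = t then r + 1 / r else 0)
          + (if k = Suc t then 1 / r else 0)) * refl_vec t q) = r * (c k * refl_vec k q)
        + ((if Suc k = t then r * c (t - 1) else 0) - (if k = t then (r + 1 / r) * c t else 0)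
          + (if k = Suc t then c (Suc t) / r else 0)) * refl_vec t q"
        by cases (auto simp: algebra_simps)
    qed
  qed
  also have "\<dots> = r * comb c refl_vec {1..<n} q
      + ((\<Sum>k=1..<n. if k = t - 1 then r * c (t - 1) else 0) - (\<Sum>k=1..<n. if k = t then (r + 1 / r) * c t else 0)
        + (\<Sum>k=1..<n. if k = Suc t then c (Suc t) / r else 0)) * refl_vec t q"
    unfolding comb_refl_apply[OF c(1) q]
    by (simp only: sum.distrib sum_subtractf sum_distrib_left sum_distrib_right[symmetric])
  also have "(\<Sum>k=1..<n. if k = t - 1 then r * c (t - 1) else 0) = r * c (t - 1)"
    using t c(2) by auto
  also have "(\<Sum>k=1..<n. if k = t then (r + 1 / r) * c t else 0) = (r + 1 / r) * c t"
    using t by auto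
  also have "(\<Sum>k=1..<n. if k = Suc t then c (Suc t) / r else 0) = c (Suc t) / r"
    using t c(3) by (cases "Suc t = n") auto
  finally show ?thesis by (simp add: refl_coeff_def)
qed

text \<open>By the recurrence, successive differences of \<open>c\<close> are geometric with ratio
  \<open>r\<^sup>2\<close>. Starting from \<open>c 0 = 0\<close>, this makes \<open>c n\<close> a
  multiple of \<open>c 1\<close> by a geometric sum of \<open>n\<close> terms, which is
  nonzero.\<close>

lemma refl_coeff_zero:
  assumes c: "c 0 = 0" "c n = 0" and z: "\<And>t. 1 \<le> t \<Longrightarrow> t < n \<Longrightarrow> refl_coeff t c = 0" and k: "k \<le> n"
  shows "c k = 0"
proof -
  have rec: "c (Suc t) = (r\<^sup>2 + 1) * c t - r\<^sup>2 * c (t - 1)" if "1 \<le> t" "t < n" for t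
    using z[OF that] r0 by (simp add: refl_coeff_def field_simps power2_eq_square)
  have step: "c (Suc t) - c t = (r\<^sup>2) ^ t * c 1" if "t < n" for t
    using that
  proof (induction t)
    case (Suc t)
    then show ?case using rec[of "Suc t"] by (simp add: algebra_simps)
  qed (simp add: c)
  have sum: "c t = (\<Sum>i<t. (r\<^sup>2) ^ i) * c 1" if "t \<le> n" for t
    using that
  proof (induction t)
    case (Suc t)
    then show ?case using step[of t] by (simp add: algebra_simps)
  qed (simp add: c)
  have "(1 - r\<^sup>2) * (\<Sum>i<n. (r\<^sup>2) ^ i) = 1 - (r\<^sup>2) ^ n" by (simp add: one_diff_power_eq)
  moreover have "(r\<^sup>2) ^ n \<noteq> 1" using r_pow[of n] n3 by (simp add: power_mult)
  ultimately have "(\<Sum>i<n. (r\<^sup>2) ^ i) \<noteq> 0" by auto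
  then have "c 1 = 0" using sum[of n] c by simp
  then show ?thesis using sum[OF k] by simp
qed

lemma refl_vec_nonzero:
  assumes "1 \<le> k" "k < n"
  shows "\<exists>q\<in>S. refl_vec k q \<noteq> 0"
proof (cases "k + 2 \<le> n")
  case True
  then have "refl_vec k (k, k + 2) \<noteq> 0" "(k, k + 2) \<in> S" using assms by (simp_all add: refl_vec_apply S_iff)
  then show ?thesis by blast
next
  case False
  define k' where "k' = k - 1"
  have "k = Suc k'" "1 \<le> k'" "Suc k' \<le> n"
    using False assms n3 by (auto simp: k'_def)
  then have "refl_vec k (k', k) \<noteq> 0" "(k', k) \<in> S"
    using l0 by (simp_all add: refl_vec_apply S_iff)
  then show ?thesis by blast
qed

lemma refl_indep:
  assumes c: "c \<in> {1..<n} \<rightarrow> carrier F" "c 0 = 0" "c n = 0"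
    and z: "\<And>t q. 1 \<le> t \<Longrightarrow> t < n \<Longrightarrow> q \<in> S \<Longrightarrow>
      \<nu> t (comb c refl_vec {1..<n}) q = r * comb c refl_vec {1..<n} q"
    and k: "k \<le> n"
  shows "c k = 0"
proof (rule refl_coeff_zero[OF c(2,3) _ k])
  fix t assume t: "1 \<le> t" "t < n"
  obtain q where "q \<in> S" "refl_vec t q \<noteq> 0" using refl_vec_nonzero[OF t] by blast
  then show "refl_coeff t c = 0" using nu_comb_refl[OF c t, of q] z[OF t, of q] by simp
qed

lemma refl_space_comb:
  assumes "v \<in> refl_space"
  obtains c where "c \<in> {1..<n} \<rightarrow> carrier F" "c 0 = 0" "c n = 0" "v = comb c refl_vec {1..<n}"
proof -
  obtain c where c: "c \<in> {1..<n} \<rightarrow> carrier F" "v = comb c refl_vec {1..<n}"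
    using assms by (auto simp: refl_space_def)
  \<comment> \<open>Values outside \<open>{1..<n}\<close> do not affect the combination; they are
    reset to meet the boundary convention of \<open>refl_coeff\<close>.\<close>
  define c' where "c' k = (if k = 0 \<or> k = n then 0 else c k)" for k
  have c': "c' \<in> {1..<n} \<rightarrow> carrier F" using c by (auto simp: c'_def)
  have "v = comb c' refl_vec {1..<n}"
    unfolding c(2)
  proof (rule V_ext)
    fix q assume "q \<in> S"
    then show "comb c refl_vec {1..<n} q = comb c' refl_vec {1..<n} q"
      unfolding comb_refl_apply[OF c(1) \<open>q \<in> S\<close>] comb_refl_apply[OF c' \<open>q \<in> S\<close>]
      by (intro sum.cong) (auto simp: c'_def)
  qed (simp_all only: comb_refl_closed c c')
  then show thesis using that[of c'] c' by (simp add: c'_def)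
qed

lemma refl_vec_in_space:
  assumes "1 \<le> k" "k < n"
  shows "refl_vec k \<in> refl_space"
proof -
  define c where "c t = (if t = k then 1 else (0::complex))" for t
  have c: "c \<in> {1..<n} \<rightarrow> carrier F" by (auto simp: c_def)
  have "refl_vec k = comb c refl_vec {1..<n}"
  proof (rule V_ext)
    fix q assume q: "q \<in> S"
    have "comb c refl_vec {1..<n} q = (\<Sum>t=1..<n. if t = k then refl_vec k q else 0)"
      unfolding comb_refl_apply[OF c q] by (intro sum.cong) (auto simp: c_def)
    then show "refl_vec k q = comb c refl_vec {1..<n} q" using assms by simp
  qed (simp_all only: comb_refl_closed refl_vec_closed c)
  then show ?thesis using c by (auto simp: refl_space_def)
qed

lemma refl_space_subspace: "subspace F refl_space V"
proof (rule subspaceI)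
  show "refl_space \<subseteq> carrier V" by (auto simp: refl_space_def intro!: comb_closed)
  have "\<zero>\<^bsub>V\<^esub> = comb (\<lambda>_. 0) refl_vec {1..<n}"
    by (rule V_ext) (simp_all only: comb_refl_apply comb_refl_closed Pi_I bmw_field_closed lk_space_zero
        V.M.zero_closed mult_zero_left sum.neutral_const)
  then show "\<zero>\<^bsub>V\<^esub> \<in> refl_space" by (auto simp: refl_space_def)
  fix v assume "v \<in> refl_space"
  then obtain c where c: "c \<in> {1..<n} \<rightarrow> carrier F" "v = comb c refl_vec {1..<n}"
    by (auto simp: refl_space_def)
  have vV: "v \<in> carrier V" unfolding c(2) by (rule comb_refl_closed[OF c(1)])
  show "v \<oplus>\<^bsub>V\<^esub> v' \<in> refl_space" if v': "v' \<in> refl_space" for v'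
  proof -
    obtain c' where c': "c' \<in> {1..<n} \<rightarrow> carrier F" "v' = comb c' refl_vec {1..<n}"
      using v' by (auto simp: refl_space_def)
    have vV': "v' \<in> carrier V" unfolding c'(2) by (rule comb_refl_closed[OF c'(1)])
    have cc: "(\<lambda>k. c k + c' k) \<in> {1..<n} \<rightarrow> carrier F" using c(1) c'(1) by (auto simp: Pi_iff)
    have "v \<oplus>\<^bsub>V\<^esub> v' = comb (\<lambda>k. c k + c' k) refl_vec {1..<n}"
    proof (rule V_ext)
      fix q assume q: "q \<in> S"
      show "(v \<oplus>\<^bsub>V\<^esub> v') q = comb (\<lambda>k. c k + c' k) refl_vec {1..<n} q"
        unfolding lk_space_add[OF q] comb_refl_apply[OF cc q] c(2) c'(2)
          comb_refl_apply[OF c(1) q] comb_refl_apply[OF c'(1) q]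
        by (simp add: sum.distrib ring_distribs)
    qed (simp_all only: comb_refl_closed cc vV vV' V.M.a_closed)
    then show ?thesis using cc by (auto simp: refl_space_def)
  qed
  show "a \<odot>\<^bsub>V\<^esub> v \<in> refl_space" if a: "a \<in> carrier F" for a
  proof -
    have ac: "(\<lambda>k. a * c k) \<in> {1..<n} \<rightarrow> carrier F" using c(1) a by (auto simp: Pi_iff)
    have "a \<odot>\<^bsub>V\<^esub> v = comb (\<lambda>k. a * c k) refl_vec {1..<n}"
    proof (rule V_ext)
      fix q assume q: "q \<in> S"
      show "(a \<odot>\<^bsub>V\<^esub> v) q = comb (\<lambda>k. a * c k) refl_vec {1..<n} q"
        unfolding lk_space_smult[OF q] comb_refl_apply[OF ac q] c(2) comb_refl_apply[OF c(1) q]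
        by (simp add: sum_distrib_left mult.assoc)
    qed (simp_all only: comb_refl_closed ac vV a V.smult_closed)
    then show ?thesis using ac by (auto simp: refl_space_def)
  qed
qed

lemma refl_space_dim: "lk_dim n l r refl_space = n - 1"
proof -
  have "lk_dim n l r refl_space = card {1..<n}"
  proof (rule lk_dim_eq_card[OF refl_space_subspace, of _ refl_vec])
    show "refl_vec \<in> {1..<n} \<rightarrow> refl_space" using refl_vec_in_space by auto
    show "\<exists>c\<in>{1..<n} \<rightarrow> carrier F. v = comb c refl_vec {1..<n}" if "v \<in> refl_space" for v
      using that by (auto simp: refl_space_def)
    fix c p assume c: "c \<in> {1..<n} \<rightarrow> carrier F" "comb c refl_vec {1..<n} = \<zero>\<^bsub>V\<^esub>" and p: "p \<in> {1..<n}"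
    define c' where "c' k = (if k = 0 \<or> k = n then 0 else c k)" for k
    have c': "c' \<in> {1..<n} \<rightarrow> carrier F" using c by (auto simp: c'_def)
    have eq: "comb c' refl_vec {1..<n} = \<zero>\<^bsub>V\<^esub>"
      unfolding c(2)[symmetric]
    proof (rule V_ext)
      fix q assume q: "q \<in> S"
      then show "comb c' refl_vec {1..<n} q = comb c refl_vec {1..<n} q"
        unfolding comb_refl_apply[OF c(1) q] comb_refl_apply[OF c' q]
        by (intro sum.cong) (auto simp: c'_def)
    qed (simp_all only: comb_refl_closed c' c(1))
    have zero: "\<nu> t \<zero>\<^bsub>V\<^esub> q = 0" if "q \<in> S" for t q
      unfolding nu_apply[OF V.M.zero_closed that]
      by (intro sum.neutral ballI) (simp only: lk_space_zero mult_zero_left)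
    have "c' p = 0"
    proof (rule refl_indep[OF c'])
      show "c' 0 = 0" "c' n = 0" by (simp_all add: c'_def)
      show "p \<le> n" using p by simp
      fix t q assume "q \<in> S"
      then show "\<nu> t (comb c' refl_vec {1..<n}) q = r * comb c' refl_vec {1..<n} q"
        unfolding eq by (simp only: zero lk_space_zero mult_zero_right)
    qed
    then show "c p = 0" using p by (simp add: c'_def)
  qed simp
  then show ?thesis by simp
qed

lemma refl_space_invariant: "lk_invariant n l r refl_space"
proof (rule lk_invariantI[OF refl_space_subspace])
  fix t v assume t: "1 \<le> t" "t < n" and v: "v \<in> refl_space"
  obtain c where c: "c \<in> {1..<n} \<rightarrow> carrier F" "c 0 = 0" "c n = 0" "v = comb c refl_vec {1..<n}"
    using refl_space_comb[OF v] .
  have vV: "v \<in> carrier V" using subspace_closed(1)[OF refl_space_subspace v] .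
  have cF: "c k \<in> carrier F" if "k \<le> n" for k
    using that c by (cases "k = 0"; cases "k = n") auto
  have a: "refl_coeff t c \<in> carrier F"
    unfolding refl_coeff_def using cF t
    by (intro bmw_field_add bmw_field_minus bmw_field_mult bmw_field_divide) auto
  have "\<nu> t v = r \<odot>\<^bsub>V\<^esub> v \<oplus>\<^bsub>V\<^esub> refl_coeff t c \<odot>\<^bsub>V\<^esub> refl_vec t"
    using nu_comb_refl[OF c(1-3) t] vV a
    by (intro V_ext) (auto simp: lk_space_pointwise c(4))
  also have "\<dots> \<in> refl_space"
    using v a refl_vec_in_space[OF t] by (intro subspace_closed[OF refl_space_subspace]) auto
  finally show "\<nu> t v \<in> refl_space" .
qed

text \<open>On a nonzero combination some \<open>\<nu> t - r\<close> is nonzero, which puts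
  \<open>refl_vec t\<close> into \<open>U\<close>. The neighbours follow one by one, because
  \<open>\<nu> (Suc k) - r\<close> sends \<open>refl_vec k\<close> to \<open>r\<close> times
  \<open>refl_vec (Suc k)\<close> and \<open>\<nu> k - r\<close> sends
  \<open>refl_vec (Suc k)\<close> to \<open>1 / r\<close> times \<open>refl_vec k\<close>.\<close>

lemma refl_space_irreducible: "lk_irreducible n l r refl_space"
  unfolding lk_irreducible_def
proof (intro conjI allI impI)
  show "lk_invariant n l r refl_space" by (rule refl_space_invariant)
  have "refl_vec 1 \<in> refl_space" "refl_vec 1 \<noteq> \<zero>\<^bsub>V\<^esub>"
    using refl_vec_in_space[of 1] refl_vec_nonzero[of 1] n3 by (auto simp: lk_space_zero)
  then show "refl_space \<noteq> {\<zero>\<^bsub>V\<^esub>}" by blast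
  fix U assume U: "lk_invariant n l r U \<and> U \<subseteq> refl_space"
  have sub: "subspace F U V" using U lk_invariant_subspace by blast
  have reflect: "\<nu> t v \<oplus>\<^bsub>V\<^esub> (- r) \<odot>\<^bsub>V\<^esub> v \<in> U" if "1 \<le> t" "t < n" "v \<in> U" for t v
    using that U lk_invariant_nu by (intro subspace_closed(3,4)[OF sub]) auto
  have isolate: "refl_vec t \<in> U"
    if "1 \<le> t" "t < n" "v \<in> U" "a \<in> carrier F" "a \<noteq> 0" "\<And>q. q \<in> S \<Longrightarrow> \<nu> t v q = r * v q + a * refl_vec t q" for t v a
  proof -
    have "inverse a \<odot>\<^bsub>V\<^esub> (\<nu> t v \<oplus>\<^bsub>V\<^esub> (- r) \<odot>\<^bsub>V\<^esub> v) \<in> U"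
      using reflect[OF that(1-3)] that(4) by (intro subspace_closed(4)[OF sub]) auto
    also have "inverse a \<odot>\<^bsub>V\<^esub> (\<nu> t v \<oplus>\<^bsub>V\<^esub> (- r) \<odot>\<^bsub>V\<^esub> v) = refl_vec t"
      using that(4-6) subspace_closed(1)[OF sub that(3)]
      by (intro V_ext) (auto simp: lk_space_pointwise)
    finally show ?thesis .
  qed
  show "U = {\<zero>\<^bsub>V\<^esub>} \<or> U = refl_space"
  proof (rule disjCI)
    assume "U \<noteq> refl_space"
    show "U = {\<zero>\<^bsub>V\<^esub>}"
    proof (rule ccontr)
      assume "U \<noteq> {\<zero>\<^bsub>V\<^esub>}"
      then obtain u where u: "u \<in> U" "u \<noteq> \<zero>\<^bsub>V\<^esub>" using subspace_closed(2)[OF sub] by blast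
      obtain c where c: "c \<in> {1..<n} \<rightarrow> carrier F" "c 0 = 0" "c n = 0" "u = comb c refl_vec {1..<n}"
        using refl_space_comb[of u] u(1) U by blast
      have "\<exists>t. 1 \<le> t \<and> t < n \<and> refl_coeff t c \<noteq> 0"
      proof (rule ccontr)
        assume "\<not> ?thesis"
        then have "c k = 0" if "k \<le> n" for k using refl_coeff_zero[OF c(2,3) _ that] by blast
        then have "comb c refl_vec {1..<n} q = 0" if "q \<in> S" for q
          unfolding comb_refl_apply[OF c(1) that] by (intro sum.neutral) auto
        then have "u = \<zero>\<^bsub>V\<^esub>"
          using subspace_closed(1)[OF sub u(1)] c(4)
          by (intro V_ext) (auto simp: lk_space_zero)
        with u(2) show False ..
      qed
      then obtain t where t: "1 \<le> t" "t < n" "refl_coeff t c \<noteq> 0" by blast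
      have cF: "c k \<in> carrier F" if "k \<le> n" for k
        using that c by (cases "k = 0"; cases "k = n") auto
      have a: "refl_coeff t c \<in> carrier F"
        unfolding refl_coeff_def using cF t
        by (intro bmw_field_add bmw_field_minus bmw_field_mult bmw_field_divide) auto
      have base: "refl_vec t \<in> U"
        using nu_comb_refl[OF c(1-3) t(1,2)] c(4) by (intro isolate[OF t(1,2) u(1) a t(3)]) simp
      have all: "refl_vec k \<in> U" if k: "1 \<le> k" "k < n" for k
      proof (cases "t \<le> k")
        case True
        then show ?thesis using k(2)
        proof (induction k rule: dec_induct)
          case (step k)
          then show ?case
            using t r0 nu_refl_vec[of k "Suc k"] by (intro isolate[of "Suc k" "refl_vec k" r]) auto
        qed (rule base)
      next
        case False
        then have "k \<le> t" by simp
        then show ?thesis using k(1)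
        proof (induction k rule: inc_induct)
          case (step k)
          then show ?case
            using t r0 nu_refl_vec[of "Suc k" k] by (intro isolate[of k "refl_vec (Suc k)" "1 / r"]) auto
        qed (rule base)
      qed
      have "refl_space \<subseteq> U"
      proof
        fix v assume "v \<in> refl_space"
        then obtain c where "c \<in> {1..<n} \<rightarrow> carrier F" "v = comb c refl_vec {1..<n}"
          by (auto simp: refl_space_def)
        then show "v \<in> U" using subspace_comb[OF sub, of "{1..<n}" c refl_vec] all by auto
      qed
      with U \<open>U \<noteq> refl_space\<close> show False by blast
    qed
  qed
qed

end

end

theorem theoremB:
  fixes n :: nat and l r :: complex
  assumes "3 \<le> n" and "n \<noteq> 4"
    and "l \<noteq> 0" and "r \<noteq> 0"
    and "\<forall>k\<in>{1..n}. (r\<^sup>2) ^ k \<noteq> 1"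
  shows "((\<exists>W. lk_irreducible n l r W \<and> lk_dim n l r W = n - 1)
           \<longleftrightarrow> l \<in> {1 / r ^ (n - 3), - (1 / r ^ (n - 3))})
       \<and> ((\<exists>W. lk_irreducible n l r W \<and> lk_dim n l r W = n - 1)
           \<longrightarrow> (\<exists>!W. lk_irreducible n l r W \<and> lk_dim n l r W = n - 1))"
proof -
  have r_pow: "r ^ (2 * k) \<noteq> 1" if "1 \<le> k" "k \<le> n" for k
    using assms(5) that by (simp add: power_mult)
  interpret lk_semisimple n l r
    using assms(1,3,4) r_pow[of 1] r_pow by unfold_locales auto
  have "\<exists>W. lk_irreducible n l r W \<and> lk_dim n l r W = n - 1" if l: "l \<in> {1 / r ^ (n - 3), - (1 / r ^ (n - 3))}"
  proof -
    \<comment> \<open>The construction assumes a condition on \<open>l\<^sup>2\<close> only, which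
      covers both signs at once.\<close>
    have "l * r ^ (n - 3) = 1 \<or> l * r ^ (n - 3) = - 1" using l assms(4) by auto
    then have "(l * r ^ (n - 3))\<^sup>2 = 1" by auto
    then have "l\<^sup>2 * r ^ (2 * (n - 3)) = 1" by (simp add: power_mult_distrib power_even_eq)
    then show ?thesis using refl_space_irreducible refl_space_dim by blast
  qed
  then show ?thesis
    using irreducible_imp_l[OF assms(2)] subrep_subset_of[OF assms(2)] by (metis subset_antisym)
qed

end
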